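(* Let $\Omega_\lambda$ be a Schubert variety in $G(k,n)$, and let $f\colon Y\to\Omega_\lambda$ be the resolution of singularities described in the context. Then the exceptional components of $f$ are in bijection with the irreducible components of ${\rm Sing}(\Omega_\lambda)$.
   Context: Work over $\mathbb C$, with $0<k<n$. $G(k,n)$ is the Grassmannian of $k$-dimensional subspaces of $\mathbb C^n$, and $F_i\subset\mathbb C^n$ is the span of the last $i$ vectors of the standard basis. For a partition $\lambda=(\lambda_1\ge\dots\ge\lambda_k\ge0)$ with $\lambda_1\le n-k$, put $i_s=s+\lambda_{k+1-s}$ and $\Omega_\lambda=\{V\in G(k,n)\mid\dim V\cap F_{n+1-i_s}\ge k+1-s,\ 1\le s\le k\}$. ${\rm Sing}(\Omega_\lambda)$ is its singular locus. Outside corners: a proper outside corner of $\lambda$ is a pair $(a,b)$ such that the rectangular partition $(b^a)$, with $a$ rows and $b$ columns, is maximal among the rectangular partitions contained in $\lambda$. If no proper outside corner has the form $(a,n-k)$, then $(0,n-k)$ is a virtual outside corner of $\lambda$; if none has the form $(k,b)$, then $(k,0)$ is a virtual outside corner of $\lambda$. An outside corner is a proper or virtual outside corner. List the outside corners as $(a_0,b_0),(a_1,b_1),\ldots,(a_r,b_r),(a_{r+1},b_{r+1})$ with $a_0<a_1<\dots<a_{r+1}$ and $b_0>b_1>\dots>b_{r+1}$. A point $V\in G(k,n)$ belongs to $\Omega_\lambda$ precisely when $\dim V\cap F_{n-k+a_s-b_s}\ge a_s$ for all $0\le s\le r+1$. The resolution: let ${\rm Fl}(a_1,\ldots,a_r,k;n)$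 be the manifold of partial flags $U_1\subset U_2\subset\cdots\subset U_r\subset V\subset\mathbb C^n$ with $\dim U_s=a_s$ and $\dim V=k$. Let $Y\subset{\rm Fl}(a_1,\ldots,a_r,k;n)$ be the subvariety of those flags that verify $U_s\subseteq F_{n-k+a_s-b_s}$ for all $1\le s\le r$; it is a tower of Grassmann bundles, hence smooth and irreducible. The map $f$ is the natural projection $Y\to G(k,n)$ sending a flag $U_1\subset\cdots\subset U_r\subset V$ to $V$. In the construction, $f$ is taken to have image $f(Y)=\Omega_\lambda$, and $f\colon Y\to\Omega_\lambda$ to be a resolution of singularities that is an isomorphism over the smooth locus of $\Omega_\lambda$. The exceptional components of $f$ are the irreducible components of its exceptional locus $f^{-1}({\rm Sing}(\Omega_\lambda))$. *)

theory Defs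
  imports "HOL-Analysis.Analysis" "HOL-Library.Extended_Nat"
begin

section \<open>Affine varieties in coordinate space\<close>

inductive polynomial_fun :: "(complex ^ 'v::finite \<Rightarrow> complex) \<Rightarrow> bool" where
  const: "polynomial_fun (\<lambda>x. c)"
| coord: "polynomial_fun (\<lambda>x. x $ i)"
| add: "polynomial_fun f \<Longrightarrow> polynomial_fun g \<Longrightarrow> polynomial_fun (\<lambda>x. f x + g x)"
| mult: "polynomial_fun f \<Longrightarrow> polynomial_fun g \<Longrightarrow> polynomial_fun (\<lambda>x. f x * g x)"

definition zariski_open :: "(complex ^ 'v::finite) set \<Rightarrow> bool" where
  "zariski_open U \<longleftrightarrow>
     (\<exists>P. (\<forall>f\<in>P. polynomial_fun f) \<and> U = {x. \<exists>f\<in>P. f x \<noteq> 0})"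

lemma istopology_zariski: "istopology zariski_open"
  unfolding istopology_def
proof (intro conjI allI impI)
  fix S T :: "(complex ^ 'v) set"
  assume "zariski_open S" and "zariski_open T"
  then obtain P Q where P: "\<forall>f\<in>P. polynomial_fun f" "S = {x. \<exists>f\<in>P. f x \<noteq> 0}"
    and Q: "\<forall>f\<in>Q. polynomial_fun f" "T = {x. \<exists>f\<in>Q. f x \<noteq> 0}"
    unfolding zariski_open_def by blast
  let ?R = "{\<lambda>x. f x * g x | f g. f \<in> P \<and> g \<in> Q}"
  have "\<forall>h\<in>?R. polynomial_fun h"
    using P(1) Q(1) by (auto intro: polynomial_fun.mult)
  moreover have "S \<inter> T = {x. \<exists>h\<in>?R. h x \<noteq> 0}"
  proof (intro set_eqI iffI)
    fix x assume "x \<in> S \<inter> T"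
    then obtain f g where "f \<in> P" "g \<in> Q" "f x * g x \<noteq> 0"
      using P(2) Q(2) by auto
    then show "x \<in> {x. \<exists>h\<in>?R. h x \<noteq> 0}"
      by (intro CollectI bexI[of _ "\<lambda>x. f x * g x"]) auto
  next
    fix x assume "x \<in> {x. \<exists>h\<in>?R. h x \<noteq> 0}"
    then show "x \<in> S \<inter> T" using P(2) Q(2) by auto
  qed
  ultimately show "zariski_open (S \<inter> T)"
    unfolding zariski_open_def by blast
next
  fix \<K> :: "(complex ^ 'v) set set"
  assume "\<forall>K\<in>\<K>. zariski_open K"
  then obtain P where P: "\<And>K. K \<in> \<K> \<Longrightarrow> \<forall>f\<in>P K. polynomial_fun f"
    "\<And>K x. K \<in> \<K> \<Longrightarrow> x \<in> K \<longleftrightarrow> (\<exists>f\<in>P K. f x \<noteq> 0)"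
    unfolding zariski_open_def set_eq_iff mem_Collect_eq by metis
  have "\<forall>f\<in>\<Union>(P ` \<K>). polynomial_fun f"
    using P(1) by blast
  moreover have "\<Union>\<K> = {x. \<exists>f\<in>\<Union>(P ` \<K>). f x \<noteq> 0}"
  proof (rule set_eqI)
    fix x
    have "x \<in> \<Union>\<K> \<longleftrightarrow> (\<exists>K\<in>\<K>. x \<in> K)" by blast
    also have "\<dots> \<longleftrightarrow> (\<exists>K\<in>\<K>. \<exists>f\<in>P K. f x \<noteq> 0)"
      by (rule bex_cong[OF refl]) (rule P(2))
    also have "\<dots> \<longleftrightarrow> x \<in> {x. \<exists>f\<in>\<Union>(P ` \<K>). f x \<noteq> 0}" by blast
    finally show "x \<in> \<Union>\<K> \<longleftrightarrow> x \<in> {x. \<exists>f\<in>\<Union>(P ` \<K>). f x \<noteq> 0}" .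
  qed
  ultimately show "zariski_open (\<Union>\<K>)"
    unfolding zariski_open_def by blast
qed

definition zariski :: "(complex ^ 'v::finite) topology" where
  "zariski = topology zariski_open"

definition irreducible_in :: "'p topology \<Rightarrow> 'p set \<Rightarrow> bool" where
  "irreducible_in T S \<longleftrightarrow>
     S \<subseteq> topspace T \<and> S \<noteq> {} \<and>
     (\<forall>A B. closedin T A \<and> closedin T B \<and> S \<subseteq> A \<union> B \<longrightarrow> S \<subseteq> A \<or> S \<subseteq> B)"

definition irreducible_components :: "'p topology \<Rightarrow> 'p set \<Rightarrow> 'p set set" where
  "irreducible_components T S =
     {Z. Z \<subseteq> S \<and> irreducible_in T Z \<and>
         (\<forall>Z'. Z' \<subseteq> S \<and> irreducible_in T Z' \<and> Z \<subseteq> Z' \<longrightarrow> Z' = Z)}"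

text \<open>The Zariski tangent space at \<open>p\<close> of the reduced variety \<open>X\<close>: the common kernel of
  the differentials at \<open>p\<close> of all polynomials in the vanishing ideal of \<open>X\<close>.\<close>

definition tangent_space ::
  "(complex ^ 'v::finite) set \<Rightarrow> complex ^ 'v \<Rightarrow> (complex ^ 'v) set" where
  "tangent_space X p =
     {v. \<forall>f. polynomial_fun f \<and> (\<forall>x\<in>X. f x = 0) \<longrightarrow>
           ((\<lambda>t. f (p + t *s v)) has_field_derivative 0) (at 0)}"

text \<open>The Krull dimension of the local ring of \<open>X\<close> at \<open>p\<close>: its chains of primes are the
  chains of irreducible closed subsets of \<open>X\<close> through \<open>p\<close>.\<close>

definition local_dim :: "(complex ^ 'v::finite) set \<Rightarrow> complex ^ 'v \<Rightarrow> enat" where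
  "local_dim X p =
     Sup {enat m | m. \<exists>Z :: nat \<Rightarrow> (complex ^ 'v) set.
        (\<forall>i\<le>m. closedin zariski (Z i) \<and> irreducible_in zariski (Z i) \<and> p \<in> Z i \<and> Z i \<subseteq> X) \<and>
        (\<forall>i<m. Z i \<subset> Z (Suc i))}"

text \<open>The points of a Zariski closed \<open>X\<close> at which the local ring is not regular.\<close>

definition singular_points :: "(complex ^ 'v::finite) set \<Rightarrow> (complex ^ 'v) set" where
  "singular_points X = {p \<in> X. enat (vec.dim (tangent_space X p)) \<noteq> local_dim X p}"


section \<open>Grassmannians and partial flag manifolds\<close>

definition grassmannian :: "nat \<Rightarrow> (complex ^ 'n::finite) set set" where
  "grassmannian k = {V. vec.subspace V \<and> vec.dim V = k}"

definition partial_flags :: "nat list \<Rightarrow> (complex ^ 'n::finite) set list set" where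
  "partial_flags ds =
     {Us. list_all2 (\<lambda>U d. U \<in> grassmannian d) Us ds \<and> sorted_wrt (\<subseteq>) Us}"

text \<open>The index type \<open>'n\<close> is ordered so that one can speak of the last \<open>i\<close> vectors of the
  standard basis.\<close>

definition last_span :: "nat \<Rightarrow> (complex ^ 'n::{finite,linorder}) set" where
  "last_span i = vec.span {axis j 1 | j. card {l. j \<le> l} \<le> i}"

definition general_linear :: "(complex ^ ('n \<times> 'n::finite)) set" where
  "general_linear = {g. invertible (\<chi> i j. g $ (i, j))}"

definition translate ::
  "complex ^ ('n \<times> 'n::finite) \<Rightarrow> (complex ^ 'n) set \<Rightarrow> (complex ^ 'n) set" where
  "translate g U = (\<lambda>x. (\<chi> i j. g $ (i, j)) *v x) ` U"

definition final_topology :: "'a topology \<Rightarrow> ('a \<Rightarrow> 'b) \<Rightarrow> 'b set \<Rightarrow> 'b topology" where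
  "final_topology T q Y = topology (\<lambda>S. S \<subseteq> Y \<and> openin T {x \<in> topspace T. q x \<in> S})"

lemma istopology_final:
  "istopology (\<lambda>S. S \<subseteq> Y \<and> openin T {x \<in> topspace T. q x \<in> S})"
  unfolding istopology_def
proof (intro conjI allI impI)
  fix S S' assume S: "S \<subseteq> Y \<and> openin T {x \<in> topspace T. q x \<in> S}"
    and S': "S' \<subseteq> Y \<and> openin T {x \<in> topspace T. q x \<in> S'}"
  show "S \<inter> S' \<subseteq> Y" using S by blast
  have "{x \<in> topspace T. q x \<in> S \<inter> S'} =
        {x \<in> topspace T. q x \<in> S} \<inter> {x \<in> topspace T. q x \<in> S'}" by blast
  then show "openin T {x \<in> topspace T. q x \<in> S \<inter> S'}" using S S' by auto
next
  fix \<K> assume K: "\<forall>K\<in>\<K>. K \<subseteq> Y \<and> openin T {x \<in> topspace T. q x \<in> K}"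
  show "\<Union>\<K> \<subseteq> Y" using K by blast
  have "{x \<in> topspace T. q x \<in> \<Union>\<K>} = (\<Union>K\<in>\<K>. {x \<in> topspace T. q x \<in> K})" by blast
  then show "openin T {x \<in> topspace T. q x \<in> \<Union>\<K>}" using K by auto
qed

text \<open>The Zariski topologies of \<open>G(k,n)\<close> and \<open>Fl(d\<^sub>1,\<dots>,d\<^sub>m;n)\<close>, as the homogeneous spaces
  \<open>GL\<^sub>n/P\<close> with \<open>P\<close> the stabilizer of \<open>F\<^sub>k\<close>, respectively of \<open>F\<^bsub>d\<^sub>1\<^esub> \<subseteq> \<dots> \<subseteq> F\<^bsub>d\<^sub>m\<^esub>\<close>.\<close>

definition grassmannian_topology :: "nat \<Rightarrow> (complex ^ 'n::{finite,linorder}) set topology" where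
  "grassmannian_topology k =
     final_topology (subtopology zariski general_linear)
       (\<lambda>g. translate g (last_span k)) (grassmannian k)"

definition flag_topology ::
  "nat list \<Rightarrow> (complex ^ 'n::{finite,linorder}) set list topology" where
  "flag_topology ds =
     final_topology (subtopology zariski general_linear)
       (\<lambda>g. map (\<lambda>d. translate g (last_span d)) ds) (partial_flags ds)"

text \<open>The standard affine chart of \<open>G(k,n)\<close> attached to a \<open>k\<close>-set \<open>I\<close> of coordinates: the
  subspaces that project isomorphically onto the coordinates in \<open>I\<close>, written as graphs of
  matrices with rows outside \<open>I\<close> and columns in \<open>I\<close>. All other matrix entries are set to 0,
  so the chart is a coordinate subspace of all \<open>n\<times>n\<close> matrices.\<close>

definition chart_domain :: "'n set \<Rightarrow> (complex ^ ('n \<times> 'n::finite)) set" where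
  "chart_domain I = {x. \<forall>i j. x $ (i, j) \<noteq> 0 \<longrightarrow> i \<notin> I \<and> j \<in> I}"

definition chart :: "'n set \<Rightarrow> complex ^ ('n \<times> 'n::finite) \<Rightarrow> (complex ^ 'n) set" where
  "chart I x = vec.span {axis j 1 + (\<chi> i. x $ (i, j)) | j. j \<in> I}"

definition singular_locus ::
  "nat \<Rightarrow> (complex ^ 'n::finite) set set \<Rightarrow> (complex ^ 'n) set set" where
  "singular_locus k X =
     (\<Union>I \<in> {I. card I = k}. chart I ` singular_points {x \<in> chart_domain I. chart I x \<in> X})"


section \<open>Schubert varieties and their resolutions\<close>

text \<open>Partitions with at most \<open>k\<close> parts, all at most \<open>m\<close>; the parts are \<open>lam 1, \<dots>, lam k\<close>,
  and the other values of \<open>lam\<close> are irrelevant.\<close>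

definition partition_in_box :: "nat \<Rightarrow> nat \<Rightarrow> (nat \<Rightarrow> nat) \<Rightarrow> bool" where
  "partition_in_box k m lam \<longleftrightarrow>
     (\<forall>s\<in>{1..k}. lam s \<le> m) \<and> (\<forall>s\<in>{1..k}. \<forall>t\<in>{1..k}. s \<le> t \<longrightarrow> lam t \<le> lam s)"

definition schubert_index :: "nat \<Rightarrow> (nat \<Rightarrow> nat) \<Rightarrow> nat \<Rightarrow> nat" where
  "schubert_index k lam s = s + lam (k + 1 - s)"

definition schubert_variety ::
  "nat \<Rightarrow> (nat \<Rightarrow> nat) \<Rightarrow> (complex ^ 'n::{finite,linorder}) set set" where
  "schubert_variety k lam =
     {V \<in> grassmannian k. \<forall>s\<in>{1..k}.
        k + 1 - s \<le> vec.dim (V \<inter> last_span (CARD('n) + 1 - schubert_index k lam s))}"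

definition rectangle_in :: "nat \<Rightarrow> (nat \<Rightarrow> nat) \<Rightarrow> nat \<Rightarrow> nat \<Rightarrow> bool" where
  "rectangle_in k lam a b \<longleftrightarrow>
     1 \<le> a \<and> a \<le> k \<and> 1 \<le> b \<and> (\<forall>s\<in>{1..a}. b \<le> lam s)"

definition proper_outside_corners :: "nat \<Rightarrow> (nat \<Rightarrow> nat) \<Rightarrow> (nat \<times> nat) set" where
  "proper_outside_corners k lam =
     {(a, b). rectangle_in k lam a b \<and>
        (\<forall>a' b'. rectangle_in k lam a' b' \<and> a \<le> a' \<and> b \<le> b' \<longrightarrow> a' = a \<and> b' = b)}"

definition virtual_outside_corners :: "nat \<Rightarrow> nat \<Rightarrow> (nat \<Rightarrow> nat) \<Rightarrow> (nat \<times> nat) set" where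
  "virtual_outside_corners k m lam =
     {(a, b). a = 0 \<and> b = m \<and> (\<nexists>a'. (a', m) \<in> proper_outside_corners k lam)} \<union>
     {(a, b). a = k \<and> b = 0 \<and> (\<nexists>b'. (k, b') \<in> proper_outside_corners k lam)}"

definition outside_corners :: "nat \<Rightarrow> nat \<Rightarrow> (nat \<Rightarrow> nat) \<Rightarrow> (nat \<times> nat) set" where
  "outside_corners k m lam = proper_outside_corners k lam \<union> virtual_outside_corners k m lam"

definition flag_dims :: "nat \<Rightarrow> nat \<Rightarrow> (nat \<Rightarrow> nat) \<Rightarrow> nat list" where
  "flag_dims k r a = map a [1..<r + 1] @ [k]"

text \<open>A flag \<open>U\<^sub>1 \<subseteq> \<dots> \<subseteq> U\<^sub>r \<subseteq> V\<close> is the list \<open>[U\<^sub>1, \<dots>, U\<^sub>r, V]\<close>. List positions start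
  at 0, so \<open>U\<^sub>s\<close> is at position \<open>s - 1\<close>; the map to \<open>G(k,n)\<close> is \<open>last\<close>.\<close>

definition resolution_space ::
  "nat \<Rightarrow> nat \<Rightarrow> (nat \<Rightarrow> nat) \<Rightarrow> (nat \<Rightarrow> nat) \<Rightarrow> (complex ^ 'n::{finite,linorder}) set list set" where
  "resolution_space k r a b =
     {Us \<in> partial_flags (flag_dims k r a).
        \<forall>s\<in>{1..r}. Us ! (s - 1) \<subseteq> last_span (CARD('n) - k + a s - b s)}"

definition exceptional_locus ::
  "nat \<Rightarrow> (nat \<Rightarrow> nat) \<Rightarrow> nat \<Rightarrow> (nat \<Rightarrow> nat) \<Rightarrow> (nat \<Rightarrow> nat) \<Rightarrow>
     (complex ^ 'n::{finite,linorder}) set list set" where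
  "exceptional_locus k lam r a b =
     {Us \<in> resolution_space k r a b. last Us \<in> singular_locus k (schubert_variety k lam)}"

end

theory Submission
  imports Defs
begin

text \<open>
  Write \<open>N t = n - k + a t - b t\<close> for \<open>1 \<le> t \<le> r\<close>, and \<open>M t = N t - a t\<close>. The members
  of the image of \<open>f\<close> are the \<open>V\<close> with \<open>dim (V \<inter> F) \<ge> a t\<close> for all \<open>t\<close>, where \<open>F\<close> is the
  member of dimension \<open>N t\<close> of the standard flag; the image is \<open>\<Omega>\<close>, so these conditions describe
  \<open>\<Omega>\<close>. The corners enter through the following properties: the numbers \<open>a t\<close> and \<open>M t\<close> increase strictly with
  \<open>t\<close>, and they lie strictly between 0 and \<open>k\<close>, respectively \<open>n - k\<close>. Both sets of components turn
  out to have exactly one member for each \<open>t\<close> from 1 to \<open>r\<close>.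

  The singular locus is the union of the loci where condition \<open>s\<close> holds with strict inequality
  (\<open>singular_locus_incidence_variety\<close>). To see this, move a point \<open>V\<close> to the origin of the affine
  chart of its pivot set \<open>J\<close>; this changes neither the dimension of the tangent space nor the local
  dimension (\<open>singular_points_regular_isomorphism\<close>). If all conditions hold with equality, then
  near this origin \<open>\<Omega>\<close> is a linear subspace. Otherwise the coordinate lines that lie in \<open>\<Omega>\<close>
  span a space of larger dimension than \<open>\<Omega>\<close> (\<open>card_free_coordinates_gt\<close>). The dimension of
  \<open>\<Omega>\<close> is bounded by the number of parameters of its Schubert cells: a chain of irreducible closed
  sets of length \<open>m\<close> yields \<open>m\<close> algebraically independent functions, and counting monomials
  against the values on a grid shows that there are at most as many of them as parameters
  (\<open>chain_length_le_parameters\<close>).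

  The exceptional locus is the preimage of these loci, but the preimage of one of them may be
  reducible. Instead, let part \<open>s\<close> consist of the flags for which already the member after \<open>U s\<close>
  meets the space that contains \<open>U s\<close> in more than \<open>U s\<close>. For a flag over a singular \<open>V\<close>,
  taking the largest index \<open>s\<close> at which the condition is strict shows that the flag belongs to part
  \<open>s\<close> (\<open>Union_exceptional_parts\<close>). Part \<open>s\<close> maps onto the locus with index \<open>s\<close>.

  Incidence conditions are closed because they are conjunctions of conditions \<open>V \<inter> W \<noteq> 0\<close> with
  \<open>dim V + dim W = n\<close>, which are vanishing determinants (\<open>dim_Int_ge_iff\<close>). The loci and the parts
  are irreducible because adapted bases exhibit them as images of the invertible matrices with zeros
  in prescribed places. No locus contains another one, as suitable coordinate subspaces show, and
  hence no part contains another one. Finite unions of closed irreducible sets without inclusions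
  have these sets as components.
\<close>

section \<open>Polynomial functions and the Zariski topology\<close>

lemma polynomial_fun_sum:
  assumes "\<And>a. a \<in> A \<Longrightarrow> polynomial_fun (f a)"
  shows "polynomial_fun (\<lambda>x. \<Sum>a\<in>A. f a x)"
  using assms
  by (induction A rule: infinite_finite_induct)
     (simp_all add: polynomial_fun.const polynomial_fun.add)

lemma polynomial_fun_prod:
  assumes "\<And>a. a \<in> A \<Longrightarrow> polynomial_fun (f a)"
  shows "polynomial_fun (\<lambda>x. \<Prod>a\<in>A. f a x)"
  using assms
  by (induction A rule: infinite_finite_induct)
     (simp_all add: polynomial_fun.const polynomial_fun.mult)

lemma polynomial_fun_power: "polynomial_fun f \<Longrightarrow> polynomial_fun (\<lambda>x. f x ^ m)"
  by (induction m) (simp_all add: polynomial_fun.const polynomial_fun.mult)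

lemma polynomial_fun_uminus: "polynomial_fun f \<Longrightarrow> polynomial_fun (\<lambda>x. - f x)"
  using polynomial_fun.mult[OF polynomial_fun.const[of "-1"]] by simp

lemma polynomial_fun_diff:
  "polynomial_fun f \<Longrightarrow> polynomial_fun g \<Longrightarrow> polynomial_fun (\<lambda>x. f x - g x)"
  using polynomial_fun.add[OF _ polynomial_fun_uminus] by fastforce

lemma polynomial_fun_det:
  assumes "\<And>i j. polynomial_fun (\<lambda>x. A x $ i $ j)"
  shows "polynomial_fun (\<lambda>x. det (A x))"
  unfolding det_def
  by (intro polynomial_fun_sum polynomial_fun.mult polynomial_fun_prod polynomial_fun.const assms)

lemma polynomial_fun_compose:
  assumes "polynomial_fun f" and "\<And>i. polynomial_fun (\<lambda>x. \<phi> x $ i)"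
  shows "polynomial_fun (\<lambda>x. f (\<phi> x))"
  using assms(1) by induction (auto intro: assms(2) polynomial_fun.intros)

lemma polynomial_fun_line:
  assumes "polynomial_fun f"
  shows "\<exists>p. \<forall>t. f (x + t *s v) = poly p t"
  using assms
proof induction
  case (const c)
  show ?case by (rule exI[of _ "[:c:]"]) simp
next
  case (coord i)
  show ?case by (rule exI[of _ "[:x $ i, v $ i:]"]) simp
next
  case (add f g)
  then show ?case by (metis poly_add)
next
  case (mult f g)
  then show ?case by (metis poly_mult)
qed

lemma openin_zariski: "openin zariski U \<longleftrightarrow> zariski_open U"
  unfolding zariski_def by (simp add: istopology_zariski)

lemma zariski_open_UNIV: "zariski_open UNIV"
  unfolding zariski_open_def
  by (rule exI[of _ "{\<lambda>x. 1}"]) (simp add: polynomial_fun.const)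

lemma topspace_zariski [simp]: "topspace zariski = UNIV"
  using zariski_open_UNIV openin_subset[of zariski UNIV] by (auto simp: openin_zariski)

lemma closedin_zariski:
  "closedin zariski S \<longleftrightarrow> (\<exists>P. (\<forall>f\<in>P. polynomial_fun f) \<and> S = {x. \<forall>f\<in>P. f x = 0})"
proof -
  have "(- S = {x. \<exists>f\<in>P. f x \<noteq> 0}) \<longleftrightarrow> (S = {x. \<forall>f\<in>P. f x = 0})" for P :: "(complex ^ _ \<Rightarrow> complex) set"
    by blast
  then have "(\<exists>P. (\<forall>f\<in>P. polynomial_fun f) \<and> - S = {x. \<exists>f\<in>P. f x \<noteq> 0}) \<longleftrightarrow>
      (\<exists>P. (\<forall>f\<in>P. polynomial_fun f) \<and> S = {x. \<forall>f\<in>P. f x = 0})"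
    by (simp only:)
  then show ?thesis
    by (simp only: closedin_def openin_zariski zariski_open_def topspace_zariski
        Compl_eq_Diff_UNIV[symmetric]) simp
qed

lemma closedin_zariski_zeros: "polynomial_fun f \<Longrightarrow> closedin zariski {x. f x = 0}"
  unfolding closedin_zariski by (rule exI[of _ "{f}"]) simp

lemma closedin_zariski_common_zeros:
  "(\<And>f. f \<in> P \<Longrightarrow> polynomial_fun f) \<Longrightarrow> closedin zariski {x. \<forall>f\<in>P. f x = 0}"
  unfolding closedin_zariski by blast

lemma openin_zariski_nonzero: "polynomial_fun f \<Longrightarrow> openin zariski {x. f x \<noteq> 0}"
  unfolding openin_zariski zariski_open_def by (rule exI[of _ "{f}"]) simp

lemma in_closure_of_zariski:
  "x \<in> zariski closure_of S \<longleftrightarrow> (\<forall>f. polynomial_fun f \<and> (\<forall>s\<in>S. f s = 0) \<longrightarrow> f x = 0)"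
proof
  assume x: "x \<in> zariski closure_of S"
  show "\<forall>f. polynomial_fun f \<and> (\<forall>s\<in>S. f s = 0) \<longrightarrow> f x = 0"
  proof (intro allI impI)
    fix f assume f: "polynomial_fun f \<and> (\<forall>s\<in>S. f s = 0)"
    then have "zariski closure_of S \<subseteq> {x. f x = 0}"
      by (intro closure_of_minimal closedin_zariski_zeros) auto
    then show "f x = 0" using x by blast
  qed
next
  assume x: "\<forall>f. polynomial_fun f \<and> (\<forall>s\<in>S. f s = 0) \<longrightarrow> f x = 0"
  obtain P where P: "\<forall>f\<in>P. polynomial_fun f" "zariski closure_of S = {x. \<forall>f\<in>P. f x = 0}"
    using closedin_closure_of[of zariski S] unfolding closedin_zariski by blast
  have "\<forall>s\<in>S. \<forall>f\<in>P. f s = 0"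
    using closure_of_subset[of S zariski] P(2) by auto
  then show "x \<in> zariski closure_of S"
    using P x by auto
qed

section \<open>Irreducible sets and irreducible components\<close>

lemma irreducible_inD:
  "irreducible_in T S \<Longrightarrow> closedin T A \<Longrightarrow> closedin T B \<Longrightarrow> S \<subseteq> A \<union> B \<Longrightarrow> S \<subseteq> A \<or> S \<subseteq> B"
  unfolding irreducible_in_def by blast

lemma irreducible_in_closure_of:
  assumes "irreducible_in T S"
  shows "irreducible_in T (T closure_of S)"
  unfolding irreducible_in_def
proof (intro conjI allI impI)
  have S: "S \<subseteq> T closure_of S"
    using assms unfolding irreducible_in_def by (intro closure_of_subset) blast
  then show "T closure_of S \<noteq> {}"
    using assms unfolding irreducible_in_def by blast
  show "T closure_of S \<subseteq> topspace T"
    by (rule closure_of_subset_topspace)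
  fix A B assume AB: "closedin T A \<and> closedin T B \<and> T closure_of S \<subseteq> A \<union> B"
  then have "S \<subseteq> A \<or> S \<subseteq> B"
    using irreducible_inD[OF assms, of A B] S by blast
  then show "T closure_of S \<subseteq> A \<or> T closure_of S \<subseteq> B"
    using AB closure_of_minimal by metis
qed

lemma irreducible_in_Int_open:
  assumes "irreducible_in T Z" "openin T U" "Z \<inter> U \<noteq> {}"
  shows "irreducible_in T (Z \<inter> U)"
  unfolding irreducible_in_def
proof (intro conjI allI impI)
  show "Z \<inter> U \<subseteq> topspace T" using assms(1) unfolding irreducible_in_def by blast
  fix A B assume AB: "closedin T A \<and> closedin T B \<and> Z \<inter> U \<subseteq> A \<union> B"
  have c: "closedin T (topspace T - U)" using assms(2) by blast
  have Z: "Z \<subseteq> topspace T" using assms(1) unfolding irreducible_in_def by blast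
  have "Z \<subseteq> A \<union> (B \<union> (topspace T - U))" using AB Z by blast
  then consider "Z \<subseteq> A" | "Z \<subseteq> B \<union> (topspace T - U)"
    using irreducible_inD[OF assms(1), of A "B \<union> (topspace T - U)"] AB c by blast
  then show "Z \<inter> U \<subseteq> A \<or> Z \<inter> U \<subseteq> B" by cases blast+
qed (use assms(3) in auto)

lemma irreducible_in_subset_Union:
  assumes "irreducible_in T Z" "finite I" "\<And>i. i \<in> I \<Longrightarrow> closedin T (C i)" "Z \<subseteq> (\<Union>i\<in>I. C i)"
  shows "\<exists>i\<in>I. Z \<subseteq> C i"
  using assms(2-4)
proof (induction I rule: finite_induct)
  case empty
  then show ?case using assms(1) unfolding irreducible_in_def by blast
next
  case (insert i I)
  have "closedin T (\<Union>i\<in>I. C i)"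
    using insert by (intro closedin_Union) auto
  then have "Z \<subseteq> C i \<or> Z \<subseteq> (\<Union>i\<in>I. C i)"
    using insert.prems by (intro irreducible_inD[OF assms(1)]) auto
  then show ?case using insert by auto
qed

lemma irreducible_components_Union:
  assumes "finite I" "\<And>i. i \<in> I \<Longrightarrow> closedin T (C i)" "\<And>i. i \<in> I \<Longrightarrow> irreducible_in T (C i)"
    and "\<And>i j. i \<in> I \<Longrightarrow> j \<in> I \<Longrightarrow> C i \<subseteq> C j \<Longrightarrow> i = j"
  shows "bij_betw C I (irreducible_components T (\<Union>i\<in>I. C i))"
proof -
  have in_some: "\<exists>i\<in>I. Z \<subseteq> C i" if "Z \<subseteq> (\<Union>i\<in>I. C i)" "irreducible_in T Z" for Z
    using irreducible_in_subset_Union[OF that(2) assms(1,2) that(1)] by blast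
  have "irreducible_components T (\<Union>i\<in>I. C i) = C ` I"
  proof (intro equalityI subsetI)
    fix Z assume "Z \<in> irreducible_components T (\<Union>i\<in>I. C i)"
    then have Z: "Z \<subseteq> (\<Union>i\<in>I. C i)" "irreducible_in T Z"
      "\<And>Z'. Z' \<subseteq> (\<Union>i\<in>I. C i) \<Longrightarrow> irreducible_in T Z' \<Longrightarrow> Z \<subseteq> Z' \<Longrightarrow> Z' = Z"
      unfolding irreducible_components_def by auto
    obtain i where "i \<in> I" "Z \<subseteq> C i" using in_some Z by blast
    then show "Z \<in> C ` I" using Z(3)[of "C i"] assms(3) by blast
  next
    fix Z assume "Z \<in> C ` I"
    then obtain i where i: "i \<in> I" "Z = C i" by blast
    have "Z' = Z" if "Z' \<subseteq> (\<Union>i\<in>I. C i)" "irreducible_in T Z'" "Z \<subseteq> Z'" for Z'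
      using in_some[OF that(1,2)] assms(4)[OF i(1)] that i by blast
    then show "Z \<in> irreducible_components T (\<Union>i\<in>I. C i)"
      unfolding irreducible_components_def using i assms(3) by blast
  qed
  moreover have "inj_on C I"
    using assms(4) by (auto intro!: inj_onI)
  ultimately show ?thesis by (simp add: bij_betw_def)
qed

lemma irreducible_in_zariski_mult:
  assumes "irreducible_in zariski Z" "polynomial_fun f" "polynomial_fun g"
    and "\<And>x. x \<in> Z \<Longrightarrow> f x * g x = 0"
  shows "(\<forall>x\<in>Z. f x = 0) \<or> (\<forall>x\<in>Z. g x = 0)"
proof -
  have "Z \<subseteq> {x. f x = 0} \<union> {x. g x = 0}" using assms(4) by auto
  then show ?thesis
    using irreducible_inD[OF assms(1), of "{x. f x = 0}" "{x. g x = 0}"]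
      closedin_zariski_zeros assms(2,3) by blast
qed

text \<open>Two polynomials that do not vanish identically on a linear subspace are both nonzero at
  almost every point of the line that joins a nonzero of one to a nonzero of the other.\<close>

lemma irreducible_in_zariski_subspace:
  assumes "vec.subspace L"
  shows "irreducible_in zariski L"
  unfolding irreducible_in_def
proof (intro conjI allI impI)
  show "L \<noteq> {}" using vec.subspace_0[OF assms] by blast
  fix A B assume AB: "closedin zariski A \<and> closedin zariski B \<and> L \<subseteq> A \<union> B"
  show "L \<subseteq> A \<or> L \<subseteq> B"
  proof (rule ccontr)
    assume "\<not> (L \<subseteq> A \<or> L \<subseteq> B)"
    then obtain x y where x: "x \<in> L" "x \<notin> A" and y: "y \<in> L" "y \<notin> B" by blast
    obtain P where P: "\<forall>f\<in>P. polynomial_fun f" "A = {x. \<forall>f\<in>P. f x = 0}"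
      using AB unfolding closedin_zariski by blast
    obtain Q where Q: "\<forall>f\<in>Q. polynomial_fun f" "B = {x. \<forall>f\<in>Q. f x = 0}"
      using AB unfolding closedin_zariski by blast
    obtain f where f: "f \<in> P" "f x \<noteq> 0" using x P by auto
    obtain g where g: "g \<in> Q" "g y \<noteq> 0" using y Q by auto
    obtain p where p: "\<And>t. f (x + t *s (y - x)) = poly p t"
      using polynomial_fun_line P f by metis
    obtain q where q: "\<And>t. g (x + t *s (y - x)) = poly q t"
      using polynomial_fun_line Q g by metis
    have "p \<noteq> 0" using p[of 0] f by auto
    moreover have "q \<noteq> 0" using q[of 1] g by auto
    ultimately have "finite {t. poly (p * q) t = 0}" by (intro poly_roots_finite) simp
    then obtain t where "poly (p * q) t \<noteq> 0"
      using ex_new_if_finite[OF infinite_UNIV_char_0[where 'a = complex]] by blast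
    then have t: "f (x + t *s (y - x)) \<noteq> 0" "g (x + t *s (y - x)) \<noteq> 0"
      using p q by auto
    have "x + t *s (y - x) \<in> L"
      using assms x y by (intro vec.subspace_add vec.subspace_scale vec.subspace_diff)
    then show False using AB P Q f g t by blast
  qed
qed simp

section \<open>Quotient topologies\<close>

lemma openin_final_topology:
  "openin (final_topology T q Y) S \<longleftrightarrow> S \<subseteq> Y \<and> openin T {x \<in> topspace T. q x \<in> S}"
  unfolding final_topology_def by (simp add: istopology_final)

lemma topspace_final_topology:
  assumes "\<And>x. x \<in> topspace T \<Longrightarrow> q x \<in> Y"
  shows "topspace (final_topology T q Y) = Y"
proof -
  have "{x \<in> topspace T. q x \<in> Y} = topspace T" using assms by blast
  then have "openin (final_topology T q Y) Y" by (simp add: openin_final_topology)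
  then show ?thesis
    using openin_subset openin_final_topology openin_topspace by (metis subset_antisym)
qed

lemma closedin_final_topology:
  assumes "\<And>x. x \<in> topspace T \<Longrightarrow> q x \<in> Y"
  shows "closedin (final_topology T q Y) S \<longleftrightarrow> S \<subseteq> Y \<and> closedin T {x \<in> topspace T. q x \<in> S}"
proof -
  have "topspace T - {x \<in> topspace T. q x \<in> S} = {x \<in> topspace T. q x \<in> Y - S}"
    using assms by blast
  then show ?thesis
    by (auto simp: closedin_def topspace_final_topology[OF assms] openin_final_topology)
qed

lemma irreducible_in_final_topology:
  assumes "\<And>x. x \<in> X \<Longrightarrow> q x \<in> Y" "irreducible_in T S" "S \<subseteq> X"
  shows "irreducible_in (final_topology (subtopology T X) q Y) (q ` S)"
proof -
  let ?X = "subtopology T X"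
  have S: "S \<subseteq> topspace ?X" "S \<noteq> {}"
    using assms(2,3) unfolding irreducible_in_def by auto
  have q: "q x \<in> Y" if "x \<in> topspace ?X" for x using that assms(1) by auto
  have top: "topspace (final_topology ?X q Y) = Y"
    by (rule topspace_final_topology[OF q])
  show ?thesis
    unfolding irreducible_in_def top
  proof (intro conjI allI impI)
    show "q ` S \<subseteq> Y" using S q by auto
    show "q ` S \<noteq> {}" using S by auto
    fix A B
    assume AB: "closedin (final_topology ?X q Y) A \<and> closedin (final_topology ?X q Y) B \<and>
      q ` S \<subseteq> A \<union> B"
    obtain A' where A': "closedin T A'" "{x \<in> topspace ?X. q x \<in> A} = A' \<inter> X"
      using AB closedin_final_topology[of ?X q Y A] q by (auto simp: closedin_subtopology)
    obtain B' where B': "closedin T B'" "{x \<in> topspace ?X. q x \<in> B} = B' \<inter> X"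
      using AB closedin_final_topology[of ?X q Y B] q by (auto simp: closedin_subtopology)
    have "S \<subseteq> A' \<union> B'" using AB S A' B' by blast
    then have "S \<subseteq> A' \<or> S \<subseteq> B'" using irreducible_inD[OF assms(2)] A' B' by blast
    then show "q ` S \<subseteq> A \<or> q ` S \<subseteq> B" using A' B' assms(3) by blast
  qed
qed

section \<open>Chains of irreducible sets\<close>

text \<open>Gaussian elimination: an equation that involves some unknown eliminates it.\<close>

lemma underdetermined_system:
  fixes M :: "'b \<Rightarrow> 'a \<Rightarrow> complex"
  assumes "finite B" "finite A" "card B < card A"
  shows "\<exists>c. (\<exists>a\<in>A. c a \<noteq> 0) \<and> (\<forall>b\<in>B. (\<Sum>a\<in>A. c a * M b a) = 0)"
  using assms
proof (induction B arbitrary: A M rule: finite_induct)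
  case empty
  then have "A \<noteq> {}" by auto
  then show ?case by (intro exI[of _ "\<lambda>_. 1"]) auto
next
  case (insert b B)
  show ?case
  proof (cases "\<forall>a\<in>A. M b a = 0")
    case True
    have "card B < card A" using insert by simp
    then obtain c where "\<exists>a\<in>A. c a \<noteq> 0" "\<forall>b\<in>B. (\<Sum>a\<in>A. c a * M b a) = 0"
      using insert.IH[OF insert.prems(1), of M] by blast
    then show ?thesis using True by (intro exI[of _ c]) auto
  next
    case False
    then obtain a0 where a0: "a0 \<in> A" "M b a0 \<noteq> 0" by blast
    define A' where "A' = A - {a0}"
    have A': "finite A'" "a0 \<notin> A'" "A = insert a0 A'" using insert.prems a0 unfolding A'_def by auto
    have "card B < card A'"
      using insert A' by simp
    then obtain c where c: "\<exists>a\<in>A'. c a \<noteq> 0"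
      "\<forall>b'\<in>B. (\<Sum>a\<in>A'. c a * (M b' a - M b a / M b a0 * M b' a0)) = 0"
      using insert.IH[OF A'(1), of "\<lambda>b' a. M b' a - M b a / M b a0 * M b' a0"] by blast
    define s where "s = (\<Sum>a\<in>A'. c a * M b a)"
    define c' where "c' = c(a0 := - s / M b a0)"
    have split: "(\<Sum>a\<in>A. c' a * M b' a) = - s / M b a0 * M b' a0 + (\<Sum>a\<in>A'. c a * M b' a)" for b'
    proof -
      have "(\<Sum>a\<in>A'. c' a * M b' a) = (\<Sum>a\<in>A'. c a * M b' a)"
        using A'(2) by (intro sum.cong) (auto simp: c'_def)
      then show ?thesis using A' by (simp add: c'_def)
    qed
    have "(\<Sum>a\<in>A. c' a * M b a) = 0"
      unfolding split using a0 by (simp add: s_def)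
    moreover have "(\<Sum>a\<in>A. c' a * M b' a) = 0" if "b' \<in> B" for b'
    proof -
      have "(\<Sum>a\<in>A'. c a * (M b' a - M b a / M b a0 * M b' a0)) =
          (\<Sum>a\<in>A'. c a * M b' a) - (\<Sum>a\<in>A'. c a * M b a) / M b a0 * M b' a0"
        by (simp add: algebra_simps sum_subtractf sum_distrib_left sum_divide_distrib)
      then show ?thesis unfolding split using c(2) that by (simp add: s_def)
    qed
    moreover have "\<exists>a\<in>A. c' a \<noteq> 0"
      using c(1) A' by (auto simp: c'_def)
    ultimately show ?thesis by (intro exI[of _ c']) auto
  qed
qed

text \<open>The degree in each single variable is what decides how large a grid detects nonzero functions.\<close>

definition coordinate_degree_le :: "nat \<Rightarrow> (complex ^ 'v::finite \<Rightarrow> complex) \<Rightarrow> bool" where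
  "coordinate_degree_le d f \<longleftrightarrow>
     (\<forall>c y. \<exists>p. degree p \<le> d \<and> (\<forall>t. f (y + t *s axis c 1) = poly p t))"

lemma coordinate_degree_le_mono:
  "coordinate_degree_le d f \<Longrightarrow> d \<le> d' \<Longrightarrow> coordinate_degree_le d' f"
  unfolding coordinate_degree_le_def by (meson order_trans)

lemma coordinate_degree_le_const: "coordinate_degree_le d (\<lambda>x. c)"
  unfolding coordinate_degree_le_def by (intro allI exI[of _ "[:c:]"]) simp

lemma coordinate_degree_le_coord: "coordinate_degree_le 1 (\<lambda>x. x $ i)"
  unfolding coordinate_degree_le_def
proof (intro allI)
  fix c and y :: "complex ^ 'a"
  show "\<exists>p. degree p \<le> 1 \<and> (\<forall>t. (y + t *s axis c 1) $ i = poly p t)"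
    by (intro exI[of _ "[:y $ i, axis c 1 $ i:]"]) simp
qed

lemma coordinate_degree_le_add:
  assumes "coordinate_degree_le d f" "coordinate_degree_le d g"
  shows "coordinate_degree_le d (\<lambda>x. f x + g x)"
  unfolding coordinate_degree_le_def
proof (intro allI)
  fix c y
  obtain p q where "degree p \<le> d" "\<forall>t. f (y + t *s axis c 1) = poly p t"
    "degree q \<le> d" "\<forall>t. g (y + t *s axis c 1) = poly q t"
    using assms unfolding coordinate_degree_le_def by blast
  then show "\<exists>p. degree p \<le> d \<and> (\<forall>t. f (y + t *s axis c 1) + g (y + t *s axis c 1) = poly p t)"
    by (intro exI[of _ "p + q"]) (auto intro: degree_add_le)
qed

lemma coordinate_degree_le_mult:
  assumes "coordinate_degree_le d f" "coordinate_degree_le e g"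
  shows "coordinate_degree_le (d + e) (\<lambda>x. f x * g x)"
  unfolding coordinate_degree_le_def
proof (intro allI)
  fix c y
  obtain p q where "degree p \<le> d" "\<forall>t. f (y + t *s axis c 1) = poly p t"
    "degree q \<le> e" "\<forall>t. g (y + t *s axis c 1) = poly q t"
    using assms unfolding coordinate_degree_le_def by blast
  then show "\<exists>p. degree p \<le> d + e \<and>
      (\<forall>t. f (y + t *s axis c 1) * g (y + t *s axis c 1) = poly p t)"
    by (intro exI[of _ "p * q"]) (auto intro: order_trans[OF degree_mult_le])
qed

lemma coordinate_degree_le_power:
  assumes "coordinate_degree_le d f" "m \<le> n"
  shows "coordinate_degree_le (d * n) (\<lambda>x. f x ^ m)"
proof -
  have "coordinate_degree_le (d * m) (\<lambda>x. f x ^ m)"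
    by (induction m) (auto intro: coordinate_degree_le_const coordinate_degree_le_mult assms(1))
  then show ?thesis using assms(2) by (auto intro: coordinate_degree_le_mono)
qed

lemma coordinate_degree_le_sum:
  assumes "\<And>a. a \<in> A \<Longrightarrow> coordinate_degree_le d (f a)"
  shows "coordinate_degree_le d (\<lambda>x. \<Sum>a\<in>A. f a x)"
  using assms
  by (induction A rule: infinite_finite_induct)
     (simp_all add: coordinate_degree_le_const coordinate_degree_le_add)

lemma coordinate_degree_le_prod:
  assumes "\<And>a. a \<in> A \<Longrightarrow> coordinate_degree_le (d a) (f a)"
  shows "coordinate_degree_le (\<Sum>a\<in>A. d a) (\<lambda>x. \<Prod>a\<in>A. f a x)"
  using assms
  by (induction A rule: infinite_finite_induct)
     (simp_all add: coordinate_degree_le_const coordinate_degree_le_mult)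

lemma polynomial_fun_coordinate_degree:
  assumes "polynomial_fun f"
  shows "\<exists>d. coordinate_degree_le d f"
  using assms
proof induction
  case (add f g)
  then obtain d e where "coordinate_degree_le d f" "coordinate_degree_le e g" by blast
  then show ?case
    by (intro exI[of _ "max d e"] coordinate_degree_le_add)
       (auto elim: coordinate_degree_le_mono)
qed (use coordinate_degree_le_const coordinate_degree_le_coord coordinate_degree_le_mult in blast)+

lemma poly_eq_0_if_many_roots:
  fixes p :: "complex poly"
  assumes "degree p \<le> d" "\<And>j. j \<le> d \<Longrightarrow> poly p (of_nat j) = 0"
  shows "p = 0"
proof (rule ccontr)
  assume "p \<noteq> 0"
  have "card (of_nat ` {..d} :: complex set) = Suc d"
    by (simp add: card_image inj_on_def)
  moreover have "of_nat ` {..d} \<subseteq> {x. poly p x = 0}" using assms(2) by auto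
  ultimately have "Suc d \<le> card {x. poly p x = 0}"
    using card_mono[OF poly_roots_finite[OF \<open>p \<noteq> 0\<close>]] by metis
  then show False
    using card_poly_roots_bound[OF \<open>p \<noteq> 0\<close>] assms(1) by linarith
qed

text \<open>The coordinates in \<open>S\<close> are released from the grid one at a time: in the released coordinate the
  function is a polynomial of degree at most \<open>d\<close> with \<open>d + 1\<close> zeros.\<close>

lemma zero_if_zero_on_grid:
  fixes f :: "complex ^ 'v::finite \<Rightarrow> complex"
  assumes f: "coordinate_degree_le d f"
    and grid: "\<And>y. (\<And>c. c \<notin> S \<Longrightarrow> y $ c = 0) \<Longrightarrow> (\<And>c. c \<in> S \<Longrightarrow> y $ c \<in> of_nat ` {..d}) \<Longrightarrow> f y = 0"
    and y: "\<And>c. c \<notin> S \<Longrightarrow> y $ c = 0"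
  shows "f y = 0"
proof -
  have "\<forall>y. (\<forall>c. c \<notin> S \<longrightarrow> y $ c = 0) \<longrightarrow> (\<forall>c\<in>S - T. y $ c \<in> of_nat ` {..d}) \<longrightarrow> f y = 0"
    if "finite T" "T \<subseteq> S" for T
    using that
  proof (induction T rule: finite_induct)
    case empty
    then show ?case using grid by auto
  next
    case (insert c T)
    show ?case
    proof (intro allI impI)
      fix y :: "complex ^ 'v"
      assume y: "\<forall>c. c \<notin> S \<longrightarrow> y $ c = 0" "\<forall>c\<in>S - insert c T. y $ c \<in> of_nat ` {..d}"
      define y0 where "y0 = y - y $ c *s axis c 1"
      have y0: "y0 $ i = (if i = c then 0 else y $ i)" for i
        unfolding y0_def by (auto simp: axis_def)
      obtain p where p: "degree p \<le> d" "\<forall>t. f (y0 + t *s axis c 1) = poly p t"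
        using f unfolding coordinate_degree_le_def by blast
      have "poly p (of_nat j) = 0" if "j \<le> d" for j
      proof -
        have "(y0 + of_nat j *s axis c 1) $ i = (if i = c then of_nat j else y $ i)" for i
          by (simp add: y0 axis_def)
        then have "f (y0 + of_nat j *s axis c 1) = 0"
          using insert.IH insert.prems y that by (auto simp del: vector_add_component)
        then show ?thesis using p by simp
      qed
      then have "p = 0" by (rule poly_eq_0_if_many_roots[OF p(1)])
      moreover have "y0 + y $ c *s axis c 1 = y" unfolding y0_def by simp
      ultimately show "f y = 0" using p(2) by (metis poly_0)
    qed
  qed
  from this[of S] show ?thesis using y finite[of S] by auto
qed

text \<open>Pulling a polynomial back along the rational map \<open>num / den\<close>. The equation \<open>den y *s x = num y\<close>
  says that \<open>x\<close> is the image of \<open>y\<close> without dividing.\<close>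

lemma polynomial_fun_clear_denominator:
  assumes "polynomial_fun f" "\<And>i. polynomial_fun (\<lambda>y. num y $ i)" "polynomial_fun den"
  shows "\<exists>N F. polynomial_fun F \<and> (\<forall>y x. den y *s x = num y \<longrightarrow> F y = den y ^ N * f x)"
  using assms(1)
proof induction
  case (const c)
  show ?case by (intro exI[of _ 0] exI[of _ "\<lambda>y. c"]) (simp add: polynomial_fun.const)
next
  case (coord i)
  show ?case
    by (intro exI[of _ 1] exI[of _ "\<lambda>y. num y $ i"])
       (metis assms(2) power_one_right vector_smult_component)
next
  case (add f g)
  then obtain N F M G where
    "polynomial_fun F" "\<forall>y x. den y *s x = num y \<longrightarrow> F y = den y ^ N * f x"
    "polynomial_fun G" "\<forall>y x. den y *s x = num y \<longrightarrow> G y = den y ^ M * g x" by blast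
  then show ?case
    by (intro exI[of _ "N + M"] exI[of _ "\<lambda>y. den y ^ M * F y + den y ^ N * G y"] conjI
        polynomial_fun.add polynomial_fun.mult polynomial_fun_power assms(3))
       (auto simp: power_add algebra_simps)
next
  case (mult f g)
  then obtain N F M G where
    "polynomial_fun F" "\<forall>y x. den y *s x = num y \<longrightarrow> F y = den y ^ N * f x"
    "polynomial_fun G" "\<forall>y x. den y *s x = num y \<longrightarrow> G y = den y ^ M * g x" by blast
  then show ?case
    by (intro exI[of _ "N + M"] exI[of _ "\<lambda>y. F y * G y"] conjI polynomial_fun.mult)
       (auto simp: power_add algebra_simps)
qed

text \<open>On the smaller set the relation reduces to its constant coefficient, which therefore
  vanishes; on the larger, irreducible set the remaining relation can be divided by \<open>f\<close>.\<close>

lemma power_relation_coefficients: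
  assumes Z: "irreducible_in zariski Z" "Z' \<subseteq> Z"
    and poly: "\<And>j. polynomial_fun (q j)" "polynomial_fun f"
    and f: "\<And>x. x \<in> Z' \<Longrightarrow> f x = 0" "\<exists>x\<in>Z. f x \<noteq> 0"
    and q: "\<And>j. (\<forall>x\<in>Z'. q j x = 0) \<Longrightarrow> (\<forall>x. q j x = 0)"
    and rel: "\<And>x. x \<in> Z \<Longrightarrow> (\<Sum>j\<le>d. q j x * f x ^ j) = 0"
  shows "\<forall>j\<le>d. \<forall>x\<in>Z'. q j x = 0"
  using poly(1) q rel
proof (induction d arbitrary: q)
  case 0
  then show ?case using Z by auto
next
  case (Suc d)
  have shift: "(\<Sum>j\<le>Suc d. q j x * f x ^ j) = q 0 x + f x * (\<Sum>j\<le>d. q (Suc j) x * f x ^ j)" for x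
    by (simp only: sum.atMost_Suc_shift) (simp add: sum_distrib_left algebra_simps)
  have q0: "\<forall>x\<in>Z'. q 0 x = 0"
  proof
    fix x assume "x \<in> Z'"
    then show "q 0 x = 0" using Suc.prems(3)[of x] f(1)[of x] Z(2) unfolding shift by auto
  qed
  then have q0': "q 0 x = 0" for x using Suc.prems(2) by blast
  have "f x * (\<Sum>j\<le>d. q (Suc j) x * f x ^ j) = 0" if "x \<in> Z" for x
    using Suc.prems(3)[OF that] unfolding shift q0' by simp
  moreover have "polynomial_fun (\<lambda>x. \<Sum>j\<le>d. q (Suc j) x * f x ^ j)"
    by (intro polynomial_fun_sum polynomial_fun.mult polynomial_fun_power Suc.prems(1) poly(2))
  ultimately have "\<forall>x\<in>Z. (\<Sum>j\<le>d. q (Suc j) x * f x ^ j) = 0"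
    using irreducible_in_zariski_mult[OF Z(1) poly(2)] f(2) by blast
  then have "\<forall>j\<le>d. \<forall>x\<in>Z'. q (Suc j) x = 0"
    using Suc.IH[of "\<lambda>j. q (Suc j)"] Suc.prems by blast
  then show ?case using q0 by (metis Suc_le_mono not0_implies_Suc)
qed

text \<open>If each function of a sequence vanishes on one term of a chain of irreducible sets and not
  on the next, then the functions are algebraically independent on the last term.\<close>

lemma chain_functions_algebraically_independent:
  fixes f :: "nat \<Rightarrow> complex ^ 'v::finite \<Rightarrow> complex"
  assumes "\<And>i. i \<le> m \<Longrightarrow> irreducible_in zariski (Z i)"
    and "\<And>i. i < m \<Longrightarrow> Z i \<subseteq> Z (Suc i)"
    and "\<And>i. i < m \<Longrightarrow> polynomial_fun (f i)"
    and "\<And>i x. i < m \<Longrightarrow> x \<in> Z i \<Longrightarrow> f i x = 0"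
    and "\<And>i. i < m \<Longrightarrow> \<exists>x\<in>Z (Suc i). f i x \<noteq> 0"
    and "\<And>x. x \<in> Z m \<Longrightarrow> (\<Sum>e\<in>{..<m} \<rightarrow>\<^sub>E {..d::nat}. c e * (\<Prod>i<m. f i x ^ e i)) = 0"
  shows "\<forall>e\<in>{..<m} \<rightarrow>\<^sub>E {..d}. c e = 0"
  using assms
proof (induction m arbitrary: c)
  case 0
  obtain x where "x \<in> Z 0" using 0(1)[of 0] unfolding irreducible_in_def by auto
  then show ?case using 0(6) by (simp add: PiE_empty_domain)
next
  case (Suc m)
  let ?E = "{..<m} \<rightarrow>\<^sub>E {..d}"
  define q where "q = (\<lambda>j x. \<Sum>e\<in>?E. c (e(m := j)) * (\<Prod>i<m. f i x ^ e i))"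
  have E: "{..<Suc m} \<rightarrow>\<^sub>E {..d} = (\<lambda>(j, e). e(m := j)) ` ({..d} \<times> ?E)"
    unfolding lessThan_Suc PiE_insert_eq ..
  have inj: "inj_on (\<lambda>(j, e). e(m := j)) ({..d} \<times> ?E)"
    using inj_combinator[of m "{..<m}" "\<lambda>_. {..d}"] by simp
  have prod: "(\<Prod>i<Suc m. f i x ^ (e(m := j)) i) = (\<Prod>i<m. f i x ^ e i) * f m x ^ j" for x j e
    by simp
  have expand: "(\<Sum>e\<in>{..<Suc m} \<rightarrow>\<^sub>E {..d}. c e * (\<Prod>i<Suc m. f i x ^ e i)) =
      (\<Sum>j\<le>d. q j x * f m x ^ j)" for x
  proof -
    have "(\<Sum>e\<in>{..<Suc m} \<rightarrow>\<^sub>E {..d}. c e * (\<Prod>i<Suc m. f i x ^ e i)) =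
        (\<Sum>(j, e)\<in>{..d} \<times> ?E. c (e(m := j)) * (\<Prod>i<Suc m. f i x ^ (e(m := j)) i))"
      unfolding E sum.reindex[OF inj] by (intro sum.cong) (simp_all add: case_prod_beta)
    also have "\<dots> = (\<Sum>j\<le>d. \<Sum>e\<in>?E. c (e(m := j)) * (\<Prod>i<m. f i x ^ e i) * f m x ^ j)"
      by (subst sum.cartesian_product[symmetric]) (simp only: prod mult.assoc)
    finally show ?thesis unfolding q_def by (simp add: sum_distrib_right)
  qed
  have coeffs: "\<forall>e\<in>?E. c (e(m := j)) = 0" if "\<forall>x\<in>Z m. q j x = 0" for j
    using that Suc.prems(1-5) by (intro Suc.IH) (auto simp: q_def fun_upd_def)
  have "polynomial_fun (q j)" for j
    unfolding q_def using Suc.prems(3)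
    by (intro polynomial_fun_sum polynomial_fun.mult polynomial_fun.const polynomial_fun_prod
        polynomial_fun_power) auto
  moreover have "\<forall>x. q j x = 0" if "\<forall>x\<in>Z m. q j x = 0" for j
    using coeffs[OF that] by (simp add: q_def)
  ultimately have q0: "\<forall>j\<le>d. \<forall>x\<in>Z m. q j x = 0"
    using Suc.prems(1,6) expand Suc.prems(2-5)[of m]
    by (intro power_relation_coefficients[of "Z (Suc m)" "Z m" q "f m" d]) auto
  have "c (e(m := j)) = 0" if "j \<le> d" "e \<in> ?E" for j e
    using coeffs q0 that by blast
  then show ?case unfolding E by auto
qed

text \<open>A chain of length \<open>m\<close> gives \<open>m\<close> algebraically independent functions. Their monomials with
  exponents at most \<open>d\<close> are \<open>(d + 1)^m\<close> many; pulled back to the parameter space they have, up to a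
  common denominator, degree at most \<open>E d\<close> in each parameter, and a combination of them is zero as
  soon as it vanishes on a grid of \<open>(E d + 1)^D\<close> points. For \<open>m > D\<close> and \<open>d\<close> large, there is a
  nontrivial such combination.\<close>

lemma chain_length_le_parameters:
  fixes num :: "complex ^ 'u::finite \<Rightarrow> complex ^ 'v::finite"
  assumes irr: "\<And>i. i \<le> m \<Longrightarrow> irreducible_in zariski (Z i)"
    and closed: "\<And>i. i \<le> m \<Longrightarrow> closedin zariski (Z i)"
    and chain: "\<And>i. i < m \<Longrightarrow> Z i \<subset> Z (Suc i)"
    and num: "\<And>i. polynomial_fun (\<lambda>y. num y $ i)" and den: "polynomial_fun den"
    and Z: "Z m \<subseteq> zariski closure_of
      {x. \<exists>y. (\<forall>c. c \<notin> S \<longrightarrow> y $ c = 0) \<and> den y \<noteq> 0 \<and> den y *s x = num y}"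
  shows "m \<le> card S"
proof (rule ccontr)
  assume "\<not> m \<le> card S"
  have "\<exists>f. polynomial_fun f \<and> (\<forall>x\<in>Z i. f x = 0) \<and> (\<exists>x\<in>Z (Suc i). f x \<noteq> 0)"
    if i: "i < m" for i
  proof -
    obtain x where x: "x \<in> Z (Suc i)" "x \<notin> Z i" using chain[OF i] by blast
    have "zariski closure_of Z i = Z i" using closed i by (simp add: closure_of_closedin)
    then show ?thesis using x in_closure_of_zariski by metis
  qed
  then obtain f where f: "\<And>i. i < m \<Longrightarrow> polynomial_fun (f i)"
    "\<And>i x. i < m \<Longrightarrow> x \<in> Z i \<Longrightarrow> f i x = 0" "\<And>i. i < m \<Longrightarrow> \<exists>x\<in>Z (Suc i). f i x \<noteq> 0"
    by metis
  have "\<exists>N F. polynomial_fun F \<and> (\<forall>y x. den y *s x = num y \<longrightarrow> F y = den y ^ N * f i x)"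
    if "i < m" for i
    by (rule polynomial_fun_clear_denominator[OF f(1)[OF that] num den])
  then obtain N F where F: "\<And>i. i < m \<Longrightarrow> polynomial_fun (F i)"
    "\<And>i y x. i < m \<Longrightarrow> den y *s x = num y \<Longrightarrow> F i y = den y ^ N i * f i x"
    by metis
  have "\<exists>d. coordinate_degree_le d (F i)" if "i < m" for i
    by (rule polynomial_fun_coordinate_degree[OF F(1)[OF that]])
  then obtain dF where dF: "\<And>i. i < m \<Longrightarrow> coordinate_degree_le (dF i) (F i)" by metis
  obtain dd where dd: "coordinate_degree_le dd den"
    using polynomial_fun_coordinate_degree[OF den] by blast
  define E where "E = (\<Sum>i<m. dF i + dd * N i)"
  define D where "D = card S"
  \<comment> \<open>With this \<open>d\<close>, \<open>(E d + 1)^D \<le> (E + 1)^D (d + 1)^D = d (d + 1)^D < (d + 1)^(D + 1)\<close>.\<close>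
  define d where "d = (E + 1) ^ D"
  define mon where "mon = (\<lambda>e y. \<Prod>i<m. F i y ^ e i * den y ^ (N i * (d - e i)))"
  define X where "X = {..<m} \<rightarrow>\<^sub>E {..d}"
  define B where "B = (\<lambda>e::'u \<Rightarrow> nat. (\<chi> c. if c \<in> S then of_nat (e c) else 0) :: complex ^ 'u) `
    (S \<rightarrow>\<^sub>E {..E * d})"
  have "card B \<le> (E * d + 1) ^ D"
  proof -
    have "card B \<le> card (S \<rightarrow>\<^sub>E {..E * d})" unfolding B_def by (intro card_image_le finite_PiE) auto
    then show ?thesis by (simp add: card_PiE D_def)
  qed
  also have "(E * d + 1) ^ D \<le> ((E + 1) * (d + 1)) ^ D"
    by (intro power_mono) (auto simp: algebra_simps)
  also have "\<dots> = d * (d + 1) ^ D"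
    by (simp only: power_mult_distrib d_def)
  also have "\<dots> < (d + 1) * (d + 1) ^ D" by simp
  also have "\<dots> = (d + 1) ^ (Suc D)" by simp
  also have "\<dots> \<le> (d + 1) ^ m"
    using \<open>\<not> m \<le> card S\<close> by (intro power_increasing) (auto simp: D_def)
  also have "\<dots> = card X" by (simp add: X_def card_PiE)
  finally have "card B < card X" .
  moreover have "finite B" unfolding B_def by (intro finite_imageI finite_PiE) auto
  moreover have "finite X" unfolding X_def by (intro finite_PiE) auto
  ultimately obtain c where c: "\<exists>e\<in>X. c e \<noteq> 0" "\<forall>y\<in>B. (\<Sum>e\<in>X. c e * mon e y) = 0"
    using underdetermined_system[of B X "\<lambda>y e. mon e y"] by auto
  have "coordinate_degree_le (E * d) (mon e)" if "e \<in> X" for e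
  proof -
    have e: "e i \<le> d" if "i < m" for i using \<open>e \<in> X\<close> that by (auto simp: X_def)
    have "coordinate_degree_le (\<Sum>i<m. dF i * d + dd * (N i * d)) (mon e)"
      unfolding mon_def
      by (intro coordinate_degree_le_prod coordinate_degree_le_mult coordinate_degree_le_power dF dd)
         (auto intro: e)
    moreover have "(\<Sum>i<m. dF i * d + dd * (N i * d)) = E * d"
      unfolding E_def sum_distrib_right by (simp add: add_mult_distrib mult.assoc)
    ultimately show ?thesis by simp
  qed
  then have "coordinate_degree_le (E * d) (\<lambda>y. \<Sum>e\<in>X. c e * mon e y)"
    using coordinate_degree_le_mult[OF coordinate_degree_le_const[of 0]]
    by (intro coordinate_degree_le_sum) fastforce
  moreover have "(\<Sum>e\<in>X. c e * mon e y) = 0"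
    if y: "\<And>c. c \<notin> S \<Longrightarrow> y $ c = 0" "\<And>c. c \<in> S \<Longrightarrow> y $ c \<in> of_nat ` {..E * d}" for y
  proof -
    have "\<exists>e. c \<in> S \<longrightarrow> e \<le> E * d \<and> y $ c = of_nat e" for c using y(2) by blast
    then obtain e where e: "\<And>c. c \<in> S \<Longrightarrow> e c \<le> E * d \<and> y $ c = of_nat (e c)" by metis
    have "y = (\<chi> c. if c \<in> S then of_nat (restrict e S c) else 0)"
      using e y(1) by (auto simp: vec_eq_iff)
    moreover have "restrict e S \<in> S \<rightarrow>\<^sub>E {..E * d}" using e by auto
    ultimately have "y \<in> B" unfolding B_def by blast
    then show ?thesis using c(2) by blast
  qed
  ultimately have zero: "(\<Sum>e\<in>X. c e * mon e y) = 0" if "\<And>c. c \<notin> S \<Longrightarrow> y $ c = 0" for y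
    using zero_if_zero_on_grid[of "E * d" "\<lambda>y. \<Sum>e\<in>X. c e * mon e y" S y] that by blast
  define g where "g = (\<lambda>x. \<Sum>e\<in>X. c e * (\<Prod>i<m. f i x ^ e i))"
  have "polynomial_fun g"
    unfolding g_def using f(1)
    by (intro polynomial_fun_sum polynomial_fun.mult polynomial_fun.const polynomial_fun_prod
        polynomial_fun_power) auto
  moreover have "g x = 0"
    if xy: "\<forall>c. c \<notin> S \<longrightarrow> y $ c = 0" "den y \<noteq> 0" "den y *s x = num y" for x y
  proof -
    have "mon e y = den y ^ (\<Sum>i<m. N i * d) * (\<Prod>i<m. f i x ^ e i)" if "e \<in> X" for e
    proof -
      have "mon e y = (\<Prod>i<m. den y ^ (N i * d) * f i x ^ e i)"
        unfolding mon_def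
      proof (intro prod.cong refl)
        fix i assume "i \<in> {..<m}"
        then have "i < m" "e i \<le> d" using that by (auto simp: X_def)
        have "N i * d = N i * e i + N i * (d - e i)"
          using \<open>e i \<le> d\<close> by (metis add_mult_distrib2 le_add_diff_inverse)
        then show "F i y ^ e i * den y ^ (N i * (d - e i)) = den y ^ (N i * d) * f i x ^ e i"
          using F(2)[OF \<open>i < m\<close> xy(3)] by (simp add: power_mult_distrib power_add power_mult)
      qed
      then show ?thesis by (simp add: prod.distrib power_sum)
    qed
    then have "den y ^ (\<Sum>i<m. N i * d) * g x = (\<Sum>e\<in>X. c e * mon e y)"
      unfolding g_def by (simp add: sum_distrib_left algebra_simps)
    then show "g x = 0" using zero[of y] xy by simp
  qed
  ultimately have "g x = 0" if "x \<in> Z m" for x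
    using subsetD[OF Z that] unfolding in_closure_of_zariski by blast
  then have "\<forall>e\<in>X. c e = 0"
    unfolding X_def g_def
    using irr chain f by (intro chain_functions_algebraically_independent[of m Z f]) auto
  then show False using c(1) by blast
qed

section \<open>Regular maps, tangent spaces and local dimension\<close>

text \<open>The denominator is a parameter because it also serves to describe where a birational map is
  an isomorphism.\<close>

definition regular_away :: "(complex ^ 'u::finite \<Rightarrow> complex) \<Rightarrow> (complex ^ 'u \<Rightarrow> complex ^ 'v::finite) \<Rightarrow> bool"
  where "regular_away den \<tau> \<longleftrightarrow> polynomial_fun den \<and>
    (\<exists>num. (\<forall>i. polynomial_fun (\<lambda>y. num y $ i)) \<and> (\<forall>y. den y \<noteq> 0 \<longrightarrow> den y *s \<tau> y = num y))"

lemma regular_away_pullback: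
  assumes "regular_away den \<tau>" "polynomial_fun f"
  obtains N F where "polynomial_fun F" "\<And>y. den y \<noteq> 0 \<Longrightarrow> F y = den y ^ N * f (\<tau> y)"
proof -
  obtain num where num: "\<And>i. polynomial_fun (\<lambda>y. num y $ i)"
    "\<And>y. den y \<noteq> 0 \<Longrightarrow> den y *s \<tau> y = num y" and den: "polynomial_fun den"
    using assms(1) unfolding regular_away_def by blast
  show ?thesis
    using polynomial_fun_clear_denominator[OF assms(2) num(1) den] num(2) that by metis
qed

lemma closedin_zariski_pullback:
  assumes "regular_away den \<tau>" "closedin zariski A"
  shows "closedin zariski {x. den x = 0 \<or> \<tau> x \<in> A}"
proof -
  obtain P where P: "\<forall>f\<in>P. polynomial_fun f" "A = {x. \<forall>f\<in>P. f x = 0}"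
    using assms(2) unfolding closedin_zariski by blast
  have "\<exists>G. polynomial_fun G \<and> (\<forall>x. G x = 0 \<longleftrightarrow> den x = 0 \<or> f (\<tau> x) = 0)" if f: "f \<in> P" for f
  proof -
    obtain N F where F: "polynomial_fun F" "\<And>y. den y \<noteq> 0 \<Longrightarrow> F y = den y ^ N * f (\<tau> y)"
      using regular_away_pullback[OF assms(1)] P(1) f by metis
    have den: "polynomial_fun den" using assms(1) unfolding regular_away_def by blast
    show ?thesis
    proof (intro exI conjI allI)
      show "polynomial_fun (\<lambda>x. den x * F x)" by (rule polynomial_fun.mult[OF den F(1)])
      show "den x * F x = 0 \<longleftrightarrow> den x = 0 \<or> f (\<tau> x) = 0" for x
        using F(2)[of x] by (cases "den x = 0") auto
    qed
  qed
  then obtain G where G: "\<And>f. f \<in> P \<Longrightarrow> polynomial_fun (G f)"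
    "\<And>f x. f \<in> P \<Longrightarrow> G f x = 0 \<longleftrightarrow> den x = 0 \<or> f (\<tau> x) = 0" by metis
  have "{x. den x = 0 \<or> \<tau> x \<in> A} = {x. \<forall>g\<in>insert (\<lambda>_. 0) (G ` P). g x = 0}"
    using G(2) P(2) by auto
  then show ?thesis
    using closedin_zariski_common_zeros[of "insert (\<lambda>_. 0) (G ` P)"] G(1) polynomial_fun.const
    by auto
qed

lemma irreducible_in_zariski_regular_image:
  assumes "regular_away den \<tau>" "irreducible_in zariski S" "\<And>x. x \<in> S \<Longrightarrow> den x \<noteq> 0"
  shows "irreducible_in zariski (\<tau> ` S)"
  unfolding irreducible_in_def
proof (intro conjI allI impI)
  show "\<tau> ` S \<noteq> {}" using assms(2) unfolding irreducible_in_def by blast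
  fix A B assume AB: "closedin zariski A \<and> closedin zariski B \<and> \<tau> ` S \<subseteq> A \<union> B"
  then have "S \<subseteq> {x. den x = 0 \<or> \<tau> x \<in> A} \<union> {x. den x = 0 \<or> \<tau> x \<in> B}" by blast
  then have "S \<subseteq> {x. den x = 0 \<or> \<tau> x \<in> A} \<or> S \<subseteq> {x. den x = 0 \<or> \<tau> x \<in> B}"
    using irreducible_inD[OF assms(2)] closedin_zariski_pullback[OF assms(1)] AB by blast
  then show "\<tau> ` S \<subseteq> A \<or> \<tau> ` S \<subseteq> B" using assms(3) by blast
qed simp

lemma DERIV_eventually_eq:
  assumes "(f has_field_derivative d) (at a)" "\<forall>\<^sub>F t in nhds a. f t = g t"
  shows "(g has_field_derivative d) (at a)"
  using DERIV_cong_ev[OF refl assms(2) refl, of d] assms(1) by blast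

lemma DERIV_zero_iff:
  assumes "(f has_field_derivative d) (at a)"
  shows "(f has_field_derivative 0) (at a) \<longleftrightarrow> d = 0"
proof
  assume "(f has_field_derivative 0) (at a)"
  then show "d = 0" using assms by (rule DERIV_unique[symmetric])
qed (use assms in simp)

text \<open>Differentials are tested on all curves through a point instead of on lines only, so that they
  can be composed: a map takes lines to curves.\<close>

definition curve_at :: "(complex \<Rightarrow> complex ^ 'v::finite) \<Rightarrow> complex ^ 'v \<Rightarrow> complex ^ 'v \<Rightarrow> bool" where
  "curve_at \<gamma> p v \<longleftrightarrow> \<gamma> 0 = p \<and> (\<forall>i. ((\<lambda>t. \<gamma> t $ i) has_field_derivative v $ i) (at 0))"

lemma curve_at_line: "curve_at (\<lambda>t. p + t *s v) p v"
  unfolding curve_at_def by (auto intro!: derivative_eq_intros)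

lemma polynomial_fun_differential:
  assumes "polynomial_fun f"
  shows "\<exists>c. \<forall>\<gamma> v. curve_at \<gamma> p v \<longrightarrow>
    ((\<lambda>t. f (\<gamma> t)) has_field_derivative (\<Sum>i\<in>UNIV. c i * v $ i)) (at 0)"
  using assms
proof induction
  case (const c)
  show ?case by (intro exI[of _ "\<lambda>_. 0"]) simp
next
  case (coord i)
  show ?case
    by (intro exI[of _ "\<lambda>j. if j = i then 1 else 0"])
       (simp add: curve_at_def if_distrib[of "\<lambda>x. x * _"] cong: if_cong)
next
  case (add f g)
  then obtain c d where
    "\<forall>\<gamma> v. curve_at \<gamma> p v \<longrightarrow> ((\<lambda>t. f (\<gamma> t)) has_field_derivative (\<Sum>i\<in>UNIV. c i * v $ i)) (at 0)"
    "\<forall>\<gamma> v. curve_at \<gamma> p v \<longrightarrow> ((\<lambda>t. g (\<gamma> t)) has_field_derivative (\<Sum>i\<in>UNIV. d i * v $ i)) (at 0)"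
    by blast
  then show ?case
    by (intro exI[of _ "\<lambda>i. c i + d i"])
       (auto simp: algebra_simps sum.distrib intro!: derivative_eq_intros)
next
  case (mult f g)
  then obtain c d where
    "\<forall>\<gamma> v. curve_at \<gamma> p v \<longrightarrow> ((\<lambda>t. f (\<gamma> t)) has_field_derivative (\<Sum>i\<in>UNIV. c i * v $ i)) (at 0)"
    "\<forall>\<gamma> v. curve_at \<gamma> p v \<longrightarrow> ((\<lambda>t. g (\<gamma> t)) has_field_derivative (\<Sum>i\<in>UNIV. d i * v $ i)) (at 0)"
    by blast
  then show ?case
    by (intro exI[of _ "\<lambda>i. c i * g p + d i * f p"])
       (auto simp: curve_at_def algebra_simps sum.distrib sum_distrib_left
         intro!: derivative_eq_intros)
qed

lemma polynomial_fun_nonzero_along_curve: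
  assumes "polynomial_fun f" "curve_at \<gamma> p v" "f p \<noteq> 0"
  shows "\<forall>\<^sub>F t in nhds 0. f (\<gamma> t) \<noteq> 0"
proof -
  obtain d where "((\<lambda>t. f (\<gamma> t)) has_field_derivative d) (at 0)"
    using polynomial_fun_differential[OF assms(1), of p] assms(2) by blast
  then have "isCont (\<lambda>t. f (\<gamma> t)) 0" by (rule DERIV_isCont)
  then have "\<forall>\<^sub>F t in at 0. f (\<gamma> t) \<noteq> 0"
    using assms(2,3) unfolding isCont_def curve_at_def by (intro tendsto_imp_eventually_ne) auto
  then show ?thesis using assms(2,3) by (simp add: eventually_nhds_conv_at curve_at_def)
qed

lemma regular_away_differential:
  fixes \<tau> :: "complex ^ 'u::finite \<Rightarrow> complex ^ 'v::finite"
  assumes "regular_away den \<tau>" "den p \<noteq> 0"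
  shows "\<exists>C. \<forall>\<gamma> v. curve_at \<gamma> p v \<longrightarrow> curve_at (\<lambda>t. \<tau> (\<gamma> t)) (\<tau> p) (C *v v)"
proof -
  obtain num where num: "\<And>i. polynomial_fun (\<lambda>y. num y $ i)"
    "\<And>y. den y \<noteq> 0 \<Longrightarrow> den y *s \<tau> y = num y" and den: "polynomial_fun den"
    using assms(1) unfolding regular_away_def by blast
  obtain c where c: "\<And>i \<gamma> v. curve_at \<gamma> p v \<Longrightarrow>
    ((\<lambda>t. num (\<gamma> t) $ i) has_field_derivative (\<Sum>j\<in>UNIV. c i j * v $ j)) (at 0)"
    using polynomial_fun_differential[OF num(1)] by metis
  obtain d where d: "\<And>\<gamma> v. curve_at \<gamma> p v \<Longrightarrow>
    ((\<lambda>t. den (\<gamma> t)) has_field_derivative (\<Sum>j\<in>UNIV. d j * v $ j)) (at 0)"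
    using polynomial_fun_differential[OF den] by metis
  define C :: "complex ^ 'u ^ 'v" where
    "C = (\<chi> i j. (c i j * den p - num p $ i * d j) / (den p * den p))"
  have "curve_at (\<lambda>t. \<tau> (\<gamma> t)) (\<tau> p) (C *v v)" if \<gamma>: "curve_at \<gamma> p v" for \<gamma> v
    unfolding curve_at_def
  proof (intro conjI allI)
    show "\<tau> (\<gamma> 0) = \<tau> p" using \<gamma> unfolding curve_at_def by simp
    fix i
    have \<gamma>0: "\<gamma> 0 = p" using \<gamma> unfolding curve_at_def by simp
    have "((\<lambda>t. num (\<gamma> t) $ i / den (\<gamma> t)) has_field_derivative
        ((\<Sum>j\<in>UNIV. c i j * v $ j) * den p - num p $ i * (\<Sum>j\<in>UNIV. d j * v $ j)) / (den p * den p))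
        (at 0)"
      using DERIV_divide[OF c[OF \<gamma>, of i] d[OF \<gamma>]] assms(2) \<gamma>0 by simp
    moreover have "((\<Sum>j\<in>UNIV. c i j * v $ j) * den p - num p $ i * (\<Sum>j\<in>UNIV. d j * v $ j)) /
        (den p * den p) = (C *v v) $ i"
    proof -
      have "(C *v v) $ i =
          (\<Sum>j\<in>UNIV. ((c i j * v $ j) * den p - num p $ i * (d j * v $ j)) / (den p * den p))"
        unfolding C_def matrix_vector_mult_def vec_lambda_beta
        by (intro sum.cong refl) (simp add: algebra_simps)
      also have "\<dots> = ((\<Sum>j\<in>UNIV. c i j * v $ j) * den p - num p $ i * (\<Sum>j\<in>UNIV. d j * v $ j)) /
          (den p * den p)"
        by (simp add: sum_divide_distrib diff_divide_distrib sum_subtractf sum_distrib_left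
            sum_distrib_right)
      finally show ?thesis ..
    qed
    moreover have "\<forall>\<^sub>F t in nhds 0. den (\<gamma> t) \<noteq> 0"
      by (rule polynomial_fun_nonzero_along_curve[OF den \<gamma> assms(2)])
    then have "\<forall>\<^sub>F t in nhds 0. num (\<gamma> t) $ i / den (\<gamma> t) = \<tau> (\<gamma> t) $ i"
    proof (rule eventually_mono)
      fix t assume t: "den (\<gamma> t) \<noteq> 0"
      have "num (\<gamma> t) $ i = den (\<gamma> t) * \<tau> (\<gamma> t) $ i" using num(2)[OF t] by (metis vector_smult_component)
      then show "num (\<gamma> t) $ i / den (\<gamma> t) = \<tau> (\<gamma> t) $ i" using t by simp
    qed
    ultimately show "((\<lambda>t. \<tau> (\<gamma> t) $ i) has_field_derivative (C *v v) $ i) (at 0)"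
      using DERIV_eventually_eq[of "\<lambda>t. num (\<gamma> t) $ i / den (\<gamma> t)"] by simp
  qed
  then show ?thesis by blast
qed

lemma curve_at_unique:
  assumes "curve_at \<gamma> p v" "curve_at \<gamma> p w"
  shows "v = w"
  unfolding vec_eq_iff
proof
  fix i show "v $ i = w $ i"
    using assms DERIV_unique[of "\<lambda>t. \<gamma> t $ i" "v $ i" 0 "w $ i"] unfolding curve_at_def by simp
qed

lemma in_tangent_space_iff_curve:
  assumes "curve_at \<gamma> p v"
  shows "v \<in> tangent_space X p \<longleftrightarrow>
    (\<forall>f. polynomial_fun f \<and> (\<forall>x\<in>X. f x = 0) \<longrightarrow> ((\<lambda>t. f (\<gamma> t)) has_field_derivative 0) (at 0))"
proof -
  have "((\<lambda>t. f (\<gamma> t)) has_field_derivative 0) (at 0) \<longleftrightarrow>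
      ((\<lambda>t. f (p + t *s v)) has_field_derivative 0) (at 0)" if f: "polynomial_fun f" for f
  proof -
    obtain c where c: "\<And>\<gamma> v. curve_at \<gamma> p v \<Longrightarrow>
        ((\<lambda>t. f (\<gamma> t)) has_field_derivative (\<Sum>i\<in>UNIV. c i * v $ i)) (at 0)"
      using polynomial_fun_differential[OF f, of p] by blast
    show ?thesis
      unfolding DERIV_zero_iff[OF c[OF assms]] DERIV_zero_iff[OF c[OF curve_at_line[of p v]]] ..
  qed
  then show ?thesis unfolding tangent_space_def by blast
qed

lemma subspace_tangent_space: "vec.subspace (tangent_space X p)"
proof -
  have lin: "\<exists>c. \<forall>v. ((\<lambda>t. f (p + t *s v)) has_field_derivative 0) (at 0) \<longleftrightarrow> (\<Sum>i\<in>UNIV. c i * v $ i) = 0"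
    if f: "polynomial_fun f" for f
  proof -
    obtain c where c: "\<And>\<gamma> v. curve_at \<gamma> p v \<Longrightarrow>
        ((\<lambda>t. f (\<gamma> t)) has_field_derivative (\<Sum>i\<in>UNIV. c i * v $ i)) (at 0)"
      using polynomial_fun_differential[OF f, of p] by blast
    show ?thesis
    proof (intro exI allI)
      fix v
      show "((\<lambda>t. f (p + t *s v)) has_field_derivative 0) (at 0) \<longleftrightarrow> (\<Sum>i\<in>UNIV. c i * v $ i) = 0"
        by (rule DERIV_zero_iff[OF c[OF curve_at_line[of p v]]])
    qed
  qed
  show ?thesis
    unfolding vec.subspace_def
  proof (intro conjI ballI allI)
    show "0 \<in> tangent_space X p" unfolding tangent_space_def by simp
    show "v + w \<in> tangent_space X p" if "v \<in> tangent_space X p" "w \<in> tangent_space X p" for v w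
      unfolding tangent_space_def mem_Collect_eq
    proof (intro allI impI)
      fix f assume f: "polynomial_fun f \<and> (\<forall>x\<in>X. f x = 0)"
      obtain c where c: "\<forall>v. ((\<lambda>t. f (p + t *s v)) has_field_derivative 0) (at 0) \<longleftrightarrow> (\<Sum>i\<in>UNIV. c i * v $ i) = 0"
        using lin f by blast
      have "(\<Sum>i\<in>UNIV. c i * v $ i) = 0" "(\<Sum>i\<in>UNIV. c i * w $ i) = 0"
        using c that f unfolding tangent_space_def by blast+
      then have "(\<Sum>i\<in>UNIV. c i * (v + w) $ i) = 0"
        by (simp add: distrib_left sum.distrib)
      then show "((\<lambda>t. f (p + t *s (v + w))) has_field_derivative 0) (at 0)"
        using c by blast
    qed
    show "a *s v \<in> tangent_space X p" if "v \<in> tangent_space X p" for a v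
      unfolding tangent_space_def mem_Collect_eq
    proof (intro allI impI)
      fix f assume f: "polynomial_fun f \<and> (\<forall>x\<in>X. f x = 0)"
      obtain c where c: "\<forall>v. ((\<lambda>t. f (p + t *s v)) has_field_derivative 0) (at 0) \<longleftrightarrow> (\<Sum>i\<in>UNIV. c i * v $ i) = 0"
        using lin f by blast
      have "(\<Sum>i\<in>UNIV. c i * (a *s v) $ i) = a * (\<Sum>i\<in>UNIV. c i * v $ i)"
        by (simp add: sum_distrib_left algebra_simps)
      moreover have "(\<Sum>i\<in>UNIV. c i * v $ i) = 0"
        using c that f unfolding tangent_space_def by blast
      ultimately have "(\<Sum>i\<in>UNIV. c i * (a *s v) $ i) = 0" by simp
      then show "((\<lambda>t. f (p + t *s (a *s v))) has_field_derivative 0) (at 0)"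
        using c by blast
    qed
  qed
qed

lemma tangent_space_line:
  assumes "\<And>t. p + t *s v \<in> X"
  shows "v \<in> tangent_space X p"
  unfolding tangent_space_def using assms by auto

lemma tangent_space_coordinate_subspace:
  assumes "\<And>x c. x \<in> X \<Longrightarrow> c \<notin> S \<Longrightarrow> x $ c = 0" "v \<in> tangent_space X p" "c \<notin> S"
  shows "v $ c = 0"
proof -
  have "((\<lambda>t. (p + t *s v) $ c) has_field_derivative 0) (at 0)"
    using assms polynomial_fun.coord[of c] unfolding tangent_space_def by blast
  moreover have "((\<lambda>t. (p + t *s v) $ c) has_field_derivative v $ c) (at 0)"
    using curve_at_line unfolding curve_at_def by blast
  ultimately show ?thesis using DERIV_unique by metis
qed

text \<open>A function that vanishes on \<open>Y\<close> pulls back to a polynomial that vanishes on \<open>X\<close>, once it is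
  multiplied by one more power of \<open>den\<close> to cover the points where \<open>\<tau>\<close> is not defined.\<close>

lemma tangent_space_regular_image:
  assumes reg: "regular_away den \<tau>" and p: "p \<in> X" "den p \<noteq> 0"
    and XY: "\<And>x. x \<in> X \<Longrightarrow> den x \<noteq> 0 \<Longrightarrow> \<tau> x \<in> Y"
    and C: "\<And>\<gamma> v. curve_at \<gamma> p v \<Longrightarrow> curve_at (\<lambda>t. \<tau> (\<gamma> t)) (\<tau> p) (C *v v)"
    and v: "v \<in> tangent_space X p"
  shows "C *v v \<in> tangent_space Y (\<tau> p)"
  unfolding in_tangent_space_iff_curve[OF C[OF curve_at_line]]
proof (intro allI impI)
  fix f assume f: "polynomial_fun f \<and> (\<forall>y\<in>Y. f y = 0)"
  obtain N F where F: "polynomial_fun F" "\<And>y. den y \<noteq> 0 \<Longrightarrow> F y = den y ^ N * f (\<tau> y)"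
    using regular_away_pullback[OF reg] f by metis
  have den: "polynomial_fun den" using reg unfolding regular_away_def by blast
  let ?\<gamma> = "\<lambda>t. p + t *s v"
  define G where "G = (\<lambda>x. den x * F x)"
  have "polynomial_fun G" unfolding G_def by (rule polynomial_fun.mult[OF den F(1)])
  moreover have G0: "G x = 0" if "x \<in> X" for x
    using F(2)[of x] XY[OF that] f by (cases "den x = 0") (auto simp: G_def)
  ultimately have DG: "((\<lambda>t. G (?\<gamma> t)) has_field_derivative 0) (at 0)"
    using v unfolding tangent_space_def by blast
  have "polynomial_fun (\<lambda>x. den x ^ Suc N)" by (rule polynomial_fun_power[OF den])
  from polynomial_fun_differential[OF this, of p]
  obtain d where Dd: "((\<lambda>t. den (?\<gamma> t) ^ Suc N) has_field_derivative d) (at 0)"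
    using curve_at_line by blast
  have "((\<lambda>t. G (?\<gamma> t) / den (?\<gamma> t) ^ Suc N) has_field_derivative 0) (at 0)"
    using DERIV_divide[OF DG Dd] p G0[OF p(1)] by simp
  moreover have "\<forall>\<^sub>F t in nhds 0. G (?\<gamma> t) / den (?\<gamma> t) ^ Suc N = f (\<tau> (?\<gamma> t))"
    using polynomial_fun_nonzero_along_curve[OF den curve_at_line p(2)]
    by (rule eventually_mono) (auto simp: G_def F(2))
  ultimately show "((\<lambda>t. f (\<tau> (?\<gamma> t))) has_field_derivative 0) (at 0)"
    by (rule DERIV_eventually_eq)
qed

text \<open>The inverse map is only known on a coordinate subspace that contains \<open>X\<close>. Since the tangent
  vectors of \<open>X\<close> lie in that subspace, the differential of \<open>\<tau>\<close> is still injective on them.\<close>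

lemma dim_tangent_space_le:
  fixes \<tau> :: "complex ^ 'u::finite \<Rightarrow> complex ^ 'v::finite"
  assumes reg: "regular_away den \<tau>" "regular_away den' \<sigma>" and p: "p \<in> X" "den p \<noteq> 0" "den' (\<tau> p) \<noteq> 0"
    and XY: "\<And>x. x \<in> X \<Longrightarrow> den x \<noteq> 0 \<Longrightarrow> \<tau> x \<in> Y"
    and XL: "\<And>x c. x \<in> X \<Longrightarrow> c \<notin> S \<Longrightarrow> x $ c = 0"
    and inv: "\<And>x. (\<And>c. c \<notin> S \<Longrightarrow> x $ c = 0) \<Longrightarrow> den x \<noteq> 0 \<Longrightarrow> \<sigma> (\<tau> x) = x"
  shows "vec.dim (tangent_space X p) \<le> vec.dim (tangent_space Y (\<tau> p))"
proof -
  obtain C where C: "\<And>\<gamma> v. curve_at \<gamma> p v \<Longrightarrow> curve_at (\<lambda>t. \<tau> (\<gamma> t)) (\<tau> p) (C *v v)"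
    using regular_away_differential[OF reg(1) p(2)] by blast
  obtain C' where C': "\<And>\<gamma> v. curve_at \<gamma> (\<tau> p) v \<Longrightarrow> curve_at (\<lambda>t. \<sigma> (\<gamma> t)) (\<sigma> (\<tau> p)) (C' *v v)"
    using regular_away_differential[OF reg(2) p(3)] by blast
  have den: "polynomial_fun den" using reg unfolding regular_away_def by blast
  have inverse: "C' *v (C *v v) = v" if v: "v \<in> tangent_space X p" for v
  proof -
    let ?\<gamma> = "\<lambda>t. p + t *s v"
    have vL: "v $ c = 0" if "c \<notin> S" for c
      using tangent_space_coordinate_subspace[of X S, OF XL v that] by blast
    have c1: "curve_at (\<lambda>t. \<sigma> (\<tau> (?\<gamma> t))) (\<sigma> (\<tau> p)) (C' *v (C *v v))"
      by (intro C' C curve_at_line)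
    have ev: "\<forall>\<^sub>F t in nhds 0. den (?\<gamma> t) \<noteq> 0"
      by (rule polynomial_fun_nonzero_along_curve[OF den curve_at_line p(2)])
    have "((\<lambda>t. ?\<gamma> t $ i) has_field_derivative (C' *v (C *v v)) $ i) (at 0)" for i
    proof -
      have "\<forall>\<^sub>F t in nhds 0. \<sigma> (\<tau> (?\<gamma> t)) $ i = ?\<gamma> t $ i"
        using ev by (rule eventually_mono) (subst inv, use XL[OF p(1)] vL in auto)
      moreover have "((\<lambda>t. \<sigma> (\<tau> (?\<gamma> t)) $ i) has_field_derivative (C' *v (C *v v)) $ i) (at 0)"
        using c1 unfolding curve_at_def by blast
      ultimately show ?thesis by (rule DERIV_eventually_eq[rotated])
    qed
    then have "curve_at ?\<gamma> p (C' *v (C *v v))" unfolding curve_at_def by simp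
    then show ?thesis using curve_at_unique curve_at_line by blast
  qed
  have "inj_on ((*v) C) (tangent_space X p)"
    by (metis inj_onI inverse)
  then have "vec.dim ((*v) C ` tangent_space X p) = vec.dim (tangent_space X p)"
    by (intro vec.dim_image_eq) (simp_all add: vec.span_eq_iff[THEN iffD2, OF subspace_tangent_space])
  moreover have "(*v) C ` tangent_space X p \<subseteq> tangent_space Y (\<tau> p)"
    using tangent_space_regular_image[OF reg(1) p(1,2) XY C] by blast
  ultimately show ?thesis using vec.dim_subset by metis
qed

lemma local_dim_leI:
  assumes "\<And>m Z. (\<And>i. i \<le> m \<Longrightarrow> closedin zariski (Z i)) \<Longrightarrow> (\<And>i. i \<le> m \<Longrightarrow> irreducible_in zariski (Z i)) \<Longrightarrow>
    (\<And>i. i \<le> m \<Longrightarrow> p \<in> Z i) \<Longrightarrow> (\<And>i. i \<le> m \<Longrightarrow> Z i \<subseteq> X) \<Longrightarrow> (\<And>i. i < m \<Longrightarrow> Z i \<subset> Z (Suc i)) \<Longrightarrow> enat m \<le> d"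
  shows "local_dim X p \<le> d"
  unfolding local_dim_def
proof (rule Sup_least, clarify)
  fix m Z
  assume "\<forall>i\<le>m. closedin zariski (Z i) \<and> irreducible_in zariski (Z i) \<and> p \<in> Z i \<and> Z i \<subseteq> X"
    "\<forall>i<m. Z i \<subset> Z (Suc i)"
  then show "enat m \<le> d" by (intro assms[of m Z]) auto
qed

lemma local_dim_geI:
  assumes "\<And>i. i \<le> m \<Longrightarrow> closedin zariski (Z i)" "\<And>i. i \<le> m \<Longrightarrow> irreducible_in zariski (Z i)"
    "\<And>i. i \<le> m \<Longrightarrow> p \<in> Z i" "\<And>i. i \<le> m \<Longrightarrow> Z i \<subseteq> X" "\<And>i. i < m \<Longrightarrow> Z i \<subset> Z (Suc i)"
  shows "enat m \<le> local_dim X p"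
  unfolding local_dim_def using assms by (intro Sup_upper CollectI exI[of _ m] conjI refl exI[of _ Z]) auto

text \<open>The closures of the images of the members of a chain through \<open>p\<close> form a chain through
  \<open>\<tau> p\<close>; it is strict because the inverse of \<open>\<tau>\<close> recovers each member near \<open>p\<close>.\<close>

lemma local_dim_le_regular_image:
  assumes reg: "regular_away den \<tau>" "regular_away den' \<sigma>" and p: "den p \<noteq> 0"
    and Y: "closedin zariski Y"
    and XY: "\<And>x. x \<in> X \<Longrightarrow> den x \<noteq> 0 \<Longrightarrow> \<tau> x \<in> Y \<and> den' (\<tau> x) \<noteq> 0 \<and> \<sigma> (\<tau> x) = x"
  shows "local_dim X p \<le> local_dim Y (\<tau> p)"
proof (rule local_dim_leI)
  fix m Z
  assume Z: "\<And>i. i \<le> m \<Longrightarrow> closedin zariski (Z i)" "\<And>i. i \<le> m \<Longrightarrow> irreducible_in zariski (Z i)"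
    "\<And>i. i \<le> m \<Longrightarrow> p \<in> Z i" "\<And>i. i \<le> m \<Longrightarrow> Z i \<subseteq> X" "\<And>i. i < m \<Longrightarrow> Z i \<subset> Z (Suc i)"
  have den: "polynomial_fun den" using reg unfolding regular_away_def by blast
  define W where "W = (\<lambda>i. zariski closure_of (\<tau> ` (Z i \<inter> {x. den x \<noteq> 0})))"
  have image_W: "\<tau> ` (Z i \<inter> {x. den x \<noteq> 0}) \<subseteq> W i" for i
    unfolding W_def by (intro closure_of_subset) simp
  show "enat m \<le> local_dim Y (\<tau> p)"
  proof (rule local_dim_geI)
    fix i assume i: "i \<le> m"
    show "closedin zariski (W i)" unfolding W_def by (rule closedin_closure_of)
    show "irreducible_in zariski (W i)"
      unfolding W_def using Z(2,3)[OF i] p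
      by (intro irreducible_in_closure_of irreducible_in_zariski_regular_image[OF reg(1)]
          irreducible_in_Int_open openin_zariski_nonzero den) auto
    show "\<tau> p \<in> W i" using Z(3)[OF i] p image_W by blast
    show "W i \<subseteq> Y" unfolding W_def using Z(4)[OF i] XY by (intro closure_of_minimal Y) auto
  next
    fix i assume i: "i < m"
    have "W i \<subseteq> W (Suc i)" unfolding W_def using Z(5)[OF i] by (intro closure_of_mono) auto
    moreover have "W i \<noteq> W (Suc i)"
    proof
      assume eq: "W i = W (Suc i)"
      have "W i \<subseteq> {y. den' y = 0 \<or> \<sigma> y \<in> Z i}"
        unfolding W_def
        using Z(1,4)[of i] i XY by (intro closure_of_minimal closedin_zariski_pullback[OF reg(2)]) auto
      have "x \<in> Z i" if x: "x \<in> Z (Suc i)" "den x \<noteq> 0" for x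
      proof -
        have "\<tau> x \<in> W i" using x image_W eq by blast
        then have "den' (\<tau> x) = 0 \<or> \<sigma> (\<tau> x) \<in> Z i"
          using \<open>W i \<subseteq> {y. den' y = 0 \<or> \<sigma> y \<in> Z i}\<close> by blast
        moreover have "x \<in> X" using x Z(4)[of "Suc i"] i by auto
        ultimately show ?thesis using XY[of x] x by auto
      qed
      then have "Z (Suc i) \<subseteq> Z i \<union> {x. den x = 0}" by blast
      then have "Z (Suc i) \<subseteq> Z i \<or> Z (Suc i) \<subseteq> {x. den x = 0}"
        using Z(1,2) i closedin_zariski_zeros[OF den]
        by (intro irreducible_inD) auto
      then show False using Z(5)[OF i] Z(3)[of "Suc i"] i p by auto
    qed
    ultimately show "W i \<subset> W (Suc i)" by blast
  qed
qed

text \<open>Regularity of a point only depends on a neighbourhood: both dimensions are monotone under a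
  local isomorphism, hence invariant.\<close>

lemma singular_points_regular_isomorphism:
  assumes reg: "regular_away den \<tau>" "regular_away den' \<sigma>"
    and closed: "closedin zariski X" "closedin zariski Y"
    and XL: "\<And>x c. x \<in> X \<Longrightarrow> c \<notin> S \<Longrightarrow> x $ c = 0" and YL: "\<And>y c. y \<in> Y \<Longrightarrow> c \<notin> S' \<Longrightarrow> y $ c = 0"
    and \<tau>: "\<And>x. (\<And>c. c \<notin> S \<Longrightarrow> x $ c = 0) \<Longrightarrow> den x \<noteq> 0 \<Longrightarrow> den' (\<tau> x) \<noteq> 0 \<and> \<sigma> (\<tau> x) = x"
    and \<sigma>: "\<And>y. (\<And>c. c \<notin> S' \<Longrightarrow> y $ c = 0) \<Longrightarrow> den' y \<noteq> 0 \<Longrightarrow> den (\<sigma> y) \<noteq> 0 \<and> \<tau> (\<sigma> y) = y"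
    and XY: "\<And>x. x \<in> X \<Longrightarrow> den x \<noteq> 0 \<Longrightarrow> \<tau> x \<in> Y" and YX: "\<And>y. y \<in> Y \<Longrightarrow> den' y \<noteq> 0 \<Longrightarrow> \<sigma> y \<in> X"
    and p: "p \<in> X" "den p \<noteq> 0"
  shows "p \<in> singular_points X \<longleftrightarrow> \<tau> p \<in> singular_points Y"
proof -
  have q: "\<tau> p \<in> Y" "den' (\<tau> p) \<noteq> 0" "\<sigma> (\<tau> p) = p"
    using XY[OF p] \<tau>[OF XL[OF p(1)] p(2)] by auto
  have "vec.dim (tangent_space X p) \<le> vec.dim (tangent_space Y (\<tau> p))"
    using reg p q(2) XY XL \<tau> by (intro dim_tangent_space_le[of den \<tau> den' \<sigma> p X Y S]) auto
  moreover have "vec.dim (tangent_space Y (\<tau> p)) \<le> vec.dim (tangent_space X (\<sigma> (\<tau> p)))"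
    using reg p q YX YL \<sigma> by (intro dim_tangent_space_le[of den' \<sigma> den \<tau> "\<tau> p" Y X S']) auto
  moreover have "local_dim X p \<le> local_dim Y (\<tau> p)"
    using XY \<tau> XL by (intro local_dim_le_regular_image[OF reg p(2) closed(2)]) blast
  moreover have "local_dim Y (\<tau> p) \<le> local_dim X (\<sigma> (\<tau> p))"
    using YX \<sigma> YL by (intro local_dim_le_regular_image[OF reg(2,1) q(2) closed(1)]) blast
  ultimately show ?thesis
    unfolding singular_points_def using p(1) q by simp
qed

section \<open>Linear algebra\<close>

lemma independent_Un_direct:
  fixes S T :: "(complex ^ 'n::finite) set"
  assumes "vec.independent S" "vec.independent T" "vec.span S \<inter> vec.span T \<subseteq> {0}"
  shows "vec.independent (S \<union> T)" "S \<inter> T = {}"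
proof -
  have "vec.independent (S \<union> T')" if "T' \<subseteq> T" "finite T'" for T'
    using that(2,1)
  proof (induction T' rule: finite_induct)
    case empty
    then show ?case using assms(1) by simp
  next
    case (insert b T')
    have "b \<notin> vec.span (S \<union> T')"
    proof
      assume "b \<in> vec.span (S \<union> T')"
      then obtain x y where xy: "b = x + y" "x \<in> vec.span S" "y \<in> vec.span T'"
        by (auto simp: vec.span_Un)
      have T': "vec.span T' \<subseteq> vec.span T" using insert.prems by (intro vec.span_mono) auto
      have "x = b - y" using xy by simp
      moreover have "b - y \<in> vec.span T"
        using xy T' insert.prems by (intro vec.span_diff) (auto intro: vec.span_base)
      ultimately have "x = 0" using xy assms(3) by auto
      then have "b \<in> vec.span T'" using xy by simp
      also have "\<dots> \<subseteq> vec.span (T - {b})" using insert by (intro vec.span_mono) auto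
      finally show False using assms(2) insert.prems by (auto simp: vec.dependent_def)
    qed
    then have "vec.independent (insert b (S \<union> T'))"
      using insert by (intro vec.independent_insertI) auto
    then show ?case by simp
  qed
  then show "vec.independent (S \<union> T)"
    using vec.finiteI_independent[OF assms(2)] by blast
  have "x \<notin> T" if "x \<in> S" for x
  proof
    assume "x \<in> T"
    then have "x = 0" using that assms(3) vec.span_base[of x] by blast
    then show False using that assms(1) vec.dependent_zero by blast
  qed
  then show "S \<inter> T = {}" by blast
qed

lemma span_Int_span_independent:
  fixes B :: "(complex ^ 'n::finite) set"
  assumes "vec.independent B" "S \<subseteq> B" "T \<subseteq> B" "S \<inter> T = {}"
  shows "vec.span S \<inter> vec.span T = {0}"
proof (intro equalityI subsetI)
  fix x assume x: "x \<in> vec.span S \<inter> vec.span T"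
  have "vec.representation B x = vec.representation S x" "vec.representation B x = vec.representation T x"
    using x assms by (auto intro!: vec.representation_extend)
  then have "vec.representation B x b = 0" for b
    using vec.representation_ne_zero[of S x b] vec.representation_ne_zero[of T x b] assms(4) by auto
  moreover have "x \<in> vec.span B" using x vec.span_mono[OF assms(2)] by blast
  ultimately show "x \<in> {0}" using vec.sum_nonzero_representation_eq[OF assms(1), of x] by simp
qed (simp add: vec.span_zero)

lemma dim_add_le_if_trivial_Int:
  fixes A B :: "(complex ^ 'n::finite) set"
  assumes "vec.subspace A" "vec.subspace B" "A \<inter> B \<subseteq> {0}" "A \<union> B \<subseteq> F"
  shows "vec.dim A + vec.dim B \<le> vec.dim F"
proof -
  obtain S where S: "S \<subseteq> A" "vec.independent S" "A \<subseteq> vec.span S" "card S = vec.dim A"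
    using vec.basis_exists[of A] by blast
  obtain T where T: "T \<subseteq> B" "vec.independent T" "B \<subseteq> vec.span T" "card T = vec.dim B"
    using vec.basis_exists[of B] by blast
  have "vec.span S \<subseteq> A" "vec.span T \<subseteq> B"
    using S(1) T(1) assms(1,2) by (intro vec.span_minimal; simp)+
  then have "vec.independent (S \<union> T)" "S \<inter> T = {}"
    using independent_Un_direct[OF S(2) T(2)] assms(3) by blast+
  moreover have "S \<union> T \<subseteq> F" using S T assms by blast
  ultimately have "card (S \<union> T) \<le> vec.dim F" by (intro vec.independent_card_le_dim)
  then show ?thesis
    using S T \<open>S \<inter> T = {}\<close> by (simp add: card_Un_disjoint vec.finiteI_independent)
qed

text \<open>A complement of \<open>V\<close> that contains a complement of \<open>V \<inter> F\<close> in \<open>F\<close>.\<close>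

lemma complement_with_large_Int:
  fixes V F :: "(complex ^ 'n::finite) set"
  assumes "vec.subspace V" "vec.subspace F"
  obtains W where "vec.subspace W" "vec.dim W + vec.dim V = CARD('n)" "V \<inter> W = {0}"
    "vec.dim F \<le> vec.dim (V \<inter> F) + vec.dim (W \<inter> F)"
proof -
  obtain B0 where B0: "B0 \<subseteq> V \<inter> F" "vec.independent B0" "V \<inter> F \<subseteq> vec.span B0"
    "card B0 = vec.dim (V \<inter> F)"
    using vec.basis_exists[of "V \<inter> F"] by blast
  obtain B1 where B1: "B1 \<subseteq> V" "vec.independent B1" "V \<subseteq> vec.span B1" "card B1 = vec.dim V"
    using vec.basis_exists[of V] by blast
  obtain B2 where B2: "B0 \<subseteq> B2" "B2 \<subseteq> F" "vec.independent B2" "F \<subseteq> vec.span B2"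
    using vec.maximal_independent_subset_extend[of B0 F] B0 by auto
  let ?T = "B2 - B0"
  have T: "vec.independent ?T" using B2(3) by (rule vec.independent_mono) auto
  have spanT: "vec.span ?T \<subseteq> F" using B2 assms(2) by (intro vec.span_minimal) auto
  have spanB1: "vec.span B1 \<subseteq> V" using B1 assms(1) by (intro vec.span_minimal) auto
  have "vec.span B0 \<inter> vec.span ?T = {0}"
    by (rule span_Int_span_independent[OF B2(3)]) (use B2 in auto)
  then have "vec.span B1 \<inter> vec.span ?T \<subseteq> {0}"
    using spanT spanB1 B0(3) by blast
  then have BT: "vec.independent (B1 \<union> ?T)" "B1 \<inter> ?T = {}"
    using independent_Un_direct[OF B1(2) T] by auto
  obtain B where B: "B1 \<union> ?T \<subseteq> B" "vec.independent B" "UNIV \<subseteq> vec.span B"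
    using vec.maximal_independent_subset_extend[of "B1 \<union> ?T" UNIV] BT by auto
  have cardB: "card B = CARD('n)"
    using vec.basis_card_eq_dim[of B UNIV] B(2,3) by (simp add: card_cart_basis)
  define W where "W = vec.span (B - B1)"
  have ind: "vec.independent (B - B1)" using B(2) by (rule vec.independent_mono) auto
  have finB: "finite B" by (rule vec.finiteI_independent[OF B(2)])
  have "vec.dim W = card B - card B1"
    unfolding W_def vec.dim_span_eq_card_independent[OF ind]
    using B(1) finB by (intro card_Diff_subset) (auto intro: finite_subset)
  moreover have "card B1 \<le> card B" using B(1) finB by (auto intro: card_mono)
  ultimately have dimW: "vec.dim W + vec.dim V = CARD('n)" using B1(4) cardB by simp
  have "vec.span B1 \<inter> W = {0}"
    unfolding W_def by (rule span_Int_span_independent[OF B(2)]) (use B in auto)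
  moreover have "vec.span B1 = V" using spanB1 B1(3) by blast
  ultimately have VW: "V \<inter> W = {0}" by simp
  have "?T \<subseteq> W \<inter> F"
  proof
    fix x assume "x \<in> ?T"
    then have "x \<in> B - B1" "x \<in> F" using B(1) BT(2) B2(2) by auto
    then show "x \<in> W \<inter> F" unfolding W_def by (auto intro: vec.span_base)
  qed
  then have "card ?T \<le> vec.dim (W \<inter> F)" using T by (intro vec.independent_card_le_dim)
  moreover have "card B2 = vec.dim F" using B2 by (intro vec.basis_card_eq_dim)
  moreover have "card ?T = card B2 - card B0"
    using B2(1) vec.finiteI_independent[OF B0(2)] by (intro card_Diff_subset) auto
  ultimately have "vec.dim F \<le> vec.dim (V \<inter> F) + vec.dim (W \<inter> F)" using B0(4) by simp
  then show thesis using that[of W] dimW VW unfolding W_def by (simp add: vec.subspace_span)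
qed

text \<open>The incidence condition \<open>dim (V \<inter> F) \<ge> a\<close> in terms of conditions of the form
  \<open>V \<inter> W \<noteq> 0\<close> with \<open>dim V + dim W = n\<close>, each of which is the vanishing of a determinant.\<close>

lemma dim_Int_ge_iff:
  fixes V F :: "(complex ^ 'n::finite) set"
  assumes "vec.subspace V" "vec.subspace F"
  shows "a \<le> vec.dim (V \<inter> F) \<longleftrightarrow>
    (\<forall>W. vec.subspace W \<and> vec.dim W + vec.dim V = CARD('n) \<and> vec.dim F < a + vec.dim (W \<inter> F) \<longrightarrow>
       V \<inter> W \<noteq> {0})"
proof
  assume a: "a \<le> vec.dim (V \<inter> F)"
  show "\<forall>W. vec.subspace W \<and> vec.dim W + vec.dim V = CARD('n) \<and> vec.dim F < a + vec.dim (W \<inter> F) \<longrightarrow>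
       V \<inter> W \<noteq> {0}"
  proof (intro allI impI notI)
    fix W assume W: "vec.subspace W \<and> vec.dim W + vec.dim V = CARD('n) \<and> vec.dim F < a + vec.dim (W \<inter> F)"
      and "V \<inter> W = {0}"
    then have "vec.dim (V \<inter> F) + vec.dim (W \<inter> F) \<le> vec.dim F"
      using assms by (intro dim_add_le_if_trivial_Int vec.subspace_inter) auto
    then show False using a W by simp
  qed
next
  assume R: "\<forall>W. vec.subspace W \<and> vec.dim W + vec.dim V = CARD('n) \<and> vec.dim F < a + vec.dim (W \<inter> F) \<longrightarrow>
       V \<inter> W \<noteq> {0}"
  obtain W where "vec.subspace W" "vec.dim W + vec.dim V = CARD('n)" "V \<inter> W = {0}"
    "vec.dim F \<le> vec.dim (V \<inter> F) + vec.dim (W \<inter> F)"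
    using complement_with_large_Int[OF assms] by blast
  then have "\<not> vec.dim F < a + vec.dim (W \<inter> F)" using R by blast
  then show "a \<le> vec.dim (V \<inter> F)"
    using \<open>vec.dim F \<le> vec.dim (V \<inter> F) + vec.dim (W \<inter> F)\<close> by simp
qed

lemma independent_image_if_dim_span:
  fixes f :: "'a \<Rightarrow> complex ^ 'n::finite"
  assumes "vec.dim (vec.span (f ` X)) = card X" "finite X"
  shows "card (f ` X) = card X" "vec.independent (f ` X)"
proof -
  have "card (f ` X) \<le> card X" using assms(2) by (rule card_image_le)
  moreover have "vec.dim (f ` X) \<le> card (f ` X)"
    using assms(2) by (intro vec.dim_le_card vec.span_superset) auto
  ultimately show c: "card (f ` X) = card X" using assms(1) by simp
  show "vec.independent (f ` X)"
    using assms c by (intro vec.card_le_dim_spanning[of _ "vec.span (f ` X)"] vec.span_superset) auto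
qed

definition matrix_of_columns :: "('n \<Rightarrow> complex ^ 'n) \<Rightarrow> complex ^ 'n ^ 'n::finite" where
  "matrix_of_columns c = (\<chi> i j. c j $ i)"

lemma columns_matrix_of_columns: "columns (matrix_of_columns c) = range c"
  by (auto simp: columns_def column_def matrix_of_columns_def)

lemma matrix_of_columns_mult: "matrix_of_columns c *v x = (\<Sum>j\<in>UNIV. x $ j *s c j)"
  by (simp add: matrix_of_columns_def matrix_mult_sum column_def)

lemma det_matrix_of_columns_nonzero_iff:
  "det (matrix_of_columns c) \<noteq> 0 \<longleftrightarrow> vec.span (range c) = UNIV"
  unfolding columns_matrix_of_columns[symmetric] matrix_right_invertible_span_columns[symmetric]
    invertible_det_nz[symmetric] invertible_right_inverse ..

text \<open>Two subspaces of complementary dimensions meet trivially iff bases of them make up a basis of the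
  whole space.\<close>

lemma det_columns_zero_iff:
  fixes u w :: "'n::finite \<Rightarrow> complex ^ 'n"
  assumes "vec.dim (vec.span (u ` S)) = card S" "vec.dim (vec.span (w ` (- S))) = card (- S)"
  shows "det (matrix_of_columns (\<lambda>j. if j \<in> S then u j else w j)) \<noteq> 0 \<longleftrightarrow>
    vec.span (u ` S) \<inter> vec.span (w ` (- S)) = {0}"
proof -
  let ?c = "\<lambda>j. if j \<in> S then u j else w j"
  have range: "range ?c = u ` S \<union> w ` (- S)" by auto
  have n: "card S + card (- S) = CARD('n)"
    by (metis card_Un_disjoint Compl_disjoint finite Compl_partition)
  note ind = independent_image_if_dim_span[OF assms(1) finite] independent_image_if_dim_span[OF assms(2) finite]
  show ?thesis
  proof
    assume "vec.span (u ` S) \<inter> vec.span (w ` (- S)) = {0}"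
    then have "vec.independent (u ` S \<union> w ` (- S))" "u ` S \<inter> w ` (- S) = {}"
      using independent_Un_direct[of "u ` S" "w ` (- S)"] ind by auto
    moreover have "card (u ` S \<union> w ` (- S)) = CARD('n)"
      using ind n \<open>u ` S \<inter> w ` (- S) = {}\<close> by (simp add: card_Un_disjoint)
    ultimately have "UNIV \<subseteq> vec.span (u ` S \<union> w ` (- S))"
      by (intro vec.card_ge_dim_independent) (auto simp: card_cart_basis)
    then show "det (matrix_of_columns ?c) \<noteq> 0"
      unfolding det_matrix_of_columns_nonzero_iff range by blast
  next
    assume "det (matrix_of_columns ?c) \<noteq> 0"
    then have span: "vec.span (u ` S \<union> w ` (- S)) = UNIV"
      unfolding det_matrix_of_columns_nonzero_iff range .
    have "CARD('n) \<le> card (u ` S \<union> w ` (- S))"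
      using vec.dim_le_card[of UNIV "u ` S \<union> w ` (- S)"] span by (simp add: card_cart_basis)
    then have "u ` S \<inter> w ` (- S) = {}"
      using card_Un_Int[of "u ` S" "w ` (- S)"] ind n by auto
    moreover have "vec.independent (u ` S \<union> w ` (- S))"
      using span n ind card_Un_le[of "u ` S" "w ` (- S)"]
      by (intro vec.card_le_dim_spanning[of _ UNIV]) (auto simp: card_cart_basis)
    ultimately show "vec.span (u ` S) \<inter> vec.span (w ` (- S)) = {0}"
      by (intro span_Int_span_independent) auto
  qed
qed

section \<open>Coordinate subspaces and the standard flag\<close>

definition coord_space :: "'n set \<Rightarrow> (complex ^ 'n::finite) set" where
  "coord_space S = {x. \<forall>i. i \<notin> S \<longrightarrow> x $ i = 0}"

lemma subspace_coord_space: "vec.subspace (coord_space S)"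
  by (simp add: vec.subspace_def coord_space_def)

lemma dim_coord_space [simp]: "vec.dim (coord_space S) = card S"
  unfolding coord_space_def by (rule dim_substandard_cart)

lemma axis_in_coord_space_iff: "axis j 1 \<in> coord_space S \<longleftrightarrow> j \<in> S"
  by (auto simp: coord_space_def axis_def)

lemma vec_eq_sum_axis: "x = (\<Sum>j\<in>UNIV. x $ j *s axis j (1::complex))"
  by (simp add: vec_eq_iff axis_def if_distrib[of "\<lambda>x. _ * x"] cong: if_cong)

lemma coord_space_eq_sum:
  assumes "x \<in> coord_space S"
  shows "x = (\<Sum>j\<in>S. x $ j *s axis j 1)"
proof -
  have "x = (\<Sum>j\<in>UNIV. x $ j *s axis j (1::complex))" by (rule vec_eq_sum_axis)
  also have "\<dots> = (\<Sum>j\<in>S. x $ j *s axis j 1)"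
    using assms by (intro sum.mono_neutral_right) (auto simp: coord_space_def)
  finally show ?thesis .
qed

lemma span_axis: "vec.span ((\<lambda>j. axis j 1) ` S) = coord_space S"
proof
  show "vec.span ((\<lambda>j. axis j 1) ` S) \<subseteq> coord_space S"
    by (intro vec.span_minimal subspace_coord_space) (auto simp: axis_in_coord_space_iff)
  show "coord_space S \<subseteq> vec.span ((\<lambda>j. axis j 1) ` S)"
  proof
    fix x assume "x \<in> coord_space S"
    then have "x = (\<Sum>j\<in>S. x $ j *s axis j 1)" by (rule coord_space_eq_sum)
    also have "\<dots> \<in> vec.span ((\<lambda>j. axis j 1) ` S)"
      by (intro vec.span_sum vec.span_scale vec.span_base) auto
    finally show "x \<in> vec.span ((\<lambda>j. axis j 1) ` S)" .
  qed
qed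

text \<open>The place of an index, counted from the end: the last index has place 1.\<close>

definition place :: "'n::{finite,linorder} \<Rightarrow> nat" where
  "place j = card {l. j \<le> l}"

lemma place_less: "i < j \<Longrightarrow> place j < place i"
  unfolding place_def by (intro psubset_card_mono finite psubsetI) (auto dest: order.strict_trans2)

lemma inj_place: "inj place"
  by (rule injI) (metis place_less less_irrefl linorder_neqE)

lemma place_eq_iff [simp]: "place i = place j \<longleftrightarrow> i = j"
  by (auto dest: injD[OF inj_place])

lemma bij_betw_place: "bij_betw place (UNIV :: 'n::{finite,linorder} set) {1..CARD('n)}"
proof -
  have "place j \<in> {1..CARD('n)}" for j :: 'n
  proof -
    have "{j} \<subseteq> {l. j \<le> l}" by simp
    from card_mono[OF _ this] have "1 \<le> place j" unfolding place_def by simp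
    moreover have "place j \<le> CARD('n)" unfolding place_def by (intro card_mono) auto
    ultimately show ?thesis by simp
  qed
  then have "range (place :: 'n \<Rightarrow> nat) \<subseteq> {1..CARD('n)}" by blast
  moreover have "card (range (place :: 'n \<Rightarrow> nat)) = card {1..CARD('n)}"
    by (simp add: card_image inj_place)
  ultimately have "range (place :: 'n \<Rightarrow> nat) = {1..CARD('n)}"
    by (intro card_subset_eq) auto
  then show ?thesis using inj_place by (simp add: bij_betw_def)
qed

lemma place_pos: "0 < place (j :: 'n::{finite,linorder})"
  using bij_betw_place[where 'n = 'n] unfolding bij_betw_def by force

lemma place_nonzero [simp]: "place j \<noteq> 0"
  using place_pos[of j] by simp

lemma place_le: "place (j :: 'n::{finite,linorder}) \<le> CARD('n)"
  using bij_betw_place[where 'n = 'n] unfolding bij_betw_def by auto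

lemma ex_place:
  assumes "1 \<le> i" "i \<le> CARD('n)"
  obtains j :: "'n::{finite,linorder}" where "place j = i"
proof -
  have "i \<in> range (place :: 'n \<Rightarrow> nat)"
    using bij_betw_place[where 'n = 'n] assms unfolding bij_betw_def by simp
  then show thesis using that by blast
qed

lemma card_place_vimage:
  assumes "A \<subseteq> {1..CARD('n)}"
  shows "card {j :: 'n::{finite,linorder}. place j \<in> A} = card A"
proof (rule bij_betw_same_card[of place])
  show "bij_betw place {j :: 'n. place j \<in> A} A"
    using bij_betw_place[where 'n = 'n] assms unfolding bij_betw_def
    by (auto simp: inj_on_def image_iff)
qed

lemma last_span_eq:
  "last_span i = (coord_space {j. place j \<le> i} :: (complex ^ 'n::{finite,linorder}) set)"
proof -
  have "{axis j (1::complex) | j::'n. card {l. j \<le> l} \<le> i} =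
      (\<lambda>j::'n. axis j (1::complex)) ` {j. place j \<le> i}"
    by (auto simp: place_def)
  then show ?thesis unfolding last_span_def by (simp only: span_axis)
qed

lemma in_last_span_iff: "x \<in> last_span i \<longleftrightarrow> (\<forall>j. x $ j \<noteq> 0 \<longrightarrow> place j \<le> i)"
  unfolding last_span_eq coord_space_def by auto

lemma subspace_last_span: "vec.subspace (last_span i)"
  unfolding last_span_eq by (rule subspace_coord_space)

lemma last_span_mono: "i \<le> j \<Longrightarrow> last_span i \<subseteq> last_span j"
  unfolding in_last_span_iff subset_iff by force

lemma dim_last_span:
  assumes "i \<le> CARD('n)"
  shows "vec.dim (last_span i :: (complex ^ 'n::{finite,linorder}) set) = i"
proof -
  have "{j :: 'n. place j \<le> i} = {j. place j \<in> {1..i}}"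
    using place_pos by (auto simp: Suc_le_eq)
  then show ?thesis
    unfolding last_span_eq using card_place_vimage[of "{1..i}", where 'n = 'n] assms by simp
qed

lemma last_span_CARD: "last_span CARD('n) = (UNIV :: (complex ^ 'n::{finite,linorder}) set)"
  using place_le unfolding last_span_eq coord_space_def by auto

lemma last_span_0: "last_span 0 = {0}"
  unfolding in_last_span_iff set_eq_iff by (auto simp: vec_eq_iff)

text \<open>The leading places of the vectors of \<open>V\<close>, where the leading entry of a vector is its nonzero
  entry of largest place.\<close>

definition pivots :: "(complex ^ 'n::{finite,linorder}) set \<Rightarrow> 'n set" where
  "pivots V = {j. \<exists>v\<in>V. v $ j \<noteq> 0 \<and> v \<in> last_span (place j)}"

lemma leading_index:
  fixes v :: "complex ^ 'n::{finite,linorder}"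
  assumes "v \<noteq> 0"
  obtains j where "v $ j \<noteq> 0" "v \<in> last_span (place j)"
proof -
  have "place ` {j. v $ j \<noteq> 0} \<noteq> {}" using assms by (auto simp: vec_eq_iff)
  then have "Max (place ` {j. v $ j \<noteq> 0}) \<in> place ` {j. v $ j \<noteq> 0}" by (intro Max_in) auto
  then obtain j where j: "v $ j \<noteq> 0" "place j = Max (place ` {j. v $ j \<noteq> 0})" by auto
  have "place i \<le> place j" if "v $ i \<noteq> 0" for i
    unfolding j(2) using that by (intro Max_ge) auto
  then show thesis using that j(1) by (auto simp: in_last_span_iff)
qed

text \<open>When the member of the standard flag grows by one dimension, its intersection with \<open>V\<close> grows
  exactly at the pivots.\<close>

lemma card_pivots_Int:
  fixes V :: "(complex ^ 'n::{finite,linorder}) set"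
  assumes "vec.subspace V" "i \<le> CARD('n)"
  shows "card (pivots V \<inter> {j. place j \<le> i}) = vec.dim (V \<inter> last_span i)"
  using assms(2)
proof (induction i)
  case 0
  have "V \<inter> last_span 0 = {0}" using vec.subspace_0[OF assms(1)] by (auto simp: last_span_0)
  then show ?case by simp
next
  case (Suc i)
  obtain j :: 'n where j: "place j = Suc i" using ex_place[of "Suc i"] Suc.prems by auto
  have insert: "{l. place l \<le> Suc i} = insert j {l. place l \<le> i}"
    using j by (auto simp: le_Suc_eq) (metis j place_eq_iff)
  have drop: "v \<in> last_span i" if "v \<in> last_span (Suc i)" "v $ j = 0" for v
    unfolding in_last_span_iff
  proof (intro allI impI)
    fix l assume "v $ l \<noteq> 0"
    then have "place l \<le> Suc i" "l \<noteq> j" using that by (auto simp: in_last_span_iff)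
    then show "place l \<le> i" using j by (metis le_Suc_eq place_eq_iff)
  qed
  show ?case
  proof (cases "j \<in> pivots V")
    case True
    then obtain v where v: "v \<in> V" "v $ j \<noteq> 0" "v \<in> last_span (Suc i)"
      unfolding pivots_def using j by auto
    have sub: "vec.subspace (V \<inter> last_span i)"
      by (intro vec.subspace_inter assms(1) subspace_last_span)
    have "v \<notin> vec.span (V \<inter> last_span i)"
      using v(2) j unfolding vec.span_eq_iff[THEN iffD2, OF sub] by (auto simp: in_last_span_iff)
    then have d: "vec.dim (insert v (V \<inter> last_span i)) = Suc (vec.dim (V \<inter> last_span i))"
      by (simp add: vec.dim_insert)
    have "V \<inter> last_span (Suc i) \<subseteq> vec.span (insert v (V \<inter> last_span i))"
    proof
      fix u assume u: "u \<in> V \<inter> last_span (Suc i)"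
      let ?u = "u - (u $ j / v $ j) *s v"
      have "?u \<in> V \<inter> last_span (Suc i)"
        using u v assms(1) subspace_last_span by (auto intro!: vec.subspace_diff vec.subspace_scale)
      moreover have "?u $ j = 0" using v by simp
      ultimately have "?u \<in> V \<inter> last_span i" using drop by blast
      then have "?u + (u $ j / v $ j) *s v \<in> vec.span (insert v (V \<inter> last_span i))"
        by (intro vec.span_add vec.span_scale vec.span_base) auto
      then show "u \<in> vec.span (insert v (V \<inter> last_span i))" by simp
    qed
    moreover have "insert v (V \<inter> last_span i) \<subseteq> V \<inter> last_span (Suc i)"
      using v last_span_mono[of i "Suc i"] by auto
    ultimately have "vec.dim (V \<inter> last_span (Suc i)) = Suc (vec.dim (V \<inter> last_span i))"
      using d vec.dim_subset vec.dim_mono by (metis le_antisym)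
    moreover have "pivots V \<inter> {l. place l \<le> Suc i} = insert j (pivots V \<inter> {l. place l \<le> i})"
      using insert True by auto
    ultimately show ?thesis using Suc j by simp
  next
    case False
    have "v $ j = 0" if "v \<in> V" "v \<in> last_span (Suc i)" for v
      using that False j unfolding pivots_def by auto
    then have "V \<inter> last_span (Suc i) = V \<inter> last_span i"
      using drop last_span_mono[of i "Suc i"] by auto
    moreover have "pivots V \<inter> {l. place l \<le> Suc i} = pivots V \<inter> {l. place l \<le> i}"
      using insert False by auto
    ultimately show ?thesis using Suc by simp
  qed
qed

lemma card_pivots:
  fixes V :: "(complex ^ 'n::{finite,linorder}) set"
  assumes "vec.subspace V"
  shows "card (pivots V) = vec.dim V"
proof -
  have "{j :: 'n. place j \<le> CARD('n)} = UNIV" using place_le by auto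
  then show ?thesis using card_pivots_Int[OF assms, of "CARD('n)"] by (simp add: last_span_CARD)
qed

lemma pivots_Int_complement: "V \<inter> coord_space (- pivots V) \<subseteq> {0}"
proof
  fix v assume v: "v \<in> V \<inter> coord_space (- pivots V)"
  show "v \<in> {0}"
  proof (rule ccontr)
    assume "v \<notin> {0}"
    then obtain j where j: "v $ j \<noteq> 0" "v \<in> last_span (place j)" using leading_index[of v] by auto
    then have "j \<in> pivots V" using v unfolding pivots_def by blast
    then show False using v j unfolding coord_space_def by auto
  qed
qed

section \<open>Affine charts\<close>

definition chart_column :: "complex ^ ('n \<times> 'n::finite) \<Rightarrow> 'n \<Rightarrow> complex ^ 'n" where
  "chart_column x j = axis j 1 + (\<chi> i. x $ (i, j))"

lemma chart_eq: "chart I x = vec.span (chart_column x ` I)"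
proof -
  have "{axis j 1 + (\<chi> i. x $ (i, j)) | j. j \<in> I} = chart_column x ` I"
    unfolding chart_column_def by blast
  then show ?thesis unfolding chart_def by simp
qed

lemma subspace_chart: "vec.subspace (chart I x)"
  unfolding chart_eq by (rule vec.subspace_span)

lemma chart_column_in_chart: "j \<in> I \<Longrightarrow> chart_column x j \<in> chart I x"
  unfolding chart_eq by (intro vec.span_base) auto

lemma chart_column_inside:
  "x \<in> chart_domain I \<Longrightarrow> i \<in> I \<Longrightarrow> chart_column x j $ i = (if i = j then 1 else 0)"
  unfolding chart_column_def chart_domain_def by (auto simp: axis_def)

lemma chart_column_outside: "j \<in> I \<Longrightarrow> i \<notin> I \<Longrightarrow> chart_column x j $ i = x $ (i, j)"
  unfolding chart_column_def by (auto simp: axis_def)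

lemma in_chart_eq_sum:
  assumes "x \<in> chart_domain I" "v \<in> chart I x"
  shows "v = (\<Sum>j\<in>I. v $ j *s chart_column x j)"
proof -
  have "vec.subspace {v. v = (\<Sum>j\<in>I. v $ j *s chart_column x j)}"
    unfolding vec.subspace_def mem_Collect_eq
  proof (intro conjI ballI allI)
    show "u + w = (\<Sum>j\<in>I. (u + w) $ j *s chart_column x j)"
      if "u \<in> {v. v = (\<Sum>j\<in>I. v $ j *s chart_column x j)}"
        "w \<in> {v. v = (\<Sum>j\<in>I. v $ j *s chart_column x j)}" for u w
    proof -
      have "u + w = (\<Sum>j\<in>I. u $ j *s chart_column x j) + (\<Sum>j\<in>I. w $ j *s chart_column x j)"
        using that by simp
      also have "\<dots> = (\<Sum>j\<in>I. (u + w) $ j *s chart_column x j)"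
        by (simp add: sum.distrib vec.scale_left_distrib)
      finally show ?thesis .
    qed
    show "c *s u = (\<Sum>j\<in>I. (c *s u) $ j *s chart_column x j)"
      if "u \<in> {v. v = (\<Sum>j\<in>I. v $ j *s chart_column x j)}" for c u
    proof -
      have "c *s u = c *s (\<Sum>j\<in>I. u $ j *s chart_column x j)"
        using that by simp
      also have "\<dots> = (\<Sum>j\<in>I. (c *s u) $ j *s chart_column x j)"
        by (simp add: vec.scale_sum_right)
      finally show ?thesis .
    qed
  qed simp
  moreover have "chart_column x l = (\<Sum>j\<in>I. chart_column x l $ j *s chart_column x j)" if "l \<in> I" for l
  proof -
    have "(\<Sum>j\<in>I. chart_column x l $ j *s chart_column x j) =
        (\<Sum>j\<in>I. if j = l then chart_column x j else 0)"
      using chart_column_inside[OF assms(1)] by (intro sum.cong) auto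
    then show ?thesis using that by simp
  qed
  ultimately have "chart I x \<subseteq> {v. v = (\<Sum>j\<in>I. v $ j *s chart_column x j)}"
    unfolding chart_eq by (intro vec.span_minimal) auto
  then show ?thesis using assms(2) by blast
qed

lemma in_chart_iff:
  assumes "x \<in> chart_domain I"
  shows "v \<in> chart I x \<longleftrightarrow> (\<forall>i. i \<notin> I \<longrightarrow> v $ i = (\<Sum>j\<in>I. x $ (i, j) * v $ j))"
proof
  assume "v \<in> chart I x"
  then have v: "v = (\<Sum>j\<in>I. v $ j *s chart_column x j)" by (rule in_chart_eq_sum[OF assms])
  show "\<forall>i. i \<notin> I \<longrightarrow> v $ i = (\<Sum>j\<in>I. x $ (i, j) * v $ j)"
  proof (intro allI impI)
    fix i assume i: "i \<notin> I"
    have "v $ i = (\<Sum>j\<in>I. v $ j *s chart_column x j) $ i" using v by simp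
    also have "\<dots> = (\<Sum>j\<in>I. x $ (i, j) * v $ j)"
      using i by (auto simp: chart_column_outside intro!: sum.cong)
    finally show "v $ i = (\<Sum>j\<in>I. x $ (i, j) * v $ j)" .
  qed
next
  assume R: "\<forall>i. i \<notin> I \<longrightarrow> v $ i = (\<Sum>j\<in>I. x $ (i, j) * v $ j)"
  have "v = (\<Sum>j\<in>I. v $ j *s chart_column x j)"
    unfolding vec_eq_iff
  proof
    fix i
    show "v $ i = (\<Sum>j\<in>I. v $ j *s chart_column x j) $ i"
    proof (cases "i \<in> I")
      case True
      then have "(\<Sum>j\<in>I. v $ j *s chart_column x j) $ i = (\<Sum>j\<in>I. if i = j then v $ j else 0)"
        by (simp add: chart_column_inside[OF assms] if_distrib[of "(*) a" for a] cong: if_cong)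
      then show ?thesis using True by simp
    next
      case False
      then have "(\<Sum>j\<in>I. v $ j *s chart_column x j) $ i = (\<Sum>j\<in>I. x $ (i, j) * v $ j)"
        by (auto simp: chart_column_outside intro!: sum.cong)
      then show ?thesis using False R by simp
    qed
  qed
  also have "\<dots> \<in> chart I x"
    by (intro vec.subspace_sum vec.subspace_scale subspace_chart chart_column_in_chart)
  finally show "v \<in> chart I x" .
qed

lemma chart_Int_complement:
  assumes "x \<in> chart_domain I"
  shows "chart I x \<inter> coord_space (- I) \<subseteq> {0}"
proof
  fix v assume v: "v \<in> chart I x \<inter> coord_space (- I)"
  then have "v = (\<Sum>j\<in>I. v $ j *s chart_column x j)" using in_chart_eq_sum[OF assms] by blast
  also have "\<dots> = 0" using v by (intro sum.neutral) (auto simp: coord_space_def)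
  finally show "v \<in> {0}" by simp
qed

lemma restrict_to_coordinates:
  fixes V :: "(complex ^ 'n::finite) set"
  assumes "vec.subspace V" "V \<inter> coord_space (- I) \<subseteq> {0}"
  shows "vec.dim ((\<lambda>v. \<chi> i. if i \<in> I then v $ i else 0) ` V) = vec.dim V"
proof (rule vec.dim_image_eq)
  show "Vector_Spaces.linear (*s) (*s) (\<lambda>v::complex ^ 'n. \<chi> i. if i \<in> I then v $ i else 0)"
    by unfold_locales (auto simp: vec_eq_iff algebra_simps)
  have "u = v"
    if uv: "u \<in> V" "v \<in> V" "(\<chi> i. if i \<in> I then u $ i else 0) = (\<chi> i. if i \<in> I then v $ i else 0)" for u v
  proof -
    have "(u - v) $ i = 0" if "i \<in> I" for i
    proof -
      have "(\<chi> i. if i \<in> I then u $ i else 0) $ i = (\<chi> i. if i \<in> I then v $ i else 0) $ i"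
        using uv(3) by simp
      then show ?thesis using that by simp
    qed
    then have "u - v \<in> V \<inter> coord_space (- I)"
      using uv assms(1) by (auto simp: coord_space_def intro: vec.subspace_diff)
    then show ?thesis using assms(2) by auto
  qed
  then show "inj_on (\<lambda>v. \<chi> i. if i \<in> I then v $ i else 0) (vec.span V)"
    unfolding vec.span_eq_iff[THEN iffD2, OF assms(1)] inj_on_def by blast
qed

text \<open>The projection to the coordinates in \<open>I\<close> identifies each member of the chart with the
  coordinate subspace.\<close>

lemma dim_chart:
  assumes "x \<in> chart_domain I"
  shows "vec.dim (chart I x) = card I"
proof -
  let ?r = "\<lambda>v::complex ^ 'a. \<chi> i. if i \<in> I then v $ i else 0"
  have "?r ` chart I x = coord_space I"
  proof
    show "?r ` chart I x \<subseteq> coord_space I" by (auto simp: coord_space_def)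
    show "coord_space I \<subseteq> ?r ` chart I x"
    proof
      fix c assume c: "c \<in> coord_space I"
      let ?v = "\<Sum>j\<in>I. c $ j *s chart_column x j"
      have "?v $ i = c $ i" if "i \<in> I" for i
      proof -
        have "?v $ i = (\<Sum>j\<in>I. if i = j then c $ j else 0)"
          using that
          by (simp add: chart_column_inside[OF assms] if_distrib[of "(*) a" for a] cong: if_cong)
        then show ?thesis using that by simp
      qed
      then have "c = ?r ?v" using c by (auto simp: vec_eq_iff coord_space_def)
      moreover have "?v \<in> chart I x"
        by (intro vec.subspace_sum vec.subspace_scale subspace_chart chart_column_in_chart)
      ultimately show "c \<in> ?r ` chart I x" by blast
    qed
  qed
  then show ?thesis
    using restrict_to_coordinates[OF subspace_chart chart_Int_complement[OF assms]] by simp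
qed

lemma ex_vector_with_coordinates:
  fixes V :: "(complex ^ 'n::finite) set"
  assumes "vec.subspace V" "V \<inter> coord_space (- I) \<subseteq> {0}" "vec.dim V = card I"
  shows "\<exists>v\<in>V. \<forall>i\<in>I. v $ i = c $ i"
proof -
  let ?r = "\<lambda>v::complex ^ 'n. \<chi> i. if i \<in> I then v $ i else 0"
  have "vec.subspace (?r ` V)"
  proof -
    have "Vector_Spaces.linear (*s) (*s) ?r"
      by unfold_locales (auto simp: vec_eq_iff algebra_simps)
    then show ?thesis using vec.linear_subspace_image assms(1) by blast
  qed
  moreover have "?r ` V \<subseteq> coord_space I" by (auto simp: coord_space_def)
  ultimately have "?r ` V = coord_space I"
    using restrict_to_coordinates[OF assms(1,2)] assms(3)
    by (intro vec.subspace_dim_equal subspace_coord_space) simp_all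
  moreover have "?r c \<in> coord_space I" by (auto simp: coord_space_def)
  ultimately obtain v where v: "v \<in> V" "?r c = ?r v" by blast
  have "v $ i = c $ i" if "i \<in> I" for i
    using arg_cong[OF v(2), of "\<lambda>x. x $ i"] that by simp
  then show ?thesis using v(1) by blast
qed

lemma ex_chart:
  fixes V :: "(complex ^ 'n::finite) set"
  assumes "vec.subspace V" "V \<inter> coord_space (- I) \<subseteq> {0}" "vec.dim V = card I"
  obtains x where "x \<in> chart_domain I" "chart I x = V"
proof -
  have "\<forall>j. \<exists>v\<in>V. \<forall>i\<in>I. v $ i = axis j 1 $ i"
    using ex_vector_with_coordinates[OF assms] by blast
  then obtain u where u: "\<And>j. u j \<in> V" "\<And>j i. i \<in> I \<Longrightarrow> u j $ i = axis j 1 $ i" by metis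
  define x :: "complex ^ ('n \<times> 'n)" where "x = (\<chi> p. if fst p \<notin> I \<and> snd p \<in> I then u (snd p) $ fst p else 0)"
  have x: "x \<in> chart_domain I" unfolding chart_domain_def x_def by auto
  have "chart_column x j = u j" if "j \<in> I" for j
    unfolding vec_eq_iff
  proof
    fix i show "chart_column x j $ i = u j $ i"
      using that u(2)[of i j] chart_column_inside[OF x, of i j] chart_column_outside[of j I i x]
      by (cases "i \<in> I") (auto simp: x_def axis_def)
  qed
  then have "chart I x \<subseteq> V"
    unfolding chart_eq using u(1) assms(1) by (intro vec.span_minimal) auto
  then have "chart I x = V"
    using dim_chart[OF x] assms by (intro vec.subspace_dim_equal subspace_chart) auto
  then show thesis using that x by blast
qed

lemma chart_inject:
  assumes "x \<in> chart_domain I" "y \<in> chart_domain I" "chart I x = chart I y"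
  shows "x = y"
  unfolding vec_eq_iff
proof
  fix p :: "'a \<times> 'a"
  obtain i j where p: "p = (i, j)" by fastforce
  show "x $ p = y $ p"
  proof (cases "i \<notin> I \<and> j \<in> I")
    case True
    have "chart_column x j - chart_column y j \<in> chart I x"
      using True assms(3) chart_column_in_chart[of j I x] chart_column_in_chart[of j I y]
      by (intro vec.subspace_diff subspace_chart) auto
    moreover have "chart_column x j - chart_column y j \<in> coord_space (- I)"
      by (simp add: coord_space_def chart_column_inside[OF assms(1)] chart_column_inside[OF assms(2)])
    ultimately have "chart_column x j - chart_column y j = 0"
      using chart_Int_complement[OF assms(1)] by blast
    then have "chart_column x j $ i = chart_column y j $ i" by simp
    then show ?thesis using True p by (simp add: chart_column_outside[of j I i])
  next
    case False
    then have "x $ (i, j) = 0" "y $ (i, j) = 0" using assms unfolding chart_domain_def by blast+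
    then show ?thesis using p by simp
  qed
qed

text \<open>The reduced echelon form of a basis of \<open>V\<close>.\<close>

lemma ex_echelon_chart:
  fixes V :: "(complex ^ 'n::{finite,linorder}) set"
  assumes "vec.subspace V"
  obtains y where "y \<in> chart_domain (pivots V)" "chart (pivots V) y = V"
    "\<And>i j. y $ (i, j) \<noteq> 0 \<Longrightarrow> place i < place j"
proof -
  obtain y where y: "y \<in> chart_domain (pivots V)" "chart (pivots V) y = V"
    using ex_chart[OF assms pivots_Int_complement] card_pivots[OF assms] by metis
  have "place i < place j" if ij: "y $ (i, j) \<noteq> 0" for i j
  proof -
    have inout: "i \<notin> pivots V" "j \<in> pivots V" using ij y(1) unfolding chart_domain_def by blast+
    let ?v = "chart_column y j"
    have "?v $ j \<noteq> 0" using chart_column_inside[OF y(1) inout(2), of j] by simp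
    then have "?v \<noteq> 0" by auto
    then obtain l where l: "?v $ l \<noteq> 0" "?v \<in> last_span (place l)" using leading_index by blast
    have "?v \<in> V" using chart_column_in_chart[OF inout(2)] y(2) by blast
    then have "l \<in> pivots V" using l unfolding pivots_def by blast
    then have "l = j" using chart_column_inside[OF y(1)] l(1) by metis
    have "?v $ i \<noteq> 0" using chart_column_outside[OF inout(2,1)] ij by simp
    then have "place i \<le> place j" using l(2) \<open>l = j\<close> by (auto simp: in_last_span_iff)
    moreover have "i \<noteq> j" using inout by blast
    ultimately show ?thesis by (simp add: le_neq_implies_less)
  qed
  then show thesis using that y by blast
qed

section \<open>Incidence conditions are closed\<close>

text \<open>For subspaces spanned by polynomial families of vectors, the incidence condition with a fixed
  subspace is given by polynomial equations.\<close>

lemma ex_incidence_equations: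
  fixes u :: "complex ^ 'v::finite \<Rightarrow> 'n::finite \<Rightarrow> complex ^ 'n"
  assumes u: "\<And>j i. polynomial_fun (\<lambda>x. u x j $ i)" and F: "vec.subspace F"
  shows "\<exists>P. (\<forall>f\<in>P. polynomial_fun f) \<and> (\<forall>x. vec.dim (vec.span (u x ` S)) = card S \<longrightarrow>
    (a \<le> vec.dim (vec.span (u x ` S) \<inter> F) \<longleftrightarrow> (\<forall>f\<in>P. f x = 0)))"
proof -
  define \<W> where "\<W> = {W. vec.subspace W \<and> vec.dim W + card S = CARD('n) \<and>
    vec.dim F < a + vec.dim (W \<inter> F)}"
  have n: "card S + card (- S) = CARD('n)"
    by (metis card_Un_disjoint Compl_disjoint finite Compl_partition)
  have "\<exists>w::'n \<Rightarrow> complex ^ 'n. vec.span (w ` (- S)) = W" if "W \<in> \<W>" for W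
  proof -
    have W: "vec.subspace W" "vec.dim W + card S = CARD('n)" using that unfolding \<W>_def by auto
    obtain B where B: "B \<subseteq> W" "vec.independent B" "W \<subseteq> vec.span B" "card B = vec.dim W"
      using vec.basis_exists[of W] by blast
    have "card (- S) = card B" using B(4) W(2) n by simp
    then obtain w where "bij_betw w (- S) B"
      using finite_same_card_bij[of "- S" B] vec.finiteI_independent[OF B(2)] by auto
    then have "w ` (- S) = B" by (simp add: bij_betw_def)
    moreover have "vec.span B = W" using B W(1) vec.span_minimal[of B W] by blast
    ultimately show ?thesis by blast
  qed
  then obtain w where w: "\<And>W. W \<in> \<W> \<Longrightarrow> vec.span (w W ` (- S)) = W" by metis
  define f where "f = (\<lambda>W x. det (matrix_of_columns (\<lambda>j. if j \<in> S then u x j else w W j)))"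
  have "polynomial_fun (f W)" for W
    unfolding f_def
  proof (rule polynomial_fun_det)
    fix i j
    show "polynomial_fun (\<lambda>x. matrix_of_columns (\<lambda>j. if j \<in> S then u x j else w W j) $ i $ j)"
      using u by (cases "j \<in> S") (simp_all add: matrix_of_columns_def polynomial_fun.const)
  qed
  moreover have "a \<le> vec.dim (vec.span (u x ` S) \<inter> F) \<longleftrightarrow> (\<forall>g\<in>f ` \<W>. g x = 0)"
    if x: "vec.dim (vec.span (u x ` S)) = card S" for x
  proof -
    have "f W x = 0 \<longleftrightarrow> vec.span (u x ` S) \<inter> W \<noteq> {0}" if "W \<in> \<W>" for W
    proof -
      have "vec.dim (vec.span (w W ` (- S))) = card (- S)"
        using w[OF that] that n unfolding \<W>_def by simp
      then show ?thesis
        using det_columns_zero_iff[OF x, of "w W"] w[OF that] unfolding f_def by auto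
    qed
    then show ?thesis
      unfolding dim_Int_ge_iff[OF vec.subspace_span F] x \<W>_def by auto
  qed
  ultimately show ?thesis by (intro exI[of _ "f ` \<W>"]) auto
qed

text \<open>Each condition is recorded by its bound \<open>a t\<close> and the excess \<open>M t\<close> of the dimension of the
  member of the flag, since for the corners of a partition both are strictly increasing in \<open>t\<close>.\<close>

definition incidence_variety ::
  "nat \<Rightarrow> nat \<Rightarrow> (nat \<Rightarrow> nat) \<Rightarrow> (nat \<Rightarrow> nat) \<Rightarrow> (complex ^ 'n::{finite,linorder}) set set" where
  "incidence_variety k r a M =
     {V \<in> grassmannian k. \<forall>t\<in>{1..r}. a t \<le> vec.dim (V \<inter> last_span (a t + M t))}"

definition affine_part :: "'n set \<Rightarrow> (complex ^ 'n::finite) set set \<Rightarrow> (complex ^ ('n \<times> 'n)) set" where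
  "affine_part I X = {x \<in> chart_domain I. chart I x \<in> X}"

lemma chart_domain_eq: "chart_domain I = coord_space {(i, j). i \<notin> I \<and> j \<in> I}"
  unfolding chart_domain_def coord_space_def by auto

lemma polynomial_fun_chart_column: "polynomial_fun (\<lambda>x. chart_column x j $ i)"
  unfolding chart_column_def
  by (simp add: polynomial_fun.add polynomial_fun.const polynomial_fun.coord)

lemma closedin_zariski_coord_space: "closedin zariski (coord_space S)"
proof -
  have "coord_space S = {x. \<forall>f\<in>(\<lambda>c x. x $ c) ` (- S). f x = 0}"
    by (auto simp: coord_space_def)
  then show ?thesis
    using closedin_zariski_common_zeros[of "(\<lambda>c x. x $ c) ` (- S)"] polynomial_fun.coord by auto
qed

lemma chart_in_grassmannian: "x \<in> chart_domain I \<Longrightarrow> chart I x \<in> grassmannian (card I)"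
  by (simp add: grassmannian_def subspace_chart dim_chart)

lemma closedin_affine_part:
  "closedin zariski (affine_part I (incidence_variety (card I) r a M))"
proof -
  have "\<exists>P. (\<forall>f\<in>P. polynomial_fun f) \<and> (\<forall>x. vec.dim (vec.span (chart_column x ` I)) = card I \<longrightarrow>
      (a t \<le> vec.dim (vec.span (chart_column x ` I) \<inter> last_span (a t + M t)) \<longleftrightarrow> (\<forall>f\<in>P. f x = 0)))" for t
    by (rule ex_incidence_equations[OF polynomial_fun_chart_column subspace_last_span])
  then obtain P where P: "\<And>t f. f \<in> P t \<Longrightarrow> polynomial_fun f"
    "\<And>t x. vec.dim (vec.span (chart_column x ` I)) = card I \<Longrightarrow>
      a t \<le> vec.dim (vec.span (chart_column x ` I) \<inter> last_span (a t + M t)) \<longleftrightarrow> (\<forall>f\<in>P t. f x = 0)"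
    by metis
  have "affine_part I (incidence_variety (card I) r a M) =
      chart_domain I \<inter> {x. \<forall>f\<in>(\<Union>t\<in>{1..r}. P t). f x = 0}"
  proof -
    have "chart I x \<in> incidence_variety (card I) r a M \<longleftrightarrow> (\<forall>t\<in>{1..r}. \<forall>f\<in>P t. f x = 0)"
      if "x \<in> chart_domain I" for x
      using dim_chart[OF that] chart_in_grassmannian[OF that] P(2)[of x]
      unfolding incidence_variety_def chart_eq by auto
    then show ?thesis unfolding affine_part_def by auto
  qed
  moreover have "closedin zariski {x. \<forall>f\<in>(\<Union>t\<in>{1..r}. P t). f x = 0}"
    by (intro closedin_zariski_common_zeros) (auto intro: P(1))
  ultimately show ?thesis
    unfolding chart_domain_eq by (simp add: closedin_Int closedin_zariski_coord_space)
qed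

section \<open>Changes of charts\<close>

text \<open>The subspace \<open>chart J x\<close> lies in the chart of \<open>I\<close> iff its basis and the axes outside \<open>I\<close>
  form a basis of the whole space. The expansion of \<open>axis j 1\<close> for \<open>j \<in> I\<close> in this basis is given
  by Cramer's rule, and its part along the axes gives column \<open>j\<close> of the new coordinates.\<close>

lemma ex_chart_transition:
  fixes I J :: "'n::finite set"
  assumes "card I = card J"
  obtains den :: "complex ^ ('n \<times> 'n) \<Rightarrow> complex" and \<tau> where "regular_away den \<tau>"
    "\<And>x. x \<in> chart_domain J \<Longrightarrow> den x \<noteq> 0 \<longleftrightarrow> chart J x \<inter> coord_space (- I) = {0}"
    "\<And>x. x \<in> chart_domain J \<Longrightarrow> den x \<noteq> 0 \<Longrightarrow> \<tau> x \<in> chart_domain I \<and> chart I (\<tau> x) = chart J x"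
proof -
  have "card (- J) = card (- I)" using assms by (simp add: Compl_eq_Diff_UNIV card_Diff_subset)
  then obtain \<rho> where \<rho>: "bij_betw \<rho> (- J) (- I)"
    using finite_same_card_bij[of "- J" "- I"] by auto
  let ?\<rho>' = "inv_into (- J) \<rho>"
  define c where "c = (\<lambda>(x :: complex ^ ('n \<times> 'n)) m. if m \<in> J then chart_column x m else axis (\<rho> m) 1)"
  define B where "B = (\<lambda>x. matrix_of_columns (c x))"
  \<comment> \<open>\<open>cof x m j / den x\<close> is the coefficient of column \<open>m\<close> in the expansion of \<open>axis j 1\<close>.\<close>
  define den where "den = (\<lambda>x. det (B x))"
  define cof where "cof = (\<lambda>(x :: complex ^ ('n \<times> 'n)) m j.
    det (\<chi> i l. if l = m then axis j 1 $ i else B x $ i $ l))"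
  define num :: "complex ^ ('n \<times> 'n) \<Rightarrow> complex ^ ('n \<times> 'n)" where
    "num = (\<lambda>x. \<chi> p. if fst p \<notin> I \<and> snd p \<in> I then - cof x (?\<rho>' (fst p)) (snd p) else 0)"
  define \<tau> :: "complex ^ ('n \<times> 'n) \<Rightarrow> complex ^ ('n \<times> 'n)" where "\<tau> = (\<lambda>x. \<chi> p. num x $ p / den x)"
  have poly_B: "polynomial_fun (\<lambda>x. B x $ i $ m)" for i m
    unfolding B_def matrix_of_columns_def c_def
    by (cases "m \<in> J") (simp_all add: polynomial_fun_chart_column polynomial_fun.const)
  have poly_den: "polynomial_fun den" unfolding den_def by (rule polynomial_fun_det[OF poly_B])
  have poly_cof: "polynomial_fun (\<lambda>x. cof x m j)" for m j
    unfolding cof_def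
  proof (rule polynomial_fun_det)
    fix i l
    show "polynomial_fun (\<lambda>x. (\<chi> i l. if l = m then axis j 1 $ i else B x $ i $ l) $ i $ l)"
      using poly_B by (cases "l = m") (simp_all add: polynomial_fun.const)
  qed
  have "polynomial_fun (\<lambda>x. num x $ p)" for p
    using poly_cof
    by (cases "fst p \<notin> I \<and> snd p \<in> I") (auto simp: num_def polynomial_fun.const intro: polynomial_fun_uminus)
  then have reg: "regular_away den \<tau>"
    unfolding regular_away_def using poly_den by (intro conjI exI[of _ num]) (auto simp: \<tau>_def vec_eq_iff)
  have axes: "(\<lambda>m. axis (\<rho> m) 1) ` (- J) = (\<lambda>i. axis i (1::complex)) ` (- I)"
    using image_image[of "\<lambda>i. axis i (1::complex)" \<rho> "- J"] bij_betw_imp_surj_on[OF \<rho>] by simp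
  have den_iff: "den x \<noteq> 0 \<longleftrightarrow> chart J x \<inter> coord_space (- I) = {0}" if x: "x \<in> chart_domain J" for x
  proof -
    have "vec.dim (vec.span ((\<lambda>m. axis (\<rho> m) (1::complex)) ` (- J))) = card (- J)"
      unfolding axes span_axis using \<open>card (- J) = card (- I)\<close> by simp
    moreover have "vec.dim (vec.span (chart_column x ` J)) = card J"
      using dim_chart[OF x] unfolding chart_eq .
    ultimately have "det (matrix_of_columns (\<lambda>m. if m \<in> J then chart_column x m else axis (\<rho> m) 1)) \<noteq> 0
        \<longleftrightarrow> chart J x \<inter> coord_space (- I) = {0}"
      using det_columns_zero_iff[of "chart_column x" J "\<lambda>m. axis (\<rho> m) 1"]
      unfolding axes span_axis chart_eq by simp
    then show ?thesis unfolding den_def B_def c_def .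
  qed
  have trans: "\<tau> x \<in> chart_domain I \<and> chart I (\<tau> x) = chart J x"
    if x: "x \<in> chart_domain J" "den x \<noteq> 0" for x
  proof
    show dom: "\<tau> x \<in> chart_domain I" unfolding chart_domain_def \<tau>_def num_def by auto
    have "chart_column (\<tau> x) j \<in> chart J x" if j: "j \<in> I" for j
    proof -
      define s where "s = (\<chi> m. cof x m j / den x)"
      have "B x *v s = axis j 1"
        using cramer[of "B x" s "axis j 1"] x(2) unfolding den_def s_def cof_def by simp
      then have "axis j 1 = (\<Sum>m\<in>UNIV. s $ m *s c x m)"
        unfolding B_def matrix_of_columns_mult by simp
      also have "\<dots> = (\<Sum>m\<in>J. s $ m *s c x m) + (\<Sum>m\<in>-J. s $ m *s c x m)"
        using sum.union_disjoint[of J "- J" "\<lambda>m. s $ m *s c x m"] by simp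
      finally have split: "axis j 1 = (\<Sum>m\<in>J. s $ m *s chart_column x m) + (\<Sum>m\<in>-J. s $ m *s axis (\<rho> m) 1)"
        unfolding c_def by simp
      have "(\<Sum>m\<in>-J. s $ m *s axis (\<rho> m) 1) $ i = (if i \<in> I then 0 else s $ ?\<rho>' i)" for i
      proof -
        have "(\<Sum>m\<in>-J. s $ m *s axis (\<rho> m) 1) $ i = (\<Sum>m\<in>-J. if \<rho> m = i then s $ m else 0)"
          by (auto simp: axis_def intro!: sum.cong)
        also have "\<dots> = (\<Sum>m\<in>-J. if \<rho> m = i then s $ ?\<rho>' (\<rho> m) else 0)"
          using \<rho> by (intro sum.cong) (auto simp: bij_betw_def)
        also have "\<dots> = (\<Sum>l\<in>-I. if l = i then s $ ?\<rho>' l else 0)"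
          by (rule sum.reindex_bij_betw[OF \<rho>])
        also have "\<dots> = (if i \<in> I then 0 else s $ ?\<rho>' i)" by simp
        finally show ?thesis .
      qed
      then have "chart_column (\<tau> x) j = axis j 1 - (\<Sum>m\<in>-J. s $ m *s axis (\<rho> m) 1)"
        using j by (auto simp: vec_eq_iff chart_column_def \<tau>_def num_def s_def)
      then have "chart_column (\<tau> x) j = (\<Sum>m\<in>J. s $ m *s chart_column x m)"
        using split by simp
      then show ?thesis
        by (simp add: vec.subspace_sum vec.subspace_scale subspace_chart chart_column_in_chart)
    qed
    then have "chart I (\<tau> x) \<subseteq> chart J x"
      unfolding chart_eq[of I] by (intro vec.span_minimal subspace_chart) auto
    then show "chart I (\<tau> x) = chart J x"
      using dim_chart[OF dom] dim_chart[OF x(1)] assms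
      by (intro vec.subspace_dim_equal subspace_chart) auto
  qed
  show thesis by (rule that[OF reg den_iff trans])
qed

lemma dim_chart_add_Int_last_span_ge:
  fixes x y :: "complex ^ ('n \<times> 'n::{finite,linorder})"
  assumes x: "x \<in> chart_domain J" and y: "y \<in> chart_domain J"
    and low: "\<And>i j. y $ (i, j) \<noteq> 0 \<Longrightarrow> place i < place j"
  shows "vec.dim (chart J x \<inter> last_span N) \<le> vec.dim (chart J (x + y) \<inter> last_span N)"
proof -
  let ?L = "\<lambda>v. v + (\<chi> i. \<Sum>j\<in>UNIV. y $ (i, j) * v $ j)"
  have lin: "Vector_Spaces.linear (*s) (*s) ?L"
    by unfold_locales (auto simp: vec_eq_iff algebra_simps sum.distrib sum_distrib_left)
  have in_J: "?L v $ j = v $ j" if "j \<in> J" for v j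
  proof -
    have "y $ (j, l) = 0" for l using y that unfolding chart_domain_def by blast
    then show ?thesis by simp
  qed
  have sum_J: "(\<Sum>j\<in>UNIV. y $ (i, j) * v $ j) = (\<Sum>j\<in>J. y $ (i, j) * v $ j)" for i v
    using y unfolding chart_domain_def by (intro sum.mono_neutral_right) auto
  have "v = 0" if L0: "?L v = 0" for v
  proof -
    have "v $ j = 0" if "j \<in> J" for j using in_J[OF that, of v] unfolding L0 by simp
    then have "?L v = v" by (simp add: vec_eq_iff sum_J)
    then show ?thesis using L0 by simp
  qed
  then have "inj ?L"
    using vec.linear_inj_iff_eq_0[OF lin] by blast
  then have eq: "vec.dim (?L ` (chart J x \<inter> last_span N)) = vec.dim (chart J x \<inter> last_span N)"
    by (intro vec.dim_image_eq[OF lin]) (auto intro: inj_on_subset)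
  have sub: "?L ` (chart J x \<inter> last_span N) \<subseteq> chart J (x + y) \<inter> last_span N"
  proof (intro subsetI, elim imageE)
    fix w v assume v: "v \<in> chart J x \<inter> last_span N" and w: "w = ?L v"
    have xy: "x + y \<in> chart_domain J"
      using x y unfolding chart_domain_eq by (intro vec.subspace_add subspace_coord_space)
    have "w \<in> chart J (x + y)"
      unfolding in_chart_iff[OF xy]
    proof (intro allI impI)
      fix i assume i: "i \<notin> J"
      have "w $ i = (\<Sum>j\<in>J. x $ (i, j) * v $ j) + (\<Sum>j\<in>J. y $ (i, j) * v $ j)"
        using v i unfolding w sum_J by (simp add: in_chart_iff[OF x])
      also have "\<dots> = (\<Sum>j\<in>J. (x + y) $ (i, j) * w $ j)"
        unfolding w sum.distrib[symmetric] using in_J by (intro sum.cong) (simp_all add: algebra_simps)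
      finally show "w $ i = (\<Sum>j\<in>J. (x + y) $ (i, j) * w $ j)" .
    qed
    moreover have "w \<in> last_span N"
      unfolding in_last_span_iff
    proof (intro allI impI)
      fix i assume "w $ i \<noteq> 0"
      then consider "v $ i \<noteq> 0" | "(\<Sum>j\<in>UNIV. y $ (i, j) * v $ j) \<noteq> 0" unfolding w by (cases "v $ i = 0") auto
      then show "place i \<le> N"
      proof cases
        case 1
        then show ?thesis using v by (auto simp: in_last_span_iff)
      next
        case 2
        then obtain j where "y $ (i, j) * v $ j \<noteq> 0" by (rule sum.not_neutral_contains_not_neutral)
        then have "place i < place j" "place j \<le> N" using v low[of i j] by (simp_all add: in_last_span_iff)
        then show ?thesis by simp
      qed
    qed
    ultimately show "w \<in> chart J (x + y) \<inter> last_span N" by blast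
  qed
  show ?thesis using vec.dim_subset[OF sub] unfolding eq .
qed

text \<open>Adding \<open>y\<close> is the action of a unipotent matrix that preserves the flag.\<close>

lemma dim_chart_add_Int_last_span:
  assumes x: "x \<in> chart_domain J" and y: "y \<in> chart_domain J"
    and low: "\<And>i j. y $ (i, j) \<noteq> 0 \<Longrightarrow> place i < place j"
  shows "vec.dim (chart J (x + y) \<inter> last_span N) = vec.dim (chart J x \<inter> last_span N)"
proof (rule antisym)
  have "x + y \<in> chart_domain J" "- y \<in> chart_domain J"
    using x y unfolding chart_domain_eq
    by (intro vec.subspace_add vec.subspace_neg subspace_coord_space; simp)+
  then have "vec.dim (chart J (x + y) \<inter> last_span N) \<le> vec.dim (chart J ((x + y) + - y) \<inter> last_span N)"
    using low by (intro dim_chart_add_Int_last_span_ge) auto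
  then show "vec.dim (chart J (x + y) \<inter> last_span N) \<le> vec.dim (chart J x \<inter> last_span N)" by simp
qed (rule dim_chart_add_Int_last_span_ge[OF assms])

lemma chart_meets_complement_trivially:
  "x \<in> chart_domain I \<Longrightarrow> chart I x \<inter> coord_space (- I) = {0}"
  using chart_Int_complement[of x I] vec.subspace_0[OF subspace_chart, of I x]
    vec.subspace_0[OF subspace_coord_space, of "- I"] by blast

text \<open>Every point looks like the origin of the chart of its pivots: the change to that chart is a
  regular isomorphism near the point, and there the echelon form \<open>y\<close> can be subtracted because
  adding it preserves the incidence conditions.\<close>

lemma singular_points_affine_part_iff:
  fixes p :: "complex ^ ('n \<times> 'n::{finite,linorder})"
  assumes p: "p \<in> affine_part I (incidence_variety (card I) r a M)"
  defines "J \<equiv> pivots (chart I p)"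
  shows "p \<in> singular_points (affine_part I (incidence_variety (card I) r a M)) \<longleftrightarrow>
    0 \<in> singular_points (affine_part J (incidence_variety (card I) r a M))"
proof -
  let ?\<Omega> = "incidence_variety (card I) r a M"
  let ?dom = "\<lambda>I::'n set. {(i, j). i \<notin> I \<and> j \<in> I}"
  have pI: "p \<in> chart_domain I" using p unfolding affine_part_def by blast
  obtain y where y: "y \<in> chart_domain J" "chart J y = chart I p"
    and low: "\<And>i j. y $ (i, j) \<noteq> 0 \<Longrightarrow> place i < place j"
    using ex_echelon_chart[OF subspace_chart, of I p] unfolding J_def by blast
  have card: "card I = card J" using dim_chart[OF pI] card_pivots[OF subspace_chart, of I p] J_def by simp
  obtain den \<tau> where reg: "regular_away den \<tau>" and
    den: "\<And>x. x \<in> chart_domain J \<Longrightarrow> den x \<noteq> 0 \<longleftrightarrow> chart J x \<inter> coord_space (- I) = {0}" and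
    \<tau>: "\<And>x. x \<in> chart_domain J \<Longrightarrow> den x \<noteq> 0 \<Longrightarrow> \<tau> x \<in> chart_domain I \<and> chart I (\<tau> x) = chart J x"
    using ex_chart_transition[OF card] by blast
  obtain den' \<sigma> where reg': "regular_away den' \<sigma>" and
    den': "\<And>x. x \<in> chart_domain I \<Longrightarrow> den' x \<noteq> 0 \<longleftrightarrow> chart I x \<inter> coord_space (- J) = {0}" and
    \<sigma>: "\<And>x. x \<in> chart_domain I \<Longrightarrow> den' x \<noteq> 0 \<Longrightarrow> \<sigma> x \<in> chart_domain J \<and> chart J (\<sigma> x) = chart I x"
    using ex_chart_transition[OF card[symmetric]] by blast
  have add: "x + y \<in> chart_domain J" if "x \<in> chart_domain J" for x
    using that y(1) unfolding chart_domain_eq by (intro vec.subspace_add subspace_coord_space)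
  have diff: "x - y \<in> chart_domain J" if "x \<in> chart_domain J" for x
    using that y(1) unfolding chart_domain_eq by (intro vec.subspace_diff subspace_coord_space)
  have \<tau>': "den' (\<tau> x) \<noteq> 0 \<and> \<sigma> (\<tau> x) = x" if x: "x \<in> chart_domain J" "den x \<noteq> 0" for x
  proof -
    have t: "\<tau> x \<in> chart_domain I" "chart I (\<tau> x) = chart J x" using \<tau>[OF x] by auto
    then have d: "den' (\<tau> x) \<noteq> 0" using den' chart_meets_complement_trivially[OF x(1)] by simp
    then show ?thesis using \<sigma>[OF t(1) d] t(2) chart_inject[OF _ x(1)] by auto
  qed
  have \<sigma>': "den (\<sigma> x) \<noteq> 0 \<and> \<tau> (\<sigma> x) = x" if x: "x \<in> chart_domain I" "den' x \<noteq> 0" for x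
  proof -
    have t: "\<sigma> x \<in> chart_domain J" "chart J (\<sigma> x) = chart I x" using \<sigma>[OF x] by auto
    then have d: "den (\<sigma> x) \<noteq> 0" using den chart_meets_complement_trivially[OF x(1)] by simp
    then show ?thesis using \<tau>[OF t(1) d] t(2) chart_inject[OF _ x(1)] by auto
  qed
  have shift: "chart J (x + y) \<in> ?\<Omega> \<longleftrightarrow> chart J x \<in> ?\<Omega>" if x: "x \<in> chart_domain J" for x
    using chart_in_grassmannian[OF x] chart_in_grassmannian[OF add[OF x]]
      dim_chart_add_Int_last_span[OF x y(1) low] card
    unfolding incidence_variety_def by auto
  have yI: "den y \<noteq> 0" "\<tau> y = p"
  proof -
    show "den y \<noteq> 0" using den[OF y(1)] y(2) chart_meets_complement_trivially[OF pI] by simp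
    then show "\<tau> y = p" using \<tau>[OF y(1)] y(2) chart_inject[OF _ pI] by auto
  qed
  have chartI: "x \<in> chart_domain I" if "\<And>c. c \<notin> ?dom I \<Longrightarrow> x $ c = 0" for x :: "complex ^ ('n \<times> 'n)" and I
    using that unfolding chart_domain_eq coord_space_def by auto
  have zero: "x $ c = 0" if "x \<in> chart_domain I" "c \<notin> ?dom I" for x :: "complex ^ ('n \<times> 'n)" and c I
    using that unfolding chart_domain_eq coord_space_def by (cases c) auto
  have "0 \<in> singular_points (affine_part J ?\<Omega>) \<longleftrightarrow> \<tau> (0 + y) \<in> singular_points (affine_part I ?\<Omega>)"
  proof (rule singular_points_regular_isomorphism[where den = "\<lambda>x. den (x + y)" and \<tau> = "\<lambda>x. \<tau> (x + y)"
        and den' = den' and \<sigma> = "\<lambda>x. \<sigma> x - y" and S = "?dom J" and S' = "?dom I"])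
    obtain num where num: "\<And>i. polynomial_fun (\<lambda>x. num x $ i)" "\<And>x. den x \<noteq> 0 \<Longrightarrow> den x *s \<tau> x = num x"
      using reg unfolding regular_away_def by blast
    have "polynomial_fun den" using reg unfolding regular_away_def by blast
    have poly_y: "polynomial_fun (\<lambda>x. f (x + y))" if "polynomial_fun f" for f
      by (rule polynomial_fun_compose[OF that])
        (simp add: polynomial_fun.add polynomial_fun.coord polynomial_fun.const)
    show "regular_away (\<lambda>x. den (x + y)) (\<lambda>x. \<tau> (x + y))"
      unfolding regular_away_def
      using poly_y[OF \<open>polynomial_fun den\<close>] poly_y[OF num(1)] num(2)
      by (intro conjI exI[of _ "\<lambda>x. num (x + y)"]) auto
    obtain num' where num': "\<And>i. polynomial_fun (\<lambda>x. num' x $ i)" "\<And>x. den' x \<noteq> 0 \<Longrightarrow> den' x *s \<sigma> x = num' x"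
      using reg' unfolding regular_away_def by blast
    have "polynomial_fun den'" using reg' unfolding regular_away_def by blast
    then show "regular_away den' (\<lambda>x. \<sigma> x - y)"
      unfolding regular_away_def
      by (intro conjI exI[of _ "\<lambda>x. num' x - den' x *s y"])
        (auto simp: num'(2)[symmetric] vec.scale_right_diff_distrib
          intro!: polynomial_fun_diff num'(1) polynomial_fun.mult polynomial_fun.const)
    show "closedin zariski (affine_part J ?\<Omega>)" unfolding card by (rule closedin_affine_part)
    show "closedin zariski (affine_part I ?\<Omega>)" by (rule closedin_affine_part)
    show "x $ c = 0" if "x \<in> affine_part J ?\<Omega>" "c \<notin> ?dom J" for x c
      using that zero[of x J c] unfolding affine_part_def by blast
    show "x $ c = 0" if "x \<in> affine_part I ?\<Omega>" "c \<notin> ?dom I" for x c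
      using that zero[of x I c] unfolding affine_part_def by blast
    show "den' (\<tau> (x + y)) \<noteq> 0 \<and> \<sigma> (\<tau> (x + y)) - y = x"
      if "\<And>c. c \<notin> ?dom J \<Longrightarrow> x $ c = 0" "den (x + y) \<noteq> 0" for x
      using \<tau>'[OF add[OF chartI[OF that(1)]] that(2)] by simp
    show "den (\<sigma> x - y + y) \<noteq> 0 \<and> \<tau> (\<sigma> x - y + y) = x"
      if "\<And>c. c \<notin> ?dom I \<Longrightarrow> x $ c = 0" "den' x \<noteq> 0" for x
      using \<sigma>'[OF chartI[OF that(1)] that(2)] by simp
    show "\<tau> (x + y) \<in> affine_part I ?\<Omega>" if "x \<in> affine_part J ?\<Omega>" "den (x + y) \<noteq> 0" for x
      using that \<tau>[OF add that(2)] shift unfolding affine_part_def by auto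
    show "\<sigma> x - y \<in> affine_part J ?\<Omega>" if x: "x \<in> affine_part I ?\<Omega>" "den' x \<noteq> 0" for x
    proof -
      have "x \<in> chart_domain I" using x unfolding affine_part_def by blast
      then have s: "\<sigma> x \<in> chart_domain J" "chart J (\<sigma> x) = chart I x" using \<sigma>[OF _ x(2)] by auto
      then show ?thesis
        using x(1) diff[OF s(1)] shift[OF diff[OF s(1)]] unfolding affine_part_def by simp
    qed
    have "0 \<in> chart_domain J" by (simp add: chart_domain_def)
    then show "0 \<in> affine_part J ?\<Omega>"
      using shift[of 0] p y(2) unfolding affine_part_def by simp
    show "den (0 + y) \<noteq> 0" using yI by simp
  qed
  then show ?thesis using yI by simp
qed

section \<open>Singular points of incidence varieties\<close>

text \<open>The top member of a chain in \<open>X\<close> is irreducible, so it lies in the closure of a single one of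
  the finitely many parametrized pieces.\<close>

lemma local_dim_le_parameters:
  fixes num :: "'c \<Rightarrow> complex ^ 'u::finite \<Rightarrow> complex ^ 'v::finite"
  assumes "finite \<C>" "\<And>c i. c \<in> \<C> \<Longrightarrow> polynomial_fun (\<lambda>y. num c y $ i)" "\<And>c. c \<in> \<C> \<Longrightarrow> polynomial_fun (den c)"
    and "\<And>c. c \<in> \<C> \<Longrightarrow> card (S c) \<le> D"
    and cover: "\<And>x. x \<in> X \<Longrightarrow> \<exists>c\<in>\<C>. \<exists>y\<in>coord_space (S c). den c y \<noteq> 0 \<and> den c y *s x = num c y"
  shows "local_dim X p \<le> enat D"
proof (rule local_dim_leI)
  fix m Z
  assume Z: "\<And>i. i \<le> m \<Longrightarrow> closedin zariski (Z i)" "\<And>i. i \<le> m \<Longrightarrow> irreducible_in zariski (Z i)"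
    "\<And>i. i \<le> m \<Longrightarrow> p \<in> Z i" "\<And>i. i \<le> m \<Longrightarrow> Z i \<subseteq> X" "\<And>i. i < m \<Longrightarrow> Z i \<subset> Z (Suc i)"
  define W where "W = (\<lambda>c. {x. \<exists>y. (\<forall>i. i \<notin> S c \<longrightarrow> y $ i = 0) \<and> den c y \<noteq> 0 \<and> den c y *s x = num c y})"
  have "X \<subseteq> (\<Union>c\<in>\<C>. W c)"
  proof
    fix x assume "x \<in> X"
    then obtain c y where "c \<in> \<C>" "y \<in> coord_space (S c)" "den c y \<noteq> 0" "den c y *s x = num c y"
      using cover by blast
    then have "x \<in> W c" unfolding W_def coord_space_def by blast
    then show "x \<in> (\<Union>c\<in>\<C>. W c)" using \<open>c \<in> \<C>\<close> by blast
  qed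
  also have "\<dots> \<subseteq> (\<Union>c\<in>\<C>. zariski closure_of W c)"
    by (intro UN_mono order_refl closure_of_subset) simp
  finally have "Z m \<subseteq> (\<Union>c\<in>\<C>. zariski closure_of W c)" using Z(4)[of m] by blast
  then obtain c where c: "c \<in> \<C>" "Z m \<subseteq> zariski closure_of W c"
    using irreducible_in_subset_Union[OF Z(2)[OF order_refl] assms(1), of "\<lambda>c. zariski closure_of W c"]
    by auto
  have "m \<le> card (S c)"
    using c Z(1,2,5) assms(2,3) unfolding W_def
    by (intro chain_length_le_parameters[of m Z "num c" "den c" "S c"]) auto
  then show "enat m \<le> enat D" using assms(4)[OF c(1)] by simp
qed

lemma in_coord_space_combination:
  assumes "\<And>c. c \<in> S \<Longrightarrow> axis c 1 \<in> T" "vec.subspace T"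
  shows "coord_space S \<subseteq> T"
  unfolding span_axis[symmetric] using assms by (intro vec.span_minimal) auto

lemma coord_space_mono: "S \<subseteq> T \<Longrightarrow> coord_space S \<subseteq> coord_space T"
  unfolding coord_space_def by auto

lemma zero_not_singular_coord_space: "0 \<notin> singular_points (coord_space S)"
proof -
  have "tangent_space (coord_space S) 0 = coord_space S"
  proof
    show "tangent_space (coord_space S) 0 \<subseteq> coord_space S"
      using tangent_space_coordinate_subspace[of "coord_space S" S] unfolding coord_space_def by blast
    show "coord_space S \<subseteq> tangent_space (coord_space S) 0"
    proof
      fix v assume "v \<in> coord_space S"
      then have "0 + t *s v \<in> coord_space S" for t
        using vec.subspace_scale[OF subspace_coord_space] by simp
      then show "v \<in> tangent_space (coord_space S) 0" by (rule tangent_space_line)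
    qed
  qed
  moreover have "local_dim (coord_space S) 0 = enat (card S)"
  proof (rule antisym)
    show "local_dim (coord_space S) 0 \<le> enat (card S)"
      by (rule local_dim_le_parameters[where \<C> = "{()}" and num = "\<lambda>_ y. y" and den = "\<lambda>_ _. 1" and S = "\<lambda>_. S"])
        (auto intro: polynomial_fun.coord polynomial_fun.const)
    obtain h where h: "bij_betw h {..<card S} S"
      using ex_bij_betw_nat_finite[of S] by (auto simp: lessThan_atLeast0)
    show "enat (card S) \<le> local_dim (coord_space S) 0"
    proof (rule local_dim_geI[where Z = "\<lambda>i. coord_space (h ` {..<i})"])
      fix i assume i: "i \<le> card S"
      show "closedin zariski (coord_space (h ` {..<i}))" by (rule closedin_zariski_coord_space)
      show "irreducible_in zariski (coord_space (h ` {..<i}))"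
        by (rule irreducible_in_zariski_subspace[OF subspace_coord_space])
      show "0 \<in> coord_space (h ` {..<i})" by (simp add: coord_space_def)
      have "h ` {..<i} \<subseteq> h ` {..<card S}" using i by (intro image_mono) auto
      also have "\<dots> = S" using h by (simp add: bij_betw_def)
      finally show "coord_space (h ` {..<i}) \<subseteq> coord_space S" by (rule coord_space_mono)
    next
      fix i assume i: "i < card S"
      have "inj_on h {..<card S}" using h by (simp add: bij_betw_def)
      then have "h i \<notin> h ` {..<i}" using i by (subst inj_on_image_mem_iff[of h "{..<card S}"]) auto
      then have "axis (h i) 1 \<notin> coord_space (h ` {..<i})" by (simp add: axis_in_coord_space_iff)
      moreover have "axis (h i) 1 \<in> coord_space (h ` {..<Suc i})" by (simp add: axis_in_coord_space_iff)
      moreover have "coord_space (h ` {..<i}) \<subseteq> coord_space (h ` {..<Suc i})"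
        by (intro coord_space_mono image_mono) auto
      ultimately show "coord_space (h ` {..<i}) \<subset> coord_space (h ` {..<Suc i})" by blast
    qed
  qed
  ultimately show ?thesis unfolding singular_points_def by simp
qed

abbreviation tail :: "nat \<Rightarrow> 'n::{finite,linorder} set" where
  "tail N \<equiv> {j. place j \<le> N}"

lemma card_tail: "N \<le> CARD('n) \<Longrightarrow> card (tail N :: 'n::{finite,linorder} set) = N"
  using dim_last_span[of N, where 'n = 'n] unfolding last_span_eq by simp

text \<open>The coordinates along which the chart of \<open>J\<close> is not constrained to first order at its
  origin. Condition \<open>t\<close> constrains to first order only if it holds with equality there.\<close>

definition free_coordinates ::
  "nat \<Rightarrow> (nat \<Rightarrow> nat) \<Rightarrow> (nat \<Rightarrow> nat) \<Rightarrow> 'n::{finite,linorder} set \<Rightarrow> ('n \<times> 'n) set" where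
  "free_coordinates r a M J = {(i, j). i \<notin> J \<and> j \<in> J \<and>
     (\<forall>t\<in>{1..r}. card (J \<inter> tail (a t + M t)) = a t \<and> place j \<le> a t + M t \<longrightarrow> place i \<le> a t + M t)}"

lemma card_chart_columns_le:
  assumes "x \<in> chart_domain J"
  shows "card {j \<in> J. chart_column x j \<in> F} \<le> vec.dim (chart J x \<inter> F)"
proof -
  let ?C = "{j \<in> J. chart_column x j \<in> F}"
  have ind: "card (chart_column x ` J) = card J" "vec.independent (chart_column x ` J)"
    using independent_image_if_dim_span[of "chart_column x" J] dim_chart[OF assms] unfolding chart_eq by auto
  then have "inj_on (chart_column x) J" by (intro eq_card_imp_inj_on) auto
  then have "card (chart_column x ` ?C) = card ?C" by (intro card_image) (auto elim: inj_on_subset)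
  moreover have "vec.independent (chart_column x ` ?C)"
    using ind(2) by (rule vec.independent_mono) auto
  moreover have "chart_column x ` ?C \<subseteq> chart J x \<inter> F"
    using chart_column_in_chart by auto
  ultimately show ?thesis
    using vec.independent_card_le_dim[of "chart_column x ` ?C" "chart J x \<inter> F"] by simp
qed

lemma chart_column_in_last_span_iff:
  assumes "x \<in> chart_domain J" "j \<in> J"
  shows "chart_column x j \<in> last_span N \<longleftrightarrow> place j \<le> N \<and> (\<forall>i. x $ (i, j) \<noteq> 0 \<longrightarrow> place i \<le> N)"
proof -
  have "chart_column x j $ i \<noteq> 0 \<longleftrightarrow> i = j \<or> x $ (i, j) \<noteq> 0" for i
  proof (cases "i \<in> J")
    case True
    then have "x $ (i, j) = 0" using assms(1) unfolding chart_domain_def by blast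
    then show ?thesis using chart_column_inside[OF assms(1) True, of j] by simp
  next
    case False
    then show ?thesis using chart_column_outside[OF assms(2) False, of x] assms(2) by auto
  qed
  then show ?thesis unfolding in_last_span_iff by auto
qed

text \<open>If condition \<open>t\<close> is sharp at the origin, then the dimension of the intersection with the member of
  the flag is as large as the coordinates of \<open>J\<close> in that member permit, so each of the corresponding
  basis vectors of the chart has to lie in the member.\<close>

lemma affine_part_subset_free_coordinates:
  assumes eq: "\<And>t. t \<in> {1..r} \<Longrightarrow> card (J \<inter> tail (a t + M t)) = a t" and k: "card J = k"
  shows "affine_part J (incidence_variety k r a M) \<subseteq> coord_space (free_coordinates r a M J)"
proof
  fix x assume "x \<in> affine_part J (incidence_variety k r a M)"
  then have x: "x \<in> chart_domain J" "chart J x \<in> incidence_variety k r a M" unfolding affine_part_def by auto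
  have "place i \<le> a t + M t"
    if ij: "x $ (i, j) \<noteq> 0" and t: "t \<in> {1..r}" "place j \<le> a t + M t" for i j t
  proof -
    let ?V = "chart J x \<inter> last_span (a t + M t)" and ?J = "J \<inter> tail (a t + M t)"
    have J: "i \<notin> J" "j \<in> J" using ij x(1) unfolding chart_domain_def by blast+
    have sub: "vec.subspace ?V" by (intro vec.subspace_inter subspace_chart subspace_last_span)
    have triv: "?V \<inter> coord_space (- ?J) \<subseteq> {0}"
      using chart_Int_complement[OF x(1)] unfolding last_span_eq coord_space_def by blast
    have "vec.dim ?V \<le> card ?J"
    proof -
      have "vec.dim ((\<lambda>v. \<chi> i. if i \<in> ?J then v $ i else 0) ` ?V) \<le> vec.dim (coord_space ?J)"
        by (intro vec.dim_subset) (auto simp: coord_space_def)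
      then show ?thesis unfolding restrict_to_coordinates[OF sub triv] by simp
    qed
    moreover have "a t \<le> vec.dim ?V" using x(2) t(1) unfolding incidence_variety_def by blast
    ultimately have "vec.dim ?V = card ?J" using eq[OF t(1)] by simp
    then obtain v where v: "v \<in> ?V" "\<forall>l\<in>?J. v $ l = axis j 1 $ l"
      using ex_vector_with_coordinates[OF sub triv, of "axis j 1"] by blast
    have "v - chart_column x j \<in> coord_space (- J)"
    proof -
      have "v $ l = chart_column x j $ l" if l: "l \<in> J" for l
      proof (cases "place l \<le> a t + M t")
        case True
        then show ?thesis using v(2) l chart_column_inside[OF x(1) l, of j] by (auto simp: axis_def)
      next
        case False
        then have "v $ l = 0" "l \<noteq> j" using v(1) t(2) by (auto simp: in_last_span_iff)
        then show ?thesis using chart_column_inside[OF x(1) l, of j] by simp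
      qed
      then show ?thesis by (simp add: coord_space_def)
    qed
    moreover have "v - chart_column x j \<in> chart J x"
      using v(1) by (intro vec.subspace_diff subspace_chart chart_column_in_chart J) auto
    ultimately have "v = chart_column x j" using chart_Int_complement[OF x(1)] by auto
    then have "chart_column x j \<in> last_span (a t + M t)" using v(1) by blast
    then show ?thesis using ij chart_column_in_last_span_iff[OF x(1) J(2)] by blast
  qed
  then show "x \<in> coord_space (free_coordinates r a M J)"
    using x(1) unfolding coord_space_def free_coordinates_def chart_domain_def by fast
qed

text \<open>Counting basis vectors that lie in a member of the flag: the column \<open>j0\<close> may be lost at the
  conditions that are not sharp, and no column is lost at the sharp ones.\<close>

lemma in_affine_part_if_free_columns:
  assumes x: "x \<in> coord_space (free_coordinates r a M J)" and k: "card J = k"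
    and ge: "\<And>t. t \<in> {1..r} \<Longrightarrow> a t \<le> card (J \<inter> tail (a t + M t))"
    and zero: "\<And>t j i. t \<in> {1..r} \<Longrightarrow> a t < card (J \<inter> tail (a t + M t)) \<Longrightarrow> j \<noteq> j0 \<Longrightarrow> x $ (i, j) = 0"
  shows "x \<in> affine_part J (incidence_variety k r a M)"
proof -
  have dom: "x \<in> chart_domain J"
    using x unfolding chart_domain_def coord_space_def free_coordinates_def by auto
  have "a t \<le> vec.dim (chart J x \<inter> last_span (a t + M t))" if t: "t \<in> {1..r}" for t
  proof -
    let ?J = "J \<inter> tail (a t + M t)"
    have "a t \<le> card {j \<in> J. chart_column x j \<in> last_span (a t + M t)}"
    proof (cases "card ?J = a t")
      case True
      have "?J \<subseteq> {j \<in> J. chart_column x j \<in> last_span (a t + M t)}"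
      proof
        fix j assume j: "j \<in> ?J"
        have "place i \<le> a t + M t" if "x $ (i, j) \<noteq> 0" for i
        proof -
          have "(i, j) \<in> free_coordinates r a M J" using x that unfolding coord_space_def by blast
          then show ?thesis using True t j unfolding free_coordinates_def by blast
        qed
        then show "j \<in> {j \<in> J. chart_column x j \<in> last_span (a t + M t)}"
          using j chart_column_in_last_span_iff[OF dom] by auto
      qed
      then have "card ?J \<le> card {j \<in> J. chart_column x j \<in> last_span (a t + M t)}"
        by (intro card_mono) auto
      then show ?thesis using True by simp
    next
      case False
      then have less: "a t < card ?J" using ge[OF t] by simp
      have "?J - {j0} \<subseteq> {j \<in> J. chart_column x j \<in> last_span (a t + M t)}"
        using zero[OF t less] chart_column_in_last_span_iff[OF dom] by auto
      then have "card (?J - {j0}) \<le> card {j \<in> J. chart_column x j \<in> last_span (a t + M t)}"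
        by (intro card_mono) auto
      moreover have "card ?J - 1 \<le> card (?J - {j0})" by (simp add: card_Diff_singleton_if)
      ultimately show ?thesis using less by linarith
    qed
    then show ?thesis using card_chart_columns_le[OF dom] order_trans by blast
  qed
  then show ?thesis
    using dom chart_in_grassmannian[OF dom] k unfolding affine_part_def incidence_variety_def by auto
qed

lemma not_singular_if_all_equal:
  assumes "\<And>t. t \<in> {1..r} \<Longrightarrow> card (J \<inter> tail (a t + M t)) = a t" "card J = k"
  shows "0 \<notin> singular_points (affine_part J (incidence_variety k r a M))"
proof -
  have "coord_space (free_coordinates r a M J) \<subseteq> affine_part J (incidence_variety k r a M)"
    using assms by (auto intro!: in_affine_part_if_free_columns)
  then have "affine_part J (incidence_variety k r a M) = coord_space (free_coordinates r a M J)"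
    using affine_part_subset_free_coordinates[of r J a M k, OF assms] by blast
  then show ?thesis by (simp add: zero_not_singular_coord_space)
qed

text \<open>A free coordinate line lies in the variety: at worst its one vector that is not a coordinate
  vector leaves the member of the flag, which only matters where the condition is sharp.\<close>

lemma card_free_coordinates_le_dim_tangent_space:
  assumes "\<And>t. t \<in> {1..r} \<Longrightarrow> a t \<le> card (J \<inter> tail (a t + M t))" "card J = k"
  shows "card (free_coordinates r a M J) \<le>
    vec.dim (tangent_space (affine_part J (incidence_variety k r a M)) 0)"
proof -
  have "coord_space (free_coordinates r a M J) \<subseteq> tangent_space (affine_part J (incidence_variety k r a M)) 0"
  proof (rule in_coord_space_combination[OF _ subspace_tangent_space])
    fix c assume c: "c \<in> free_coordinates r a M J"
    show "axis c 1 \<in> tangent_space (affine_part J (incidence_variety k r a M)) 0"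
    proof (rule tangent_space_line)
      fix t :: complex
      have line: "(0 + t *s axis c 1) $ p = (if p = c then t else 0)" for p by (simp add: axis_def)
      have "0 + t *s axis c 1 \<in> coord_space (free_coordinates r a M J)"
        unfolding coord_space_def mem_Collect_eq line using c by auto
      moreover have "(0 + t *s axis c 1) $ (i, j) = 0" if "j \<noteq> snd c" for i j
        unfolding line using that by auto
      ultimately show "0 + t *s axis c 1 \<in> affine_part J (incidence_variety k r a M)"
        using assms by (intro in_affine_part_if_free_columns[of _ r a M J k "snd c"])
    qed
  qed
  from vec.dim_subset[OF this] show ?thesis by simp
qed

text \<open>The variety is covered by the rational images of the Schubert cells, given by their echelon
  forms.\<close>

lemma local_dim_affine_part_le:
  fixes J :: "'n::{finite,linorder} set"
  assumes k: "card J = k" and n: "\<And>t. t \<in> {1..r} \<Longrightarrow> a t + M t \<le> CARD('n)"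
    and cells: "\<And>J' :: 'n set. card J' = k \<Longrightarrow> (\<And>t. t \<in> {1..r} \<Longrightarrow> a t \<le> card (J' \<inter> tail (a t + M t))) \<Longrightarrow>
      card {(i, j). i \<notin> J' \<and> j \<in> J' \<and> place i < place j} \<le> D"
  shows "local_dim (affine_part J (incidence_variety k r a M)) p \<le> enat D"
proof -
  define \<C> where "\<C> = {J' :: 'n set. card J' = k \<and> (\<forall>t\<in>{1..r}. a t \<le> card (J' \<inter> tail (a t + M t)))}"
  have "\<exists>den num. polynomial_fun den \<and> (\<forall>i. polynomial_fun (\<lambda>y. num y $ i)) \<and>
      (\<forall>x\<in>chart_domain J. \<forall>y\<in>chart_domain J'. chart J' y = chart J x \<longrightarrow> den y \<noteq> 0 \<and> den y *s x = num y)"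
    if J': "card J' = k" for J' :: "'n set"
  proof -
    have "card J = card J'" using k J' by simp
    from ex_chart_transition[OF this] obtain den \<tau> where reg: "regular_away den \<tau>" and
      den: "\<And>y. y \<in> chart_domain J' \<Longrightarrow> den y \<noteq> 0 \<longleftrightarrow> chart J' y \<inter> coord_space (- J) = {0}" and
      \<tau>: "\<And>y. y \<in> chart_domain J' \<Longrightarrow> den y \<noteq> 0 \<Longrightarrow> \<tau> y \<in> chart_domain J \<and> chart J (\<tau> y) = chart J' y"
      by blast
    obtain num where num: "\<And>i. polynomial_fun (\<lambda>y. num y $ i)" "\<And>y. den y \<noteq> 0 \<Longrightarrow> den y *s \<tau> y = num y"
      and "polynomial_fun den"
      using reg unfolding regular_away_def by blast
    moreover have "den y \<noteq> 0 \<and> den y *s x = num y"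
      if xy: "x \<in> chart_domain J" "y \<in> chart_domain J'" "chart J' y = chart J x" for x y
    proof -
      have d: "den y \<noteq> 0" using den[OF xy(2)] xy(3) chart_meets_complement_trivially[OF xy(1)] by simp
      then have "\<tau> y = x" using \<tau>[OF xy(2)] xy(3) chart_inject[OF _ xy(1)] by auto
      then show ?thesis using num(2)[OF d] d by simp
    qed
    ultimately show ?thesis by blast
  qed
  then obtain den num where dn: "\<And>J' :: 'n set. card J' = k \<Longrightarrow> polynomial_fun (den J')"
    "\<And>J' i. card J' = k \<Longrightarrow> polynomial_fun (\<lambda>y. num J' y $ i)"
    "\<And>J' x y. card J' = k \<Longrightarrow> x \<in> chart_domain J \<Longrightarrow> y \<in> chart_domain J' \<Longrightarrow> chart J' y = chart J x \<Longrightarrow>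
      den J' y \<noteq> 0 \<and> den J' y *s x = num J' y"
    by metis
  show ?thesis
  proof (rule local_dim_le_parameters[where \<C> = \<C> and num = num and den = den
        and S = "\<lambda>J'. {(i, j). i \<notin> J' \<and> j \<in> J' \<and> place i < place j}"])
    show "finite \<C>" by simp
    show "polynomial_fun (\<lambda>y. num c y $ i)" if "c \<in> \<C>" for c i
      using that dn(2) unfolding \<C>_def by blast
    show "polynomial_fun (den c)" if "c \<in> \<C>" for c
      using that dn(1) unfolding \<C>_def by blast
    show "card {(i, j). i \<notin> J' \<and> j \<in> J' \<and> place i < place j} \<le> D" if "J' \<in> \<C>" for J'
      using cells that unfolding \<C>_def by blast
    fix x assume "x \<in> affine_part J (incidence_variety k r a M)"
    then have x: "x \<in> chart_domain J" "chart J x \<in> incidence_variety k r a M" unfolding affine_part_def by auto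
    let ?J' = "pivots (chart J x)"
    obtain y where y: "y \<in> chart_domain ?J'" "chart ?J' y = chart J x"
      "\<And>i j. y $ (i, j) \<noteq> 0 \<Longrightarrow> place i < place j"
      using ex_echelon_chart[OF subspace_chart, of J x] by blast
    have card: "card ?J' = k" using card_pivots[OF subspace_chart, of J x] dim_chart[OF x(1)] k by simp
    moreover have "a t \<le> card (?J' \<inter> tail (a t + M t))" if "t \<in> {1..r}" for t
      using x(2) that n[OF that] unfolding incidence_variety_def
      by (simp add: card_pivots_Int[OF subspace_chart])
    ultimately have "?J' \<in> \<C>" unfolding \<C>_def by blast
    moreover have "y \<in> coord_space {(i, j). i \<notin> ?J' \<and> j \<in> ?J' \<and> place i < place j}"
      using y(1,3) unfolding coord_space_def chart_domain_def by auto
    ultimately show "\<exists>c\<in>\<C>. \<exists>y\<in>coord_space {(i, j). i \<notin> c \<and> j \<in> c \<and> place i < place j}.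
        den c y \<noteq> 0 \<and> den c y *s x = num c y"
      using dn(3)[OF card x(1) y(1,2)] by blast
  qed
qed

section \<open>Counting coordinates\<close>

definition rank_in :: "'n::{finite,linorder} set \<Rightarrow> 'n \<Rightarrow> nat" where
  "rank_in J j = card (J \<inter> tail (place j))"

lemma bij_betw_rank_in:
  fixes J :: "'n::{finite,linorder} set"
  shows "bij_betw (rank_in J) J {1..card J}"
proof -
  have less: "rank_in J i < rank_in J j" if "i \<in> J" "j \<in> J" "place i < place j" for i j
    unfolding rank_in_def
  proof (rule psubset_card_mono)
    have "j \<in> J \<inter> tail (place j)" "j \<notin> J \<inter> tail (place i)" using that by auto
    moreover have "J \<inter> tail (place i) \<subseteq> J \<inter> tail (place j)" using that by auto
    ultimately show "J \<inter> tail (place i) \<subset> J \<inter> tail (place j)" by blast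
  qed simp
  have inj: "inj_on (rank_in J) J"
    by (rule inj_onI) (metis less less_irrefl linorder_neqE_nat place_eq_iff)
  have "rank_in J j \<in> {1..card J}" if "j \<in> J" for j
  proof -
    have "{j} \<subseteq> J \<inter> tail (place j)" using that by auto
    from card_mono[OF _ this] have "1 \<le> rank_in J j" unfolding rank_in_def by simp
    moreover have "rank_in J j \<le> card J" unfolding rank_in_def by (intro card_mono) auto
    ultimately show ?thesis by simp
  qed
  then have "rank_in J ` J \<subseteq> {1..card J}" by blast
  then have "rank_in J ` J = {1..card J}"
    using card_image[OF inj] by (intro card_subset_eq) auto
  then show ?thesis using inj by (simp add: bij_betw_def)
qed

lemma rank_in_le_iff:
  assumes "j \<in> J"
  shows "rank_in J j \<le> card (J \<inter> tail N) \<longleftrightarrow> place j \<le> N"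
proof
  assume "place j \<le> N"
  then show "rank_in J j \<le> card (J \<inter> tail N)" unfolding rank_in_def by (intro card_mono) auto
next
  assume R: "rank_in J j \<le> card (J \<inter> tail N)"
  show "place j \<le> N"
  proof (rule ccontr)
    assume "\<not> place j \<le> N"
    then have "j \<in> J \<inter> tail (place j)" "j \<notin> J \<inter> tail N" using assms by auto
    moreover have "J \<inter> tail N \<subseteq> J \<inter> tail (place j)" using \<open>\<not> place j \<le> N\<close> by auto
    ultimately have "J \<inter> tail N \<subset> J \<inter> tail (place j)" by blast
    then have "card (J \<inter> tail N) < rank_in J j" unfolding rank_in_def by (intro psubset_card_mono) auto
    then show False using R by simp
  qed
qed

definition incidence_data :: "nat \<Rightarrow> nat \<Rightarrow> nat \<Rightarrow> (nat \<Rightarrow> nat) \<Rightarrow> (nat \<Rightarrow> nat) \<Rightarrow> bool" where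
  "incidence_data n k r a M \<longleftrightarrow> k < n \<and> (\<forall>t\<in>{1..r}. 0 < a t \<and> a t < k \<and> 0 < M t \<and> M t < n - k) \<and>
     (\<forall>s\<in>{1..r}. \<forall>t\<in>{1..r}. s < t \<longrightarrow> a s < a t \<and> M s < M t)"

text \<open>In the echelon form of a member that satisfies the conditions, the vector with the \<open>m\<close>-th
  smallest leading place has at most this many free entries. The sum over all \<open>m\<close> is the dimension of
  the Schubert variety: for the corners of a partition, the entry for \<open>m\<close> is \<open>n - k\<close> minus the \<open>m\<close>-th part.\<close>

definition column_bound :: "nat \<Rightarrow> nat \<Rightarrow> nat \<Rightarrow> (nat \<Rightarrow> nat) \<Rightarrow> (nat \<Rightarrow> nat) \<Rightarrow> nat \<Rightarrow> nat" where
  "column_bound n k r a M m = Min (insert (n - k) (M ` {t \<in> {1..r}. m \<le> a t}))"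

lemma card_tail_minus:
  fixes J :: "'n::{finite,linorder} set"
  assumes "N \<le> CARD('n)"
  shows "card (tail N - J) = N - card (J \<inter> tail N)"
proof -
  have "card (tail N - J) = card (tail N :: 'n set) - card (tail N \<inter> J)"
    by (rule card_Diff_subset_Int) simp
  then show ?thesis using card_tail[OF assms] by (simp add: Int_commute)
qed

lemma sum_over_columns:
  fixes J :: "'n::finite set" and Q :: "'n \<Rightarrow> 'n \<Rightarrow> bool"
  shows "card {(i, j). i \<notin> J \<and> j \<in> J \<and> Q i j} = (\<Sum>j\<in>J. card {i. i \<notin> J \<and> Q i j})"
proof -
  have "{(i, j). i \<notin> J \<and> j \<in> J \<and> Q i j} = (\<lambda>(j, i). (i, j)) ` (SIGMA j:J. {i. i \<notin> J \<and> Q i j})" by auto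
  then have "card {(i, j). i \<notin> J \<and> j \<in> J \<and> Q i j} = card (SIGMA j:J. {i. i \<notin> J \<and> Q i j})"
    by (simp add: card_image inj_on_def case_prod_beta)
  then show ?thesis by simp
qed

lemma sum_rank_in: "(\<Sum>j\<in>J. c (rank_in J j)) = (\<Sum>m\<in>{1..card J}. c m)"
  by (rule sum.reindex_bij_betw[OF bij_betw_rank_in])

text \<open>If \<open>j\<close> is among the first \<open>a t\<close> pivots, then its place is at most \<open>a t + M t\<close>, and of the
  \<open>a t + M t\<close> indices in that range at least \<open>a t\<close> are pivots, which leaves \<open>M t\<close>.\<close>

lemma card_echelon_coordinates_le:
  fixes J :: "'n::{finite,linorder} set"
  assumes data: "incidence_data CARD('n) (card J) r a M"
    and ge: "\<And>t. t \<in> {1..r} \<Longrightarrow> a t \<le> card (J \<inter> tail (a t + M t))"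
  shows "card {(i, j). i \<notin> J \<and> j \<in> J \<and> place i < place j} \<le>
    (\<Sum>m\<in>{1..card J}. column_bound CARD('n) (card J) r a M m)"
proof -
  have "card {i. i \<notin> J \<and> place i < place j} \<le> column_bound CARD('n) (card J) r a M (rank_in J j)"
    if j: "j \<in> J" for j
    unfolding column_bound_def
  proof (rule Min.boundedI)
    fix b assume "b \<in> insert (CARD('n) - card J) (M ` {t \<in> {1..r}. rank_in J j \<le> a t})"
    then consider "b = CARD('n) - card J" | t where "t \<in> {1..r}" "rank_in J j \<le> a t" "b = M t" by auto
    then show "card {i. i \<notin> J \<and> place i < place j} \<le> b"
    proof cases
      case 1
      have "card {i. i \<notin> J \<and> place i < place j} \<le> card (UNIV - J)" by (intro card_mono) auto
      also have "\<dots> = b" using 1 by (simp add: card_Diff_subset)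
      finally show ?thesis .
    next
      case 2
      have N: "a t + M t \<le> CARD('n)" using data 2(1) unfolding incidence_data_def by fastforce
      have "place j \<le> a t + M t"
        using rank_in_le_iff[OF j] ge[OF 2(1)] 2(2) order_trans by blast
      then have "card {i. i \<notin> J \<and> place i < place j} \<le> card (tail (a t + M t) - J)"
        by (intro card_mono) auto
      then show ?thesis using ge[OF 2(1)] 2(3) by (simp add: card_tail_minus[OF N])
    qed
  qed auto
  then show ?thesis unfolding sum_over_columns sum_rank_in[symmetric] by (intro sum_mono)
qed

text \<open>Column by column there are at least as many free coordinates as the bound, because the sharp
  conditions are among those that enter the bound. In the pivot column of rank \<open>a s\<close> the bound is
  \<open>M s\<close>, attained by condition \<open>s\<close> alone; as that condition is not sharp, the first sharp one that
  applies to this column, if any, has a larger index and leaves more coordinates.\<close>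

lemma card_free_coordinates_gt:
  fixes J :: "'n::{finite,linorder} set"
  assumes data: "incidence_data CARD('n) (card J) r a M"
    and ge: "\<And>t. t \<in> {1..r} \<Longrightarrow> a t \<le> card (J \<inter> tail (a t + M t))"
    and s: "s \<in> {1..r}" "a s < card (J \<inter> tail (a s + M s))"
  shows "(\<Sum>m\<in>{1..card J}. column_bound CARD('n) (card J) r a M m) < card (free_coordinates r a M J)"
proof -
  let ?n = "CARD('n)" and ?k = "card J"
  let ?c = "column_bound ?n ?k r a M"
  define Q where "Q = (\<lambda>(i::'n) (j::'n). \<forall>t\<in>{1..r}. card (J \<inter> tail (a t + M t)) = a t \<and> place j \<le> a t + M t \<longrightarrow>
    place i \<le> a t + M t)"
  define T where "T = (\<lambda>j. {t \<in> {1..r}. card (J \<inter> tail (a t + M t)) = a t \<and> rank_in J j \<le> a t})"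
  have free: "free_coordinates r a M J = {(i, j). i \<notin> J \<and> j \<in> J \<and> Q i j}"
    unfolding free_coordinates_def Q_def by blast
  have mono: "a t \<le> a t' \<and> M t \<le> M t'" if "t \<in> {1..r}" "t' \<in> {1..r}" "t \<le> t'" for t t'
    using data that unfolding incidence_data_def by (metis le_eq_less_or_eq)
  have in_T: "t \<in> T j" if "j \<in> J" "t \<in> {1..r}" "card (J \<inter> tail (a t + M t)) = a t" "place j \<le> a t + M t" for t j
    using that rank_in_le_iff[OF that(1), of "a t + M t"] unfolding T_def by auto
  have count: "\<exists>b. (b = ?n - ?k \<or> (\<exists>t\<in>T j. b = M t)) \<and> b \<le> card {i. i \<notin> J \<and> Q i j}" if j: "j \<in> J" for j
  proof (cases "T j = {}")
    case True
    then have "Q i j" for i using in_T[OF j] unfolding Q_def by blast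
    then have "{i. i \<notin> J \<and> Q i j} = UNIV - J" by auto
    then have "?n - ?k \<le> card {i. i \<notin> J \<and> Q i j}" by (simp add: card_Diff_subset)
    then show ?thesis by blast
  next
    case False
    define t where "t = Min (T j)"
    have fin: "finite (T j)" unfolding T_def by simp
    have t: "t \<in> T j" unfolding t_def using fin False by (rule Min_in)
    then have tr: "t \<in> {1..r}" "card (J \<inter> tail (a t + M t)) = a t" unfolding T_def by auto
    have N: "a t + M t \<le> ?n" using data tr(1) unfolding incidence_data_def by fastforce
    have "tail (a t + M t) - J \<subseteq> {i. i \<notin> J \<and> Q i j}"
    proof
      fix i assume i: "i \<in> tail (a t + M t) - J"
      have "place i \<le> a t' + M t'"
        if t': "t' \<in> {1..r}" "card (J \<inter> tail (a t' + M t')) = a t'" "place j \<le> a t' + M t'" for t'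
      proof -
        have "t \<le> t'" unfolding t_def using fin in_T[OF j t'] by (rule Min_le)
        then show ?thesis using mono[OF tr(1) t'(1)] i by fastforce
      qed
      then show "i \<in> {i. i \<notin> J \<and> Q i j}" using i unfolding Q_def by blast
    qed
    then have "card (tail (a t + M t) - J) \<le> card {i. i \<notin> J \<and> Q i j}" by (intro card_mono) auto
    then have "M t \<le> card {i. i \<notin> J \<and> Q i j}" using tr(2) by (simp add: card_tail_minus[OF N])
    then show ?thesis using t by blast
  qed
  have c_le: "?c (rank_in J j) \<le> card {i. i \<notin> J \<and> Q i j}" if j: "j \<in> J" for j
  proof -
    obtain b where b: "b = ?n - ?k \<or> (\<exists>t\<in>T j. b = M t)" "b \<le> card {i. i \<notin> J \<and> Q i j}"
      using count[OF j] by blast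
    have "?c (rank_in J j) \<le> b"
      unfolding column_bound_def using b(1) by (intro Min_le) (auto simp: T_def)
    then show ?thesis using b(2) by simp
  qed
  have "a s \<in> {1..?k}" using data s(1) unfolding incidence_data_def by fastforce
  then have "a s \<in> rank_in J ` J"
    using bij_betw_rank_in[of J] by (simp add: bij_betw_def)
  then obtain j where j: "j \<in> J" "rank_in J j = a s" by force
  have "?c (rank_in J j) < card {i. i \<notin> J \<and> Q i j}"
  proof -
    obtain b where b: "b = ?n - ?k \<or> (\<exists>t\<in>T j. b = M t)" "b \<le> card {i. i \<notin> J \<and> Q i j}"
      using count[OF j(1)] by blast
    have "?c (rank_in J j) \<le> M s"
      unfolding column_bound_def using s(1) j(2) by (intro Min_le) auto
    moreover have "M s < b"
      using b(1)
    proof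
      assume "b = ?n - ?k"
      then show ?thesis using data s(1) unfolding incidence_data_def by auto
    next
      assume "\<exists>t\<in>T j. b = M t"
      then obtain t where t: "t \<in> {1..r}" "card (J \<inter> tail (a t + M t)) = a t" "a s \<le> a t" "b = M t"
        unfolding T_def using j(2) by auto
      have "t \<noteq> s" using t(2) s(2) by auto
      moreover have "\<not> t < s" using t(1,3) s(1) data unfolding incidence_data_def by fastforce
      ultimately have "s < t" by simp
      then show ?thesis using t s(1) data unfolding incidence_data_def by blast
    qed
    ultimately show ?thesis using b(2) by simp
  qed
  then have "(\<Sum>j\<in>J. ?c (rank_in J j)) < (\<Sum>j\<in>J. card {i. i \<notin> J \<and> Q i j})"
    using c_le j(1) by (intro sum_strict_mono_ex1) auto
  then show ?thesis unfolding free sum_over_columns sum_rank_in .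
qed

text \<open>Some condition is not sharp: the tangent space has a larger dimension than all parametrized
  pieces. All conditions are sharp: the variety is a linear subspace.\<close>

lemma zero_singular_affine_part_iff:
  fixes J :: "'n::{finite,linorder} set"
  assumes data: "incidence_data CARD('n) (card J) r a M"
    and ge: "\<And>t. t \<in> {1..r} \<Longrightarrow> a t \<le> card (J \<inter> tail (a t + M t))"
  shows "0 \<in> singular_points (affine_part J (incidence_variety (card J) r a M)) \<longleftrightarrow>
    (\<exists>t\<in>{1..r}. a t < card (J \<inter> tail (a t + M t)))"
proof
  assume "0 \<in> singular_points (affine_part J (incidence_variety (card J) r a M))"
  then have "\<not> (\<forall>t\<in>{1..r}. card (J \<inter> tail (a t + M t)) = a t)"
    using not_singular_if_all_equal[of r J a M "card J"] by blast
  then show "\<exists>t\<in>{1..r}. a t < card (J \<inter> tail (a t + M t))"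
    using ge by (metis le_neq_implies_less)
next
  assume "\<exists>t\<in>{1..r}. a t < card (J \<inter> tail (a t + M t))"
  then obtain s where s: "s \<in> {1..r}" "a s < card (J \<inter> tail (a s + M s))" by blast
  let ?X = "affine_part J (incidence_variety (card J) r a M)"
  let ?D = "\<Sum>m\<in>{1..card J}. column_bound CARD('n) (card J) r a M m"
  have "local_dim ?X 0 \<le> enat ?D"
  proof (rule local_dim_affine_part_le[OF refl])
    show "a t + M t \<le> CARD('n)" if "t \<in> {1..r}" for t
      using data that unfolding incidence_data_def by fastforce
    show "card {(i, j). i \<notin> J' \<and> j \<in> J' \<and> place i < place j} \<le> ?D"
      if "card J' = card J" "\<And>t. t \<in> {1..r} \<Longrightarrow> a t \<le> card (J' \<inter> tail (a t + M t))" for J' :: "'n set"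
      using card_echelon_coordinates_le[of J' r a M] data that by simp
  qed
  moreover have "?D < vec.dim (tangent_space ?X 0)"
    using card_free_coordinates_gt[OF data ge s]
      card_free_coordinates_le_dim_tangent_space[of r a J M "card J", OF ge refl] by linarith
  moreover have "0 \<in> ?X"
    using ge by (intro in_affine_part_if_free_columns) (simp_all add: coord_space_def)
  ultimately show "0 \<in> singular_points ?X"
    unfolding singular_points_def by (metis (mono_tags, lifting) enat_ord_simps(1) leD mem_Collect_eq)
qed

lemma singular_locus_incidence_variety:
  assumes data: "incidence_data CARD('n::{finite,linorder}) k r a M"
  shows "singular_locus k (incidence_variety k r a M :: (complex ^ 'n::{finite,linorder}) set set) =
    {V \<in> incidence_variety k r a M. \<exists>t\<in>{1..r}. a t < vec.dim (V \<inter> last_span (a t + M t))}"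
proof -
  let ?\<Omega> = "incidence_variety k r a M :: (complex ^ 'n::{finite,linorder}) set set"
  have N: "a t + M t \<le> CARD('n)" if "t \<in> {1..r}" for t
    using data that unfolding incidence_data_def by fastforce
  have sing: "p \<in> singular_points (affine_part I ?\<Omega>) \<longleftrightarrow>
      (\<exists>t\<in>{1..r}. a t < vec.dim (chart I p \<inter> last_span (a t + M t)))"
    if I: "card I = k" and p: "p \<in> affine_part I ?\<Omega>" for I :: "'n set" and p
  proof -
    let ?J = "pivots (chart I p)"
    have pI: "p \<in> chart_domain I" "chart I p \<in> ?\<Omega>" using p unfolding affine_part_def by auto
    have J: "card ?J = k" using card_pivots[OF subspace_chart, of I p] dim_chart[OF pI(1)] I by simp
    have dims: "card (?J \<inter> tail (a t + M t)) = vec.dim (chart I p \<inter> last_span (a t + M t))"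
      if "t \<in> {1..r}" for t
      by (rule card_pivots_Int[OF subspace_chart N[OF that]])
    have "p \<in> singular_points (affine_part I ?\<Omega>) \<longleftrightarrow> 0 \<in> singular_points (affine_part ?J ?\<Omega>)"
      using singular_points_affine_part_iff[of p I r a M] p I by simp
    also have "\<dots> \<longleftrightarrow> (\<exists>t\<in>{1..r}. a t < card (?J \<inter> tail (a t + M t)))"
      using zero_singular_affine_part_iff[of ?J r a M] data J dims pI(2)
      by (simp add: incidence_variety_def)
    also have "\<dots> \<longleftrightarrow> (\<exists>t\<in>{1..r}. a t < vec.dim (chart I p \<inter> last_span (a t + M t)))"
      using dims by simp
    finally show ?thesis .
  qed
  have sing_sub: "singular_points X \<subseteq> X" for X :: "(complex ^ ('n \<times> 'n)) set"
    unfolding singular_points_def by blast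
  show ?thesis
    unfolding singular_locus_def affine_part_def[symmetric]
  proof (intro equalityI subsetI)
    fix V assume "V \<in> (\<Union>I\<in>{I. card I = k}. chart I ` singular_points (affine_part I ?\<Omega>))"
    then obtain I p where I: "card I = k" "p \<in> singular_points (affine_part I ?\<Omega>)" "V = chart I p" by blast
    then have p: "p \<in> affine_part I ?\<Omega>" using sing_sub by blast
    then show "V \<in> {V \<in> ?\<Omega>. \<exists>t\<in>{1..r}. a t < vec.dim (V \<inter> last_span (a t + M t))}"
      using sing[OF I(1) p] I(2,3) unfolding affine_part_def by simp
  next
    fix V assume V: "V \<in> {V \<in> ?\<Omega>. \<exists>t\<in>{1..r}. a t < vec.dim (V \<inter> last_span (a t + M t))}"
    then have sub: "vec.subspace V" "vec.dim V = k" unfolding incidence_variety_def grassmannian_def by auto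
    let ?J = "pivots V"
    obtain y where y: "y \<in> chart_domain ?J" "chart ?J y = V" using ex_echelon_chart[OF sub(1)] .
    have J: "card ?J = k" using card_pivots[OF sub(1)] sub(2) by simp
    have "y \<in> affine_part ?J ?\<Omega>" using y V unfolding affine_part_def by simp
    then have "y \<in> singular_points (affine_part ?J ?\<Omega>)" using sing[OF J] V y(2) by simp
    then show "V \<in> (\<Union>I\<in>{I. card I = k}. chart I ` singular_points (affine_part I ?\<Omega>))"
      using J y(2) by (intro UN_I[of ?J] image_eqI[of V _ y]) simp_all
  qed
qed

section \<open>Subspaces and flags as translates of the standard flag\<close>

definition matrix_column :: "complex ^ ('n \<times> 'n::finite) \<Rightarrow> 'n \<Rightarrow> complex ^ 'n" where
  "matrix_column g j = (\<chi> i. g $ (i, j))"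

lemma matrix_eq_columns: "(\<chi> i j. g $ (i, j)) = matrix_of_columns (matrix_column g)"
  by (simp add: matrix_of_columns_def matrix_column_def)

lemma general_linear_iff: "g \<in> general_linear \<longleftrightarrow> det (matrix_of_columns (matrix_column g)) \<noteq> 0"
  unfolding general_linear_def matrix_eq_columns by (simp add: invertible_det_nz)

lemma polynomial_fun_matrix_column: "polynomial_fun (\<lambda>g. matrix_column g j $ i)"
  unfolding matrix_column_def by (simp add: polynomial_fun.coord)

lemma openin_general_linear: "openin zariski general_linear"
proof -
  have "polynomial_fun (\<lambda>g. det (matrix_of_columns (matrix_column g)))"
    by (rule polynomial_fun_det) (simp add: matrix_of_columns_def polynomial_fun_matrix_column)
  from openin_zariski_nonzero[OF this] show ?thesis by (simp add: general_linear_iff[symmetric])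
qed

lemma translate_last_span: "translate g (last_span d) = vec.span (matrix_column g ` tail d)"
proof -
  let ?A = "matrix_of_columns (matrix_column g)"
  have "?A *v axis j 1 = matrix_column g j" for j
    unfolding matrix_of_columns_mult by (simp add: axis_def if_distrib[of "\<lambda>c. c *s _"] cong: if_cong)
  then have "matrix_column g ` tail d = (*v) ?A ` (\<lambda>j. axis j 1) ` tail d"
    by (simp add: image_image)
  then have "vec.span (matrix_column g ` tail d) = (*v) ?A ` vec.span ((\<lambda>j. axis j 1) ` tail d)"
    by (simp add: vec.linear_span_image)
  then show ?thesis
    unfolding translate_def matrix_eq_columns last_span_eq span_axis ..
qed

lemma subspace_translate_last_span: "vec.subspace (translate g (last_span d))"
  unfolding translate_last_span by (rule vec.subspace_span)

lemma dim_translate_last_span: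
  fixes g :: "complex ^ ('n \<times> 'n::{finite,linorder})"
  assumes "g \<in> general_linear" "d \<le> CARD('n)"
  shows "vec.dim (translate g (last_span d)) = d"
proof -
  let ?A = "\<chi> i j. g $ (i, j)"
  have "det ?A \<noteq> 0" using assms(1) unfolding general_linear_iff matrix_eq_columns .
  then have "inj ((*v) ?A)"
    using det_nz_iff_inj_gen[OF matrix_vector_mul_linear_gen[of ?A]] by simp
  then have "vec.dim ((*v) ?A ` last_span d) = vec.dim (last_span d :: (complex ^ 'n::{finite,linorder}) set)"
    by (intro vec.dim_image_eq matrix_vector_mul_linear_gen) (auto intro: inj_on_subset)
  then show ?thesis using dim_last_span[OF assms(2)] unfolding translate_def by simp
qed

lemma translate_last_span_mono: "d \<le> d' \<Longrightarrow> translate g (last_span d) \<subseteq> translate g (last_span d')"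
  unfolding translate_def by (intro image_mono last_span_mono)

lemma translate_in_grassmannian:
  fixes g :: "complex ^ ('n \<times> 'n::{finite,linorder})"
  shows "g \<in> general_linear \<Longrightarrow> d \<le> CARD('n) \<Longrightarrow> translate g (last_span d) \<in> grassmannian d"
  by (simp add: grassmannian_def dim_translate_last_span subspace_translate_last_span)

lemma ex_incidence_equations_translate:
  fixes F :: "(complex ^ 'n::{finite,linorder}) set"
  assumes F: "vec.subspace F" and d: "d \<le> CARD('n)"
  shows "\<exists>P. (\<forall>f\<in>P. polynomial_fun f) \<and> (\<forall>g\<in>general_linear.
    c \<le> vec.dim (translate g (last_span d) \<inter> F) \<longleftrightarrow> (\<forall>f\<in>P. f g = 0))"
proof -
  have "\<exists>P. (\<forall>f\<in>P. polynomial_fun f) \<and>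
    (\<forall>g. vec.dim (vec.span (matrix_column g ` tail d)) = card (tail d :: 'n set) \<longrightarrow>
      (c \<le> vec.dim (vec.span (matrix_column g ` tail d) \<inter> F) \<longleftrightarrow> (\<forall>f\<in>P. f g = 0)))"
    by (rule ex_incidence_equations[OF polynomial_fun_matrix_column F])
  then obtain P where P: "\<forall>f\<in>P. polynomial_fun f"
    "\<forall>g. vec.dim (vec.span (matrix_column g ` tail d)) = card (tail d :: 'n set) \<longrightarrow>
      (c \<le> vec.dim (vec.span (matrix_column g ` tail d) \<inter> F) \<longleftrightarrow> (\<forall>f\<in>P. f g = 0))"
    by (elim exE conjE)
  have "c \<le> vec.dim (translate g (last_span d) \<inter> F) \<longleftrightarrow> (\<forall>f\<in>P. f g = 0)"
    if g: "g \<in> general_linear" for g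
    unfolding translate_last_span
    by (rule P(2)[rule_format])
      (simp only: dim_translate_last_span[OF g d] card_tail[OF d] translate_last_span[symmetric])
  then show ?thesis using P(1) by (intro exI[of _ P]) simp
qed

lemma closedin_incidence_translate:
  fixes F :: "(complex ^ 'n::{finite,linorder}) set"
  assumes "vec.subspace F" "d \<le> CARD('n)"
  shows "closedin (subtopology zariski general_linear)
    {g \<in> general_linear. c \<le> vec.dim (translate g (last_span d) \<inter> F)}"
proof -
  obtain P where P: "\<forall>f\<in>P. polynomial_fun f"
    "\<forall>g\<in>general_linear. c \<le> vec.dim (translate g (last_span d) \<inter> F) \<longleftrightarrow> (\<forall>f\<in>P. f g = 0)"
    using ex_incidence_equations_translate[OF assms] by blast
  then have "{g \<in> general_linear. c \<le> vec.dim (translate g (last_span d) \<inter> F)} =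
      {g. \<forall>f\<in>P. f g = 0} \<inter> general_linear" by auto
  moreover have "closedin zariski {g. \<forall>f\<in>P. f g = 0}"
    using P(1) by (intro closedin_zariski_common_zeros) auto
  ultimately show ?thesis unfolding closedin_subtopology by blast
qed

text \<open>Vectors are chosen one after the other, each outside the span of its predecessors.\<close>

lemma ex_adapted_matrix:
  fixes W :: "nat \<Rightarrow> (complex ^ 'n::{finite,linorder}) set"
  assumes sub: "\<And>m. vec.subspace (W m)" and mono: "\<And>m. W m \<subseteq> W (Suc m)"
    and dim: "\<And>m. m \<le> CARD('n) \<Longrightarrow> m \<le> vec.dim (W m)"
  obtains g where "g \<in> general_linear" "\<And>j. matrix_column g j \<in> W (place j)"
proof -
  have "\<exists>v. (\<forall>m\<in>{1..i}. v m \<in> W m) \<and> vec.dim (vec.span (v ` {1..i})) = i" if "i \<le> CARD('n)" for i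
    using that
  proof (induction i)
    case 0
    then show ?case by simp
  next
    case (Suc i)
    then obtain v where v: "\<forall>m\<in>{1..i}. v m \<in> W m" "vec.dim (vec.span (v ` {1..i})) = i" by auto
    have "\<not> W (Suc i) \<subseteq> vec.span (v ` {1..i})"
    proof
      assume "W (Suc i) \<subseteq> vec.span (v ` {1..i})"
      from vec.dim_subset[OF this] have "vec.dim (W (Suc i)) \<le> i" using v(2) by simp
      then show False using dim[OF Suc.prems] by simp
    qed
    then obtain x where x: "x \<in> W (Suc i)" "x \<notin> vec.span (v ` {1..i})" by blast
    let ?v = "v(Suc i := x)"
    have "?v ` {1..Suc i} = insert x (v ` {1..i})"
      by (auto simp: atLeastAtMostSuc_conv)
    then have "vec.dim (vec.span (?v ` {1..Suc i})) = Suc i"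
      using x(2) v(2) by (simp add: vec.dim_insert)
    moreover have "\<forall>m\<in>{1..Suc i}. ?v m \<in> W m" using v(1) x(1) by auto
    ultimately show ?case by blast
  qed
  then obtain v where v: "\<forall>m\<in>{1..CARD('n)}. v m \<in> W m"
    "vec.dim (vec.span (v ` {1..CARD('n)})) = CARD('n)" by blast
  define g :: "complex ^ ('n \<times> 'n)" where "g = (\<chi> p. v (place (snd p)) $ fst p)"
  have col: "matrix_column g j = v (place j)" for j
    by (simp add: matrix_column_def g_def vec_eq_iff)
  have range: "range (place :: 'n \<Rightarrow> nat) = {1..CARD('n)}"
    using bij_betw_place[where 'n = 'n] by (simp add: bij_betw_def)
  have "range (matrix_column g) = v ` {1..CARD('n)}"
    unfolding range[symmetric] by (auto simp: col)
  then have "vec.span (range (matrix_column g)) = UNIV"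
    using v(2) by (intro vec.subspace_dim_equal) (simp_all add: card_cart_basis)
  then have "g \<in> general_linear" unfolding general_linear_iff det_matrix_of_columns_nonzero_iff .
  moreover have "matrix_column g j \<in> W (place j)" for j
    using v(1) range col by auto
  ultimately show thesis using that by blast
qed

section \<open>Irreducible families of matrices\<close>

text \<open>A condition on where the columns of a matrix lie with respect to the standard flag. It is
  expressed as the vanishing of entries, so that it defines a linear subspace of the space of matrices,
  whose invertible members form an irreducible set.\<close>

definition column_conditions :: "nat \<Rightarrow> (nat \<Rightarrow> nat) \<Rightarrow> (nat \<Rightarrow> nat) \<Rightarrow> (complex ^ ('n \<times> 'n::{finite,linorder})) set" where
  "column_conditions r c N = coord_space {(i, j). \<forall>t\<in>{1..r}. place j \<le> c t \<longrightarrow> place i \<le> N t}"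

lemma column_conditions_iff:
  "g \<in> column_conditions r c N \<longleftrightarrow>
    (\<forall>t\<in>{1..r}. \<forall>j. place j \<le> c t \<longrightarrow> matrix_column g j \<in> last_span (N t))"
  unfolding column_conditions_def coord_space_def in_last_span_iff matrix_column_def by auto

lemma translate_subset_if_column_conditions:
  assumes "g \<in> column_conditions r c N" "t \<in> {1..r}" "d \<le> c t"
  shows "translate g (last_span d) \<subseteq> last_span (N t)"
  unfolding translate_last_span
  using assms by (intro vec.span_minimal subspace_last_span) (auto simp: column_conditions_iff)

lemma incidence_if_column_conditions:
  fixes g :: "complex ^ ('n \<times> 'n::{finite,linorder})"
  assumes g: "g \<in> general_linear" "g \<in> column_conditions r c N" and t: "t \<in> {1..r}"
    and d: "c t \<le> d" "c t \<le> CARD('n)"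
  shows "c t \<le> vec.dim (translate g (last_span d) \<inter> last_span (N t))"
proof -
  have "translate g (last_span (c t)) \<subseteq> translate g (last_span d) \<inter> last_span (N t)"
    using translate_subset_if_column_conditions[OF g(2) t order_refl] translate_last_span_mono[OF d(1)]
    by blast
  from vec.dim_subset[OF this] show ?thesis using dim_translate_last_span[OF g(1) d(2)] by simp
qed

lemma translate_eqI:
  fixes g :: "complex ^ ('n \<times> 'n::{finite,linorder})"
  assumes "g \<in> general_linear" "d \<le> CARD('n)" "vec.subspace U" "vec.dim U = d"
    and "\<And>j. place j \<le> d \<Longrightarrow> matrix_column g j \<in> U"
  shows "translate g (last_span d) = U"
proof (rule vec.subspace_dim_equal)
  show "translate g (last_span d) \<subseteq> U"
    unfolding translate_last_span using assms(3,5) by (intro vec.span_minimal) auto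
qed (use assms in \<open>simp_all add: subspace_translate_last_span dim_translate_last_span\<close>)

text \<open>The \<open>m\<close>-th vector of the basis is sought in \<open>V\<close> intersected with the smallest member of the flag
  that the conditions allow; this intersection has dimension at least \<open>m\<close>.\<close>

lemma ex_translate_with_column_conditions:
  fixes V :: "(complex ^ 'n::{finite,linorder}) set"
  assumes V: "V \<in> grassmannian k" and c: "\<And>t. t \<in> {1..r} \<Longrightarrow> c t \<le> vec.dim (V \<inter> last_span (N t))"
    and N: "\<And>s t. s \<in> {1..r} \<Longrightarrow> t \<in> {1..r} \<Longrightarrow> s \<le> t \<Longrightarrow> N s \<le> N t"
  obtains g where "g \<in> general_linear" "g \<in> column_conditions r c N" "translate g (last_span k) = V"
proof -
  have sub: "vec.subspace V" "vec.dim V = k" using V unfolding grassmannian_def by auto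
  have k: "k \<le> CARD('n)"
    using vec.dim_subset[OF subset_UNIV[of V]] sub(2) by (simp add: card_cart_basis)
  have ck: "c t \<le> k" if "t \<in> {1..r}" for t
    using c[OF that] vec.dim_subset[of "V \<inter> last_span (N t)" V] sub(2) by simp
  define W where "W = (\<lambda>m. {x. (m \<le> k \<longrightarrow> x \<in> V) \<and> (\<forall>t\<in>{1..r}. m \<le> c t \<longrightarrow> x \<in> last_span (N t))})"
  have subW: "vec.subspace (W m)" for m
    unfolding W_def
    by (intro vec.subspaceI)
       (auto intro: vec.subspace_0 vec.subspace_add vec.subspace_scale subspace_last_span sub(1))
  have monoW: "W m \<subseteq> W (Suc m)" for m unfolding W_def by auto
  have dimW: "m \<le> vec.dim (W m)" if m: "m \<le> CARD('n)" for m
  proof (cases "\<exists>t\<in>{1..r}. m \<le> c t")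
    case True
    define T where "T = {t \<in> {1..r}. m \<le> c t}"
    have "finite T" unfolding T_def by simp
    have "T \<noteq> {}" using True unfolding T_def by blast
    define t where "t = Min T"
    have "t \<in> T" unfolding t_def by (rule Min_in) fact+
    then have t: "t \<in> {1..r}" "m \<le> c t" unfolding T_def by auto
    have "V \<inter> last_span (N t) \<subseteq> W m"
    proof
      fix x assume x: "x \<in> V \<inter> last_span (N t)"
      have "x \<in> last_span (N t')" if t': "t' \<in> {1..r}" "m \<le> c t'" for t'
      proof -
        have "t' \<in> T" using t' unfolding T_def by blast
        then have "t \<le> t'" unfolding t_def using \<open>finite T\<close> by (intro Min_le)
        then show ?thesis using N[OF t(1) t'(1)] x last_span_mono by blast
      qed
      then show "x \<in> W m" using x unfolding W_def by blast
    qed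
    from vec.dim_subset[OF this] show ?thesis using c[OF t(1)] t(2) by simp
  next
    case False
    show ?thesis
    proof (cases "m \<le> k")
      case True
      then have "W m = V" using False unfolding W_def by auto
      then show ?thesis using True sub(2) by simp
    next
      case nk: False
      then have "W m = UNIV" using False unfolding W_def by auto
      then show ?thesis using m by (simp add: card_cart_basis)
    qed
  qed
  obtain g where g: "g \<in> general_linear" "\<And>j. matrix_column g j \<in> W (place j)"
    using ex_adapted_matrix[of W, OF subW monoW dimW] by blast
  have "g \<in> column_conditions r c N" using g(2) unfolding column_conditions_iff W_def by blast
  moreover have "translate g (last_span k) = V"
    using g sub k unfolding W_def by (intro translate_eqI) auto
  ultimately show thesis using that g(1) by blast
qed

lemma irreducible_column_conditions:
  fixes g :: "complex ^ ('n \<times> 'n::{finite,linorder})"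
  assumes "g \<in> general_linear" "g \<in> column_conditions r c N"
  shows "irreducible_in zariski (column_conditions r c N \<inter> general_linear :: (complex ^ ('n \<times> 'n)) set)"
  using assms unfolding column_conditions_def
  by (intro irreducible_in_Int_open irreducible_in_zariski_subspace subspace_coord_space
      openin_general_linear) auto

section \<open>Loci in the Grassmannian\<close>

lemma closedin_grassmannian_incidence:
  fixes F :: "(complex ^ 'n::{finite,linorder}) set"
  assumes k: "k \<le> CARD('n)" and F: "vec.subspace F"
  shows "closedin (grassmannian_topology k) {V \<in> grassmannian k. c \<le> vec.dim (V \<inter> F)}"
proof -
  have "{g \<in> topspace (subtopology zariski general_linear).
      translate g (last_span k) \<in> {V \<in> grassmannian k. c \<le> vec.dim (V \<inter> F)}} =
    {g \<in> general_linear. c \<le> vec.dim (translate g (last_span k) \<inter> F)}"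
    using translate_in_grassmannian[OF _ k] by auto
  then show ?thesis
    unfolding grassmannian_topology_def
    using closedin_incidence_translate[OF F k] translate_in_grassmannian[OF _ k]
    by (subst closedin_final_topology) auto
qed

text \<open>These loci turn out to be the components of the singular locus.\<close>

definition jump_locus ::
  "nat \<Rightarrow> nat \<Rightarrow> (nat \<Rightarrow> nat) \<Rightarrow> (nat \<Rightarrow> nat) \<Rightarrow> nat \<Rightarrow> (complex ^ 'n::{finite,linorder}) set set" where
  "jump_locus k r a M s = {V \<in> incidence_variety k r a M. a s < vec.dim (V \<inter> last_span (a s + M s))}"

lemma all_le_with_one_strict_iff:
  fixes a f :: "nat \<Rightarrow> nat"
  assumes "s \<in> R"
  shows "(\<forall>t\<in>R. a t \<le> f t) \<and> a s < f s \<longleftrightarrow> (\<forall>t\<in>R. (a(s := Suc (a s))) t \<le> f t)"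
proof
  assume R: "\<forall>t\<in>R. (a(s := Suc (a s))) t \<le> f t"
  have "a t \<le> f t" if "t \<in> R" for t
    using bspec[OF R that] by (cases "t = s") auto
  moreover have "a s < f s" using bspec[OF R assms] by simp
  ultimately show "(\<forall>t\<in>R. a t \<le> f t) \<and> a s < f s" by blast
qed auto

text \<open>Again a locus given by incidence conditions, with the bound in condition \<open>s\<close> raised by one.\<close>

lemma jump_locus_eq:
  assumes "s \<in> {1..r}"
  shows "(jump_locus k r a M s :: (complex ^ 'n::{finite,linorder}) set set) =
    {V \<in> grassmannian k. \<forall>t\<in>{1..r}. (a(s := Suc (a s))) t \<le> vec.dim (V \<inter> last_span (a t + M t))}"
proof -
  have "(\<forall>t\<in>{1..r}. a t \<le> vec.dim (V \<inter> last_span (a t + M t))) \<and> a s < vec.dim (V \<inter> last_span (a s + M s)) \<longleftrightarrow>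
      (\<forall>t\<in>{1..r}. (a(s := Suc (a s))) t \<le> vec.dim (V \<inter> last_span (a t + M t)))" for V :: "(complex ^ 'n::{finite,linorder}) set"
    by (rule all_le_with_one_strict_iff[OF assms, of a "\<lambda>t. vec.dim (V \<inter> last_span (a t + M t))"])
  then show ?thesis unfolding jump_locus_def incidence_variety_def by blast
qed

lemma incidence_data_place_mono:
  assumes "incidence_data n k r a M" "s \<in> {1..r}" "t \<in> {1..r}" "s \<le> t"
  shows "a s + M s \<le> a t + M t"
  using assms unfolding incidence_data_def by (metis add_mono le_eq_less_or_eq)

lemma jump_locus_eq_image:
  assumes data: "incidence_data CARD('n) k r a M" and s: "s \<in> {1..r}"
  shows "jump_locus k r a M s = (\<lambda>g. translate g (last_span k)) `
    (column_conditions r (a(s := Suc (a s))) (\<lambda>t. a t + M t) \<inter>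
      (general_linear :: (complex ^ ('n \<times> 'n::{finite,linorder})) set))"
    (is "_ = ?q ` (?L \<inter> _)")
proof (intro equalityI subsetI)
  fix V :: "(complex ^ 'n::{finite,linorder}) set"
  assume "V \<in> jump_locus k r a M s"
  then have V: "V \<in> grassmannian k"
    "\<And>t. t \<in> {1..r} \<Longrightarrow> (a(s := Suc (a s))) t \<le> vec.dim (V \<inter> last_span (a t + M t))"
    unfolding jump_locus_eq[OF s] by auto
  obtain g where "g \<in> general_linear" "g \<in> ?L" "translate g (last_span k) = V"
    using ex_translate_with_column_conditions[OF V incidence_data_place_mono[OF data]] .
  then show "V \<in> ?q ` (?L \<inter> general_linear)" by blast
next
  fix V assume "V \<in> ?q ` (?L \<inter> general_linear)"
  then obtain g where g: "g \<in> general_linear" "g \<in> ?L" "V = ?q g" by blast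
  have le: "(a(s := Suc (a s))) t \<le> k" if "t \<in> {1..r}" for t
  proof -
    have "a t < k" "a s < k" using data that s unfolding incidence_data_def by blast+
    then show ?thesis by simp
  qed
  have k: "k \<le> CARD('n)" using data unfolding incidence_data_def by simp
  show "V \<in> jump_locus k r a M s"
    unfolding jump_locus_eq[OF s] g(3)
  proof (intro CollectI conjI ballI)
    show "?q g \<in> grassmannian k" by (rule translate_in_grassmannian[OF g(1) k])
    fix t assume t: "t \<in> {1..r}"
    show "(a(s := Suc (a s))) t \<le> vec.dim (?q g \<inter> last_span (a t + M t))"
      by (rule incidence_if_column_conditions[OF g(1,2) t le[OF t] order_trans[OF le[OF t] k]])
  qed
qed

text \<open>Used to prescribe the dimensions in which a coordinate subspace meets members of the standard
  flag.\<close>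

lemma ex_set_with_counts:
  fixes N c :: "nat \<Rightarrow> nat"
  assumes "N 0 = 0" "c 0 = 0"
    and "\<And>u. u < R \<Longrightarrow> N u \<le> N (Suc u) \<and> c u \<le> c (Suc u) \<and> c (Suc u) + N u \<le> c u + N (Suc u)"
  shows "\<exists>P \<subseteq> {1..N R}. \<forall>u\<le>R. card (P \<inter> {1..N u}) = c u"
  using assms(3)
proof (induction R)
  case 0
  then show ?case using assms(1,2) by auto
next
  case (Suc R)
  have "\<And>u. u < R \<Longrightarrow> N u \<le> N (Suc u) \<and> c u \<le> c (Suc u) \<and> c (Suc u) + N u \<le> c u + N (Suc u)"
    using Suc.prems by simp
  from Suc.IH[OF this] obtain P where P: "P \<subseteq> {1..N R}" "\<forall>u\<le>R. card (P \<inter> {1..N u}) = c u" by blast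
  have step: "N R \<le> N (Suc R)" "c R \<le> c (Suc R)" "c (Suc R) + N R \<le> c R + N (Suc R)"
    using Suc.prems[of R] by auto
  have "N u \<le> N R" if "u \<le> R" for u
    using that Suc.prems by (induction R) (auto simp: le_Suc_eq intro: order_trans)
  note NR = this
  have "c (Suc R) - c R \<le> card {N R<..N (Suc R)}" using step by simp
  then obtain Q where Q: "Q \<subseteq> {N R<..N (Suc R)}" "card Q = c (Suc R) - c R"
    by (rule obtain_subset_with_card_n)
  have finite: "finite P" "finite Q" using P(1) Q(1) by (auto intro: finite_subset)
  have "card ((P \<union> Q) \<inter> {1..N u}) = c u" if u: "u \<le> Suc R" for u
  proof (cases "u \<le> R")
    case True
    then have "(P \<union> Q) \<inter> {1..N u} = P \<inter> {1..N u}" using NR[OF True] Q(1) by fastforce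
    then show ?thesis using P(2) True by simp
  next
    case False
    then have "u = Suc R" using u by simp
    have "(P \<union> Q) \<inter> {1..N (Suc R)} = P \<union> Q" using P(1) Q(1) step(1) by fastforce
    moreover have "P \<inter> Q = {}" using P(1) Q(1) by fastforce
    moreover have "card P = c R" using P by (metis inf.absorb1 order_refl)
    ultimately show ?thesis
      using \<open>u = Suc R\<close> Q(2) finite step(2) by (simp add: card_Un_disjoint)
  qed
  moreover have "P \<union> Q \<subseteq> {1..N (Suc R)}" using P(1) Q(1) step(1) by fastforce
  ultimately show ?case by blast
qed

lemma dim_coord_space_Int_last_span:
  "vec.dim (coord_space J \<inter> last_span N) = card (J \<inter> tail N)"
proof -
  have "coord_space J \<inter> last_span N = coord_space (J \<inter> tail N)"
    unfolding last_span_eq coord_space_def by auto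
  then show ?thesis by simp
qed

text \<open>A coordinate subspace in which condition \<open>s\<close> fails to be sharp by one and every other
  condition is sharp.\<close>

lemma ex_generic_member_of_jump_locus:
  assumes data: "incidence_data CARD('n::{finite,linorder}) k r a M" and s: "s \<in> {1..r}"
  obtains V :: "(complex ^ 'n::{finite,linorder}) set" where "V \<in> jump_locus k r a M s"
    "\<And>t. t \<in> {1..r} \<Longrightarrow> t \<noteq> s \<Longrightarrow> vec.dim (V \<inter> last_span (a t + M t)) = a t"
proof -
  let ?n = "CARD('n)"
  let ?a = "a(s := Suc (a s))"
  define N where "N = (\<lambda>u. if u = 0 then 0 else if u \<le> r then a u + M u else ?n)"
  define c where "c = (\<lambda>u. if u = 0 then 0 else if u \<le> r then ?a u else k)"
  have one: "0 < a t" "a t < k" "0 < M t" "M t < ?n - k" if "t \<in> {1..r}" for t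
    using data that unfolding incidence_data_def by auto
  have two: "a t < a (Suc t)" "M t < M (Suc t)" if "t \<in> {1..r}" "Suc t \<in> {1..r}" for t
    using data that unfolding incidence_data_def by (meson lessI)+
  have kn: "k < ?n" using data unfolding incidence_data_def by simp
  have step: "N u \<le> N (Suc u) \<and> c u \<le> c (Suc u) \<and> c (Suc u) + N u \<le> c u + N (Suc u)" if u: "u < Suc r" for u
  proof -
    consider "u = 0" "r = 0" | "u = 0" "0 < r" | "0 < u" "u < r" | "0 < u" "u = r" using u by linarith
    then show ?thesis
    proof cases
      case 1
      then show ?thesis using kn by (simp add: N_def c_def)
    next
      case 2
      then have "(1::nat) \<in> {1..r}" by simp
      then show ?thesis using 2 one[of 1] by (auto simp: N_def c_def)
    next
      case 3
      then have "u \<in> {1..r}" "Suc u \<in> {1..r}" by auto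
      then show ?thesis using 3 two[of u] by (auto simp: N_def c_def)
    next
      case 4
      then have "u \<in> {1..r}" by auto
      then show ?thesis using 4 one[of u] kn by (auto simp: N_def c_def)
    qed
  qed
  obtain P where P: "P \<subseteq> {1..N (Suc r)}" "\<forall>u\<le>Suc r. card (P \<inter> {1..N u}) = c u"
    using ex_set_with_counts[of N c "Suc r", OF _ _ step] by (auto simp: N_def c_def)
  have Pn: "P \<subseteq> {1..?n}" using P(1) by (simp add: N_def)
  define J :: "'n set" where "J = {j. place j \<in> P}"
  have count: "card (J \<inter> tail m) = card (P \<inter> {1..m})" for m
  proof -
    have "J \<inter> tail m = {j. place j \<in> P \<inter> {1..m}}" using place_pos by (auto simp: J_def Suc_le_eq)
    moreover have "P \<inter> {1..m} \<subseteq> {1..?n}" using Pn by auto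
    ultimately show ?thesis using card_place_vimage by metis
  qed
  have "card J = k"
  proof -
    have "card J = card P" unfolding J_def by (rule card_place_vimage[OF Pn])
    also have "\<dots> = card (P \<inter> {1..N (Suc r)})" using P(1) by (simp add: inf.absorb1)
    also have "\<dots> = k" using P(2) by (simp add: c_def)
    finally show ?thesis .
  qed
  have dims: "vec.dim (coord_space J \<inter> last_span (a t + M t)) = ?a t" if t: "t \<in> {1..r}" for t
  proof -
    have "N t = a t + M t" "c t = ?a t" using t by (auto simp: N_def c_def)
    then show ?thesis unfolding dim_coord_space_Int_last_span count using P(2) t by (metis atLeastAtMost_iff le_SucI)
  qed
  have "coord_space J \<in> jump_locus k r a M s"
    unfolding jump_locus_eq[OF s] using dims \<open>card J = k\<close>
    by (simp add: grassmannian_def subspace_coord_space)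
  then show thesis using that[of "coord_space J"] dims by simp
qed

lemma jump_locus_subset_imp_eq:
  assumes data: "incidence_data CARD('n::{finite,linorder}) k r a M" and "s \<in> {1..r}" "t \<in> {1..r}"
    and sub: "(jump_locus k r a M s :: (complex ^ 'n::{finite,linorder}) set set) \<subseteq> jump_locus k r a M t"
  shows "s = t"
proof (rule ccontr)
  assume "s \<noteq> t"
  obtain V :: "(complex ^ 'n::{finite,linorder}) set" where V: "V \<in> jump_locus k r a M s"
    "\<And>t. t \<in> {1..r} \<Longrightarrow> t \<noteq> s \<Longrightarrow> vec.dim (V \<inter> last_span (a t + M t)) = a t"
    using ex_generic_member_of_jump_locus[OF data assms(2)] by blast
  have "a t < vec.dim (V \<inter> last_span (a t + M t))" using V(1) sub unfolding jump_locus_def by blast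
  then show False using V(2)[OF assms(3)] \<open>s \<noteq> t\<close> by simp
qed

lemma closedin_jump_locus:
  assumes data: "incidence_data CARD('n::{finite,linorder}) k r a M" and s: "s \<in> {1..r}"
  shows "closedin (grassmannian_topology k) (jump_locus k r a M s :: (complex ^ 'n::{finite,linorder}) set set)"
proof -
  have k: "k \<le> CARD('n)" using data unfolding incidence_data_def by simp
  have "(jump_locus k r a M s :: (complex ^ 'n::{finite,linorder}) set set) = (\<Inter>t\<in>{1..r}.
      {V \<in> grassmannian k. (a(s := Suc (a s))) t \<le> vec.dim (V \<inter> last_span (a t + M t))})"
    unfolding jump_locus_eq[OF s] using s by blast
  moreover have "closedin (grassmannian_topology k)
      {V \<in> grassmannian k. (a(s := Suc (a s))) t \<le> vec.dim (V \<inter> (last_span (a t + M t) :: (complex ^ 'n::{finite,linorder}) set))}" for t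
    by (rule closedin_grassmannian_incidence[OF k subspace_last_span])
  moreover have "{1..r} \<noteq> {}" using s by blast
  ultimately show ?thesis by (simp only:) (rule closedin_INT)
qed

lemma irreducible_jump_locus:
  assumes data: "incidence_data CARD('n::{finite,linorder}) k r a M" and s: "s \<in> {1..r}"
  shows "irreducible_in (grassmannian_topology k)
    (jump_locus k r a M s :: (complex ^ 'n::{finite,linorder}) set set)"
proof -
  let ?L = "column_conditions r (a(s := Suc (a s))) (\<lambda>t. a t + M t) :: (complex ^ ('n \<times> 'n)) set"
  have k: "k \<le> CARD('n)" using data unfolding incidence_data_def by simp
  obtain V :: "(complex ^ 'n::{finite,linorder}) set" where "V \<in> jump_locus k r a M s"
    using ex_generic_member_of_jump_locus[OF data s] .
  then obtain g where "g \<in> ?L" "g \<in> general_linear" unfolding jump_locus_eq_image[OF data s] by blast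
  then have "irreducible_in zariski (?L \<inter> general_linear)" by (intro irreducible_column_conditions)
  then show ?thesis
    unfolding jump_locus_eq_image[OF data s] grassmannian_topology_def
    using translate_in_grassmannian[OF _ k] by (intro irreducible_in_final_topology) auto
qed

section \<open>Loci in the flag manifold\<close>

definition flag_translate ::
  "nat list \<Rightarrow> complex ^ ('n \<times> 'n::{finite,linorder}) \<Rightarrow> (complex ^ 'n::{finite,linorder}) set list" where
  "flag_translate ds g = map (\<lambda>d. translate g (last_span d)) ds"

text \<open>The dimension of the member at list position \<open>i\<close>, where positions start at 0.\<close>

definition flag_dim :: "nat \<Rightarrow> nat \<Rightarrow> (nat \<Rightarrow> nat) \<Rightarrow> nat \<Rightarrow> nat" where
  "flag_dim k r a i = (if i < r then a (Suc i) else k)"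

lemma length_flag_dims [simp]: "length (flag_dims k r a) = Suc r"
  by (simp add: flag_dims_def)

lemma nth_flag_dims: "i \<le> r \<Longrightarrow> flag_dims k r a ! i = flag_dim k r a i"
  by (auto simp: flag_dims_def flag_dim_def nth_append simp del: upt_Suc)

lemma flag_dim_pred: "t \<in> {1..r} \<Longrightarrow> flag_dim k r a (t - 1) = a t"
  by (auto simp: flag_dim_def)

lemma flag_dim_less:
  assumes "incidence_data n k r a M" "i < j" "j \<le> r"
  shows "flag_dim k r a i < flag_dim k r a j"
proof (cases "j < r")
  case True
  then have "Suc i \<in> {1..r}" "Suc j \<in> {1..r}" "Suc i < Suc j" using assms(2) by auto
  then have "a (Suc i) < a (Suc j)" using assms(1) unfolding incidence_data_def by blast
  then show ?thesis using True assms(2) by (simp add: flag_dim_def)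
next
  case False
  then have "Suc i \<in> {1..r}" using assms by auto
  then have "a (Suc i) < k" using assms(1) unfolding incidence_data_def by blast
  then show ?thesis using False assms(2,3) by (simp add: flag_dim_def)
qed

lemma flag_dim_mono:
  assumes "incidence_data n k r a M" "i \<le> j" "j \<le> r"
  shows "flag_dim k r a i \<le> flag_dim k r a j"
  using flag_dim_less[OF assms(1), of i j] assms(2,3) by (cases "i = j") auto

lemma flag_dim_le:
  assumes "incidence_data n k r a M" "i \<le> r"
  shows "flag_dim k r a i \<le> k"
  using flag_dim_mono[OF assms order_refl] by (simp add: flag_dim_def)

lemma partial_flags_iff:
  "Us \<in> partial_flags (flag_dims k r a) \<longleftrightarrow> length Us = Suc r \<and>
    (\<forall>i\<le>r. Us ! i \<in> grassmannian (flag_dim k r a i)) \<and> (\<forall>i j. i \<le> j \<longrightarrow> j \<le> r \<longrightarrow> Us ! i \<subseteq> Us ! j)"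
proof -
  have "sorted_wrt (\<subseteq>) Us \<longleftrightarrow> (\<forall>i j. i \<le> j \<longrightarrow> j \<le> r \<longrightarrow> Us ! i \<subseteq> Us ! j)" if "length Us = Suc r"
  proof
    assume "sorted_wrt (\<subseteq>) Us"
    then have "Us ! i \<subseteq> Us ! j" if "i < j" "j \<le> r" for i j
      using that \<open>length Us = Suc r\<close> unfolding sorted_wrt_iff_nth_less by simp
    then show "\<forall>i j. i \<le> j \<longrightarrow> j \<le> r \<longrightarrow> Us ! i \<subseteq> Us ! j" by (metis le_neq_implies_less order_refl)
  next
    assume "\<forall>i j. i \<le> j \<longrightarrow> j \<le> r \<longrightarrow> Us ! i \<subseteq> Us ! j"
    then show "sorted_wrt (\<subseteq>) Us"
      using \<open>length Us = Suc r\<close> unfolding sorted_wrt_iff_nth_less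
      by (metis less_Suc_eq_le less_imp_le_nat)
  qed
  then show ?thesis
    unfolding partial_flags_def by (auto simp: list_all2_conv_all_nth nth_flag_dims less_Suc_eq_le)
qed

lemma flag_translate_nth:
  "i \<le> r \<Longrightarrow> flag_translate (flag_dims k r a) g ! i = translate g (last_span (flag_dim k r a i))"
  unfolding flag_translate_def by (simp add: nth_flag_dims)

lemma flag_translate_in_partial_flags:
  fixes g :: "complex ^ ('n \<times> 'n::{finite,linorder})"
  assumes data: "incidence_data CARD('n) k r a M" and g: "g \<in> general_linear"
  shows "flag_translate (flag_dims k r a) g \<in> partial_flags (flag_dims k r a)"
  unfolding partial_flags_iff
proof (intro conjI allI impI)
  show "length (flag_translate (flag_dims k r a) g) = Suc r" by (simp add: flag_translate_def)
  fix i assume i: "i \<le> r"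
  have "flag_dim k r a i \<le> CARD('n)"
    using flag_dim_le[OF data i] data unfolding incidence_data_def by simp
  then show "flag_translate (flag_dims k r a) g ! i \<in> grassmannian (flag_dim k r a i)"
    unfolding flag_translate_nth[OF i] by (rule translate_in_grassmannian[OF g])
next
  fix i j assume ij: "i \<le> j" "j \<le> r"
  then show "flag_translate (flag_dims k r a) g ! i \<subseteq> flag_translate (flag_dims k r a) g ! j"
    using flag_dim_mono[OF data ij] by (simp add: flag_translate_nth translate_last_span_mono)
qed

lemma last_flag_translate: "last (flag_translate (flag_dims k r a) g) = translate g (last_span k)"
  by (simp add: flag_translate_def flag_dims_def)

definition incidence_resolution ::
  "nat \<Rightarrow> nat \<Rightarrow> (nat \<Rightarrow> nat) \<Rightarrow> (nat \<Rightarrow> nat) \<Rightarrow> (complex ^ 'n::{finite,linorder}) set list set" where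
  "incidence_resolution k r a M = {Us \<in> partial_flags (flag_dims k r a).
     \<forall>t\<in>{1..r}. Us ! (t - 1) \<subseteq> last_span (a t + M t)}"

lemma incidence_resolutionD:
  assumes "Us \<in> incidence_resolution k r a M"
  shows "length Us = Suc r" "last Us = Us ! r"
    and "\<And>i. i \<le> r \<Longrightarrow> vec.subspace (Us ! i)" "\<And>i. i \<le> r \<Longrightarrow> vec.dim (Us ! i) = flag_dim k r a i"
    and "\<And>i j. i \<le> j \<Longrightarrow> j \<le> r \<Longrightarrow> Us ! i \<subseteq> Us ! j"
    and "\<And>t. t \<in> {1..r} \<Longrightarrow> Us ! (t - 1) \<subseteq> last_span (a t + M t)"
proof -
  show len: "length Us = Suc r" using assms unfolding incidence_resolution_def partial_flags_iff by blast
  then have "Us \<noteq> []" by auto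
  then show "last Us = Us ! r" by (simp add: last_conv_nth len)
qed (use assms in \<open>auto simp: incidence_resolution_def partial_flags_iff grassmannian_def\<close>)

lemma flag_translate_in_resolution:
  fixes g :: "complex ^ ('n \<times> 'n::{finite,linorder})"
  assumes data: "incidence_data CARD('n) k r a M" and g: "g \<in> general_linear"
    and c: "g \<in> column_conditions r c (\<lambda>t. a t + M t)" "\<And>t. t \<in> {1..r} \<Longrightarrow> a t \<le> c t"
  shows "flag_translate (flag_dims k r a) g \<in> incidence_resolution k r a M"
proof -
  have "flag_translate (flag_dims k r a) g ! (t - 1) \<subseteq> last_span (a t + M t)" if t: "t \<in> {1..r}" for t
  proof -
    have "t - 1 \<le> r" using t by auto
    from flag_translate_nth[OF this] show ?thesis
      using translate_subset_if_column_conditions[OF c(1) t c(2)[OF t]]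
      unfolding flag_dim_pred[OF t] by metis
  qed
  then show ?thesis
    unfolding incidence_resolution_def using flag_translate_in_partial_flags[OF data g] by blast
qed

lemma last_image_incidence_resolution:
  assumes data: "incidence_data CARD('n::{finite,linorder}) k r a M"
  shows "last ` incidence_resolution k r a M =
    (incidence_variety k r a M :: (complex ^ 'n::{finite,linorder}) set set)"
proof (intro equalityI subsetI)
  fix V :: "(complex ^ 'n::{finite,linorder}) set"
  assume "V \<in> last ` incidence_resolution k r a M"
  then obtain Us where Us: "Us \<in> incidence_resolution k r a M" "V = Us ! r"
    using incidence_resolutionD(2) by blast
  note U = incidence_resolutionD[OF Us(1)]
  have "V \<in> grassmannian k" using U(3,4)[of r] Us(2) by (simp add: grassmannian_def flag_dim_def)
  moreover have "a t \<le> vec.dim (V \<inter> last_span (a t + M t))" if t: "t \<in> {1..r}" for t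
  proof -
    have t': "t - 1 \<le> r" using t by auto
    have "Us ! (t - 1) \<subseteq> V \<inter> last_span (a t + M t)" using U(5)[OF t' order_refl] U(6)[OF t] Us(2) by blast
    from vec.dim_subset[OF this] show ?thesis unfolding U(4)[OF t'] flag_dim_pred[OF t] .
  qed
  ultimately show "V \<in> incidence_variety k r a M" unfolding incidence_variety_def by blast
next
  fix V :: "(complex ^ 'n::{finite,linorder}) set"
  assume "V \<in> incidence_variety k r a M"
  then have V: "V \<in> grassmannian k" "\<And>t. t \<in> {1..r} \<Longrightarrow> a t \<le> vec.dim (V \<inter> last_span (a t + M t))"
    unfolding incidence_variety_def by auto
  obtain g where g: "g \<in> general_linear" "g \<in> column_conditions r a (\<lambda>t. a t + M t)"
    "translate g (last_span k) = V"
    using ex_translate_with_column_conditions[OF V incidence_data_place_mono[OF data]] .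
  have "flag_translate (flag_dims k r a) g \<in> incidence_resolution k r a M"
    by (rule flag_translate_in_resolution[OF data g(1,2)]) simp
  then show "V \<in> last ` incidence_resolution k r a M"
    using last_flag_translate[of k r a g] g(3) by (metis image_eqI)
qed

text \<open>\<open>Us ! s\<close> is the member after \<open>U s\<close>. With \<open>last Us\<close> instead of it this would be the preimage
  of the locus with index \<open>s\<close>, which may have several components.\<close>

definition exceptional_part ::
  "nat \<Rightarrow> nat \<Rightarrow> (nat \<Rightarrow> nat) \<Rightarrow> (nat \<Rightarrow> nat) \<Rightarrow> nat \<Rightarrow> (complex ^ 'n::{finite,linorder}) set list set" where
  "exceptional_part k r a M s =
     {Us \<in> incidence_resolution k r a M. a s < vec.dim (Us ! s \<inter> last_span (a s + M s))}"

text \<open>If \<open>s\<close> is the last index for which \<open>V\<close> meets its space of the standard flag in more than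
  \<open>U s\<close>, then this intersection is contained in the next member of the flag.\<close>

lemma Union_exceptional_parts:
  assumes data: "incidence_data CARD('n::{finite,linorder}) k r a M"
  shows "{Us \<in> incidence_resolution k r a M. \<exists>t\<in>{1..r}. a t < vec.dim (last Us \<inter> last_span (a t + M t))} =
    (\<Union>s\<in>{1..r}. exceptional_part k r a M s :: (complex ^ 'n::{finite,linorder}) set list set)"
proof (intro equalityI subsetI)
  fix Us :: "(complex ^ 'n::{finite,linorder}) set list"
  assume "Us \<in> {Us \<in> incidence_resolution k r a M.
    \<exists>t\<in>{1..r}. a t < vec.dim (last Us \<inter> last_span (a t + M t))}"
  then have Us: "Us \<in> incidence_resolution k r a M"
    "\<exists>t\<in>{1..r}. a t < vec.dim (last Us \<inter> last_span (a t + M t))" by auto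
  note U = incidence_resolutionD[OF Us(1)]
  have V: "last Us \<in> incidence_variety k r a M" using Us(1) last_image_incidence_resolution[OF data] by blast
  define T where "T = {t \<in> {1..r}. a t < vec.dim (last Us \<inter> last_span (a t + M t))}"
  have T: "finite T" "T \<noteq> {}" using Us(2) unfolding T_def by auto
  define s where "s = Max T"
  have "s \<in> T" unfolding s_def using T by (rule Max_in)
  then have s: "s \<in> {1..r}" "a s < vec.dim (last Us \<inter> last_span (a s + M s))" unfolding T_def by auto
  have "last Us \<inter> last_span (a s + M s) \<subseteq> Us ! s"
  proof (cases "s = r")
    case True
    then show ?thesis using U(2) by simp
  next
    case False
    then have s': "Suc s \<in> {1..r}" using s(1) by auto
    have "Suc s \<notin> T"
      using Max_ge[OF T(1), of "Suc s"] unfolding s_def[symmetric] by auto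
    then have eq: "vec.dim (last Us \<inter> last_span (a (Suc s) + M (Suc s))) \<le> a (Suc s)"
      using s' unfolding T_def by auto
    have sr: "s \<le> r" using s(1) by simp
    have "Us ! s \<subseteq> last Us \<inter> last_span (a (Suc s) + M (Suc s))"
      using U(6)[OF s'] U(5)[OF sr order_refl] U(2) by simp
    moreover have "vec.dim (Us ! s) = a (Suc s)" using U(4)[OF sr] flag_dim_pred[OF s', of k a] by simp
    moreover have "vec.subspace (last Us \<inter> last_span (a (Suc s) + M (Suc s)))"
      using U(3)[of r] U(2) by (intro vec.subspace_inter subspace_last_span) simp
    ultimately have "Us ! s = last Us \<inter> last_span (a (Suc s) + M (Suc s))"
      using U(3)[OF sr] eq by (intro vec.subspace_dim_equal) simp_all
    moreover have "a s + M s \<le> a (Suc s) + M (Suc s)"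
      using incidence_data_place_mono[OF data s(1) s'] by simp
    ultimately show ?thesis using last_span_mono by blast
  qed
  then have "last Us \<inter> last_span (a s + M s) \<subseteq> Us ! s \<inter> last_span (a s + M s)" by blast
  from vec.dim_subset[OF this] have "Us \<in> exceptional_part k r a M s"
    using s(2) Us(1) unfolding exceptional_part_def by auto
  then show "Us \<in> (\<Union>s\<in>{1..r}. exceptional_part k r a M s)" using s(1) by blast
next
  fix Us :: "(complex ^ 'n::{finite,linorder}) set list"
  assume "Us \<in> (\<Union>s\<in>{1..r}. exceptional_part k r a M s)"
  then obtain s where s: "s \<in> {1..r}" "Us \<in> incidence_resolution k r a M"
    "a s < vec.dim (Us ! s \<inter> last_span (a s + M s))" unfolding exceptional_part_def by blast
  note U = incidence_resolutionD[OF s(2)]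
  have "Us ! s \<inter> last_span (a s + M s) \<subseteq> last Us \<inter> last_span (a s + M s)"
    using U(5)[of s r] U(2) s(1) by auto
  from vec.dim_subset[OF this] s
  show "Us \<in> {Us \<in> incidence_resolution k r a M.
      \<exists>t\<in>{1..r}. a t < vec.dim (last Us \<inter> last_span (a t + M t))}"
    by (auto intro: less_le_trans)
qed

text \<open>The \<open>m\<close>-th vector of an adapted basis is sought in the smallest member of the flag of dimension at
  least \<open>m\<close>. The vector with \<open>m = a s + 1\<close> is special: it must also lie in the space of the standard
  flag that contains \<open>U s\<close>, and for this there is room by definition of the part.\<close>

lemma exceptional_part_eq_image:
  assumes data: "incidence_data CARD('n) k r a M" and s: "s \<in> {1..r}"
  shows "exceptional_part k r a M s = flag_translate (flag_dims k r a) `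
    (column_conditions r (a(s := Suc (a s))) (\<lambda>t. a t + M t) \<inter>
      (general_linear :: (complex ^ ('n \<times> 'n::{finite,linorder})) set))"
    (is "_ = ?q ` (?L \<inter> _)")
proof (intro equalityI subsetI)
  let ?d = "flag_dim k r a" and ?F = "last_span (a s + M s) :: (complex ^ 'n::{finite,linorder}) set"
  fix Us :: "(complex ^ 'n::{finite,linorder}) set list"
  assume Us: "Us \<in> exceptional_part k r a M s"
  then have res: "Us \<in> incidence_resolution k r a M" unfolding exceptional_part_def by blast
  note U = incidence_resolutionD[OF res]
  have big: "a s < vec.dim (Us ! s \<inter> ?F)" using Us unfolding exceptional_part_def by blast
  have s': "s - 1 < s" "s \<le> r" "s - 1 \<le> r" using s by auto
  have as: "?d (s - 1) = a s" by (rule flag_dim_pred[OF s])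
  have "a s < k" using data s unfolding incidence_data_def by blast
  define W where "W = (\<lambda>m. {x. (\<forall>i\<le>r. m \<le> ?d i \<longrightarrow> x \<in> Us ! i) \<and> (m \<le> Suc (a s) \<longrightarrow> x \<in> ?F)})"
  have subW: "vec.subspace (W m)" for m
    unfolding W_def
    by (intro vec.subspaceI)
       (auto intro: vec.subspace_0 vec.subspace_add vec.subspace_scale subspace_last_span U(3))
  have monoW: "W m \<subseteq> W (Suc m)" for m unfolding W_def by auto
  have dimW: "m \<le> vec.dim (W m)" if m: "m \<le> CARD('n)" for m
  proof (cases "m \<le> k")
    case False
    then have "W m = UNIV" using flag_dim_le[OF data] \<open>a s < k\<close> unfolding W_def by fastforce
    then show ?thesis using m by (simp add: card_cart_basis)
  next
    case True
    define I where "I = {i. i \<le> r \<and> m \<le> ?d i}"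
    have I: "finite I" "I \<noteq> {}" using True unfolding I_def by (auto simp: flag_dim_def)
    define i where "i = Min I"
    have "i \<in> I" unfolding i_def using I by (rule Min_in)
    then have i: "i \<le> r" "m \<le> ?d i" unfolding I_def by auto
    have least: "i \<le> i'" if "i' \<le> r" "m \<le> ?d i'" for i'
      unfolding i_def using I(1) that by (intro Min_le) (auto simp: I_def)
    show ?thesis
    proof (cases "m = Suc (a s)")
      case m: True
      have "s \<le> i'" if "i' \<le> r" "m \<le> ?d i'" for i'
      proof (rule ccontr)
        assume "\<not> s \<le> i'"
        then have "?d i' \<le> ?d (s - 1)" using s' by (intro flag_dim_mono[OF data]) auto
        then show False using that(2) m as by simp
      qed
      then have "Us ! s \<inter> ?F \<subseteq> W m" using U(5) unfolding W_def by blast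
      from vec.dim_subset[OF this] show ?thesis using big m by simp
    next
      case m: False
      have "Us ! i \<subseteq> ?F" if "m \<le> Suc (a s)"
      proof -
        have "m \<le> ?d (s - 1)" using that m as by simp
        then have "i \<le> s - 1" using least s'(3) by blast
        then show ?thesis using U(5)[of i "s - 1"] U(6)[OF s] s' by blast
      qed
      then have "Us ! i \<subseteq> W m" using U(5)[OF least] unfolding W_def by blast
      from vec.dim_subset[OF this] show ?thesis using i U(4)[OF i(1)] by simp
    qed
  qed
  obtain g where g: "g \<in> general_linear" "\<And>j. matrix_column g j \<in> W (place j)"
    using ex_adapted_matrix[of W, OF subW monoW dimW] by blast
  have "matrix_column g j \<in> last_span (a t + M t)"
    if t: "t \<in> {1..r}" "place j \<le> (a(s := Suc (a s))) t" for t j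
  proof (cases "place j \<le> a t")
    case True
    have "t - 1 \<le> r" using t(1) by auto
    then have "matrix_column g j \<in> Us ! (t - 1)"
      using g(2)[of j] True flag_dim_pred[OF t(1), of k a] unfolding W_def by auto
    then show ?thesis using U(6)[OF t(1)] by blast
  next
    case False
    then have "t = s" using t(2) by (cases "t = s") auto
    then show ?thesis using g(2)[of j] t(2) unfolding W_def by simp
  qed
  then have "g \<in> ?L" unfolding column_conditions_iff by blast
  moreover have "?q g = Us"
  proof (rule nth_equalityI)
    show "length (?q g) = length Us" using U(1) by (simp add: flag_translate_def)
    fix i assume "i < length (?q g)"
    then have i: "i \<le> r" by (simp add: flag_translate_def)
    have "?d i \<le> CARD('n)" using flag_dim_le[OF data i] data unfolding incidence_data_def by simp
    then have "translate g (last_span (?d i)) = Us ! i"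
      using g(2) U(3,4)[OF i] i unfolding W_def by (intro translate_eqI[OF g(1)]) auto
    then show "?q g ! i = Us ! i" by (simp add: flag_translate_nth[OF i])
  qed
  ultimately show "Us \<in> ?q ` (?L \<inter> general_linear)" using g(1) by blast
next
  fix Us assume "Us \<in> ?q ` (?L \<inter> general_linear)"
  then obtain g where g: "g \<in> general_linear" "g \<in> ?L" "Us = ?q g" by blast
  have res: "Us \<in> incidence_resolution k r a M"
    unfolding g(3) by (rule flag_translate_in_resolution[OF data g(1,2)]) simp
  have s': "s - 1 < s" "s \<le> r" using s by auto
  have "a s < flag_dim k r a s"
    using flag_dim_less[OF data s'] unfolding flag_dim_pred[OF s] .
  then have d: "(a(s := Suc (a s))) s \<le> flag_dim k r a s" by simp
  moreover have "flag_dim k r a s \<le> CARD('n)"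
    using flag_dim_le[OF data s'(2)] data unfolding incidence_data_def by simp
  ultimately have "(a(s := Suc (a s))) s \<le>
      vec.dim (translate g (last_span (flag_dim k r a s)) \<inter> last_span (a s + M s))"
    by (intro incidence_if_column_conditions[OF g(1,2) s]) (auto intro: order_trans)
  then show "Us \<in> exceptional_part k r a M s"
    using res g(3) s'(2) unfolding exceptional_part_def by (simp add: flag_translate_nth)
qed

lemma last_image_exceptional_part:
  assumes "incidence_data CARD('n::{finite,linorder}) k r a M" "s \<in> {1..r}"
  shows "last ` exceptional_part k r a M s = (jump_locus k r a M s :: (complex ^ 'n::{finite,linorder}) set set)"
  unfolding exceptional_part_eq_image[OF assms] jump_locus_eq_image[OF assms] image_image
    last_flag_translate ..

lemma flag_topology_eq:
  "flag_topology ds =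
    final_topology (subtopology zariski general_linear) (flag_translate ds) (partial_flags ds)"
  unfolding flag_topology_def flag_translate_def ..

lemma irreducible_exceptional_part:
  assumes data: "incidence_data CARD('n::{finite,linorder}) k r a M" and s: "s \<in> {1..r}"
  shows "irreducible_in (flag_topology (flag_dims k r a))
    (exceptional_part k r a M s :: (complex ^ 'n::{finite,linorder}) set list set)"
proof -
  let ?L = "column_conditions r (a(s := Suc (a s))) (\<lambda>t. a t + M t) :: (complex ^ ('n \<times> 'n)) set"
  obtain V :: "(complex ^ 'n::{finite,linorder}) set" where "V \<in> jump_locus k r a M s"
    using ex_generic_member_of_jump_locus[OF data s] .
  then obtain g where "g \<in> ?L" "g \<in> general_linear" unfolding jump_locus_eq_image[OF data s] by blast
  then have "irreducible_in zariski (?L \<inter> general_linear)" by (intro irreducible_column_conditions)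
  then show ?thesis
    unfolding exceptional_part_eq_image[OF data s] flag_topology_eq
    using flag_translate_in_partial_flags[OF data] by (intro irreducible_in_final_topology) auto
qed

lemma closedin_exceptional_part:
  assumes data: "incidence_data CARD('n::{finite,linorder}) k r a M" and s: "s \<in> {1..r}"
  shows "closedin (flag_topology (flag_dims k r a))
    (exceptional_part k r a M s :: (complex ^ 'n::{finite,linorder}) set list set)"
proof -
  let ?G = "general_linear :: (complex ^ ('n \<times> 'n)) set"
  let ?q = "flag_translate (flag_dims k r a) :: complex ^ ('n \<times> 'n) \<Rightarrow> _"
  have kn: "k \<le> CARD('n)" using data unfolding incidence_data_def by simp
  have n: "flag_dim k r a i \<le> CARD('n)" if "i \<le> r" for i
    using flag_dim_le[OF data that] kn by simp
  have an: "a t \<le> CARD('n)" if "t \<in> {1..r}" for t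
    using data that kn unfolding incidence_data_def by fastforce
  define K where "K = (\<lambda>t. {g \<in> ?G. a t \<le> vec.dim (translate g (last_span (a t)) \<inter> last_span (a t + M t))})"
  define K' where "K' = {g \<in> ?G. Suc (a s) \<le>
    vec.dim (translate g (last_span (flag_dim k r a s)) \<inter> last_span (a s + M s))}"
  have "translate g (last_span (a t)) \<subseteq> last_span (a t + M t) \<longleftrightarrow>
      a t \<le> vec.dim (translate g (last_span (a t)) \<inter> last_span (a t + M t))"
    if g: "g \<in> ?G" and t: "t \<in> {1..r}" for g t
  proof
    assume "translate g (last_span (a t)) \<subseteq> last_span (a t + M t)"
    then have "translate g (last_span (a t)) \<inter> last_span (a t + M t) = translate g (last_span (a t))" by blast
    then show "a t \<le> vec.dim (translate g (last_span (a t)) \<inter> last_span (a t + M t))"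
      using dim_translate_last_span[OF g an[OF t]] by simp
  next
    assume "a t \<le> vec.dim (translate g (last_span (a t)) \<inter> last_span (a t + M t))"
    then have "translate g (last_span (a t)) \<inter> last_span (a t + M t) = translate g (last_span (a t))"
      using dim_translate_last_span[OF g an[OF t]]
      by (intro vec.subspace_dim_equal vec.subspace_inter subspace_translate_last_span subspace_last_span) auto
    then show "translate g (last_span (a t)) \<subseteq> last_span (a t + M t)" by blast
  qed
  moreover have "?q g ! (t - 1) = translate g (last_span (a t))" if "t \<in> {1..r}" for g t
  proof -
    have "t - 1 \<le> r" using that by auto
    then show ?thesis by (simp only: flag_translate_nth flag_dim_pred[OF that])
  qed
  moreover have "?q g ! s = translate g (last_span (flag_dim k r a s))" for g
    using s by (simp add: flag_translate_nth)
  ultimately have "?q g \<in> exceptional_part k r a M s \<longleftrightarrow> g \<in> (\<Inter>t\<in>{1..r}. K t) \<inter> K'" if g: "g \<in> ?G" for g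
    using flag_translate_in_partial_flags[OF data g] g
    unfolding exceptional_part_def incidence_resolution_def K_def K'_def by (auto simp: Suc_le_eq)
  moreover have "K' \<subseteq> ?G" unfolding K'_def by blast
  ultimately have "{g \<in> topspace (subtopology zariski ?G). ?q g \<in> exceptional_part k r a M s} =
      (\<Inter>t\<in>{1..r}. K t) \<inter> K'"
    by auto
  moreover have "closedin (subtopology zariski ?G) ((\<Inter>t\<in>{1..r}. K t) \<inter> K')"
  proof (intro closedin_Int closedin_INT)
    show "{1..r} \<noteq> {}" using s by blast
    show "closedin (subtopology zariski ?G) (K t)" if "t \<in> {1..r}" for t
      unfolding K_def by (rule closedin_incidence_translate[OF subspace_last_span an[OF that]])
    have "s \<le> r" using s by simp
    then show "closedin (subtopology zariski ?G) K'"
      unfolding K'_def by (intro closedin_incidence_translate[OF subspace_last_span n])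
  qed
  moreover have "exceptional_part k r a M s \<subseteq> (partial_flags (flag_dims k r a) :: (complex ^ 'n::{finite,linorder}) set list set)"
    unfolding exceptional_part_def incidence_resolution_def by blast
  moreover have "?q g \<in> partial_flags (flag_dims k r a)" if "g \<in> topspace (subtopology zariski ?G)" for g
    using that flag_translate_in_partial_flags[OF data] by simp
  ultimately show ?thesis unfolding flag_topology_eq by (subst closedin_final_topology) auto
qed

section \<open>The components of the exceptional locus and of the singular locus\<close>

lemma outside_corners_bounds:
  assumes "partition_in_box k m lam" "(x, y) \<in> outside_corners k m lam"
  shows "x \<le> k" "y \<le> m"
proof -
  have "x \<le> k \<and> y \<le> m" if "rectangle_in k lam x y"
  proof -
    have "1 \<in> {1..x}" "1 \<in> {1..k}" "x \<le> k" using that unfolding rectangle_in_def by auto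
    then have "y \<le> lam 1" "lam 1 \<le> m"
      using that assms(1) unfolding rectangle_in_def partition_in_box_def by blast+
    then show ?thesis using \<open>x \<le> k\<close> by simp
  qed
  then show "x \<le> k" "y \<le> m"
    using assms(2) unfolding outside_corners_def proper_outside_corners_def virtual_outside_corners_def
    by auto
qed

text \<open>Strictness of the bounds comes from the two extreme corners, whose indices are 0 and
  \<open>r + 1\<close>.\<close>

lemma incidence_data_of_corners:
  assumes "k < n" "partition_in_box k (n - k) lam"
    and corners: "outside_corners k (n - k) lam = (\<lambda>s. (a s, b s)) ` {0..r + 1}"
    and mono: "strict_mono_on {0..r + 1} a" "strict_antimono_on {0..r + 1} b"
  shows "incidence_data n k r a (\<lambda>t. n - k - b t)"
proof -
  have bounds: "a t \<le> k" "b t \<le> n - k" if "t \<le> r + 1" for t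
  proof -
    have "(a t, b t) \<in> outside_corners k (n - k) lam" unfolding corners using that by auto
    then show "a t \<le> k" "b t \<le> n - k" using outside_corners_bounds[OF assms(2)] by blast+
  qed
  have less: "a s < a t" "b t < b s" if "s < t" "t \<le> r + 1" for s t
    using strict_mono_onD[OF mono(1), of s t] monotone_onD[OF mono(2), of s t] that by auto
  have "0 < a t" "a t < k" "0 < n - k - b t" "n - k - b t < n - k" if "t \<in> {1..r}" for t
    using less[of 0 t] less[of t "r + 1"] bounds[of "r + 1"] bounds[of 0] that by auto
  moreover have "n - k - b s < n - k - b t" if "s \<in> {1..r}" "t \<in> {1..r}" "s < t" for s t
    using less[of s t] bounds[of s] that by auto
  moreover have "a s < a t" if "s \<in> {1..r}" "t \<in> {1..r}" "s < t" for s t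
    using less[of s t] that by auto
  ultimately show ?thesis unfolding incidence_data_def using assms(1) by blast
qed

theorem proposition11p2:
  fixes k n r :: nat and lam a b :: "nat \<Rightarrow> nat"
    and \<Omega> :: "(complex ^ 'n::{finite,linorder}) set set"
  assumes "n = CARD('n::{finite,linorder})" and "0 < k" and "k < n"
    and "partition_in_box k (n - k) lam"
    and "\<Omega> = schubert_variety k lam"
    and corners: "outside_corners k (n - k) lam = (\<lambda>s. (a s, b s)) ` {0..r + 1}"
    and "strict_mono_on {0..r + 1} a" and "strict_antimono_on {0..r + 1} b"
    and image: "last ` resolution_space k r a b = \<Omega>"
  shows "\<exists>h. bij_betw h
           (irreducible_components (flag_topology (flag_dims k r a))
              (exceptional_locus k lam r a b :: (complex ^ 'n::{finite,linorder}) set list set))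
           (irreducible_components (grassmannian_topology k) (singular_locus k \<Omega>))"
proof -
  define M where "M = (\<lambda>t. n - k - b t)"
  have "incidence_data n k r a M"
    unfolding M_def using assms by (intro incidence_data_of_corners)
  then have data: "incidence_data CARD('n) k r a M" using assms(1) by simp
  \<comment> \<open>Positivity of \<open>M t\<close> means that the subtraction of \<open>b t\<close> is not truncated.\<close>
  have "CARD('n) - k + a t - b t = a t + M t" if "t \<in> {1..r}" for t
  proof -
    have "0 < M t" using data that unfolding incidence_data_def by blast
    then show ?thesis using assms(1) unfolding M_def by simp
  qed
  then have resolution: "resolution_space k r a b =
      (incidence_resolution k r a M :: (complex ^ 'n::{finite,linorder}) set list set)"
    unfolding resolution_space_def incidence_resolution_def by auto
  then have \<Omega>: "\<Omega> = incidence_variety k r a M"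
    using image last_image_incidence_resolution[OF data] by simp
  have sing: "singular_locus k \<Omega> = (\<Union>s\<in>{1..r}. jump_locus k r a M s)"
    unfolding \<Omega> singular_locus_incidence_variety[OF data] jump_locus_def by blast
  have "(exceptional_locus k lam r a b :: (complex ^ 'n::{finite,linorder}) set list set) =
      {Us \<in> incidence_resolution k r a M. last Us \<in> singular_locus k \<Omega>}"
    unfolding exceptional_locus_def resolution assms(5) ..
  also have "\<dots> = {Us \<in> incidence_resolution k r a M.
      \<exists>t\<in>{1..r}. a t < vec.dim (last Us \<inter> last_span (a t + M t))}"
    unfolding \<Omega> singular_locus_incidence_variety[OF data]
    using last_image_incidence_resolution[OF data] by blast
  also have "\<dots> = (\<Union>s\<in>{1..r}. exceptional_part k r a M s)"
    by (rule Union_exceptional_parts[OF data])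
  finally have exc: "(exceptional_locus k lam r a b :: (complex ^ 'n::{finite,linorder}) set list set) =
      (\<Union>s\<in>{1..r}. exceptional_part k r a M s)" .
  have "bij_betw (jump_locus k r a M) {1..r}
      (irreducible_components (grassmannian_topology k) (singular_locus k \<Omega>))"
    unfolding sing
  proof (rule irreducible_components_Union)
    fix s t assume "s \<in> {1..r}" "t \<in> {1..r}"
      and "(jump_locus k r a M s :: (complex ^ 'n::{finite,linorder}) set set) \<subseteq> jump_locus k r a M t"
    then show "s = t" by (rule jump_locus_subset_imp_eq[OF data])
  qed (simp_all only: finite_atLeastAtMost closedin_jump_locus[OF data] irreducible_jump_locus[OF data])
  moreover have "bij_betw (exceptional_part k r a M) {1..r}
      (irreducible_components (flag_topology (flag_dims k r a))
        (exceptional_locus k lam r a b :: (complex ^ 'n::{finite,linorder}) set list set))"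
    unfolding exc
  proof (rule irreducible_components_Union)
    fix s t assume st: "s \<in> {1..r}" "t \<in> {1..r}"
      and "(exceptional_part k r a M s :: (complex ^ 'n::{finite,linorder}) set list set) \<subseteq> exceptional_part k r a M t"
    then have "last ` (exceptional_part k r a M s :: (complex ^ 'n::{finite,linorder}) set list set) \<subseteq>
        last ` exceptional_part k r a M t" by blast
    then show "s = t"
      unfolding last_image_exceptional_part[OF data st(1)] last_image_exceptional_part[OF data st(2)]
      by (rule jump_locus_subset_imp_eq[OF data st])
  qed (simp_all only: finite_atLeastAtMost closedin_exceptional_part[OF data]
      irreducible_exceptional_part[OF data])
  ultimately show ?thesis
    using bij_betw_trans[OF bij_betw_inv_into] by blast
qed

end
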